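(* Let $(H,q)$ be a non-degenerate lattice of rank $n$ and signature $(r,s)$. Then for each of the signatures $(r+3,s)$, $(r+2,s+1)$, $(r+1,s+2)$, $(r,s+3)$ there is an isometric embedding of rational quadratic spaces $(H\otimes_{\mathbb{Z}}\mathbb{Q},q)\hookrightarrow(L_{\mathbb{Q}},q_{st})$, where $L_{\mathbb{Q}}=\mathbb{Q}^{n+3}$ and $q_{st}=\sum_{i=1}^{n+3}\pm z_i^2$ is a diagonal form with all coefficients $\pm1$ having the chosen signature.
   Context: A lattice is a free abelian group with an integer-valued quadratic form; it is non-degenerate if the associated bilinear form is non-degenerate. *)

theory Defs
  imports "Jordan_Normal_Form.Determinant"
begin

text \<open>A lattice of rank n is modelled as Z^n together with an integer-valued quadratic form
  q(x) = x . (A x), where A is the (unique) symmetric rational n x n matrix of q.\<close>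

definition lattice_form :: "nat \<Rightarrow> rat mat \<Rightarrow> bool" where
  "lattice_form n A \<longleftrightarrow> A \<in> carrier_mat n n \<and> transpose_mat A = A \<and>
     (\<forall>y :: int vec. y \<in> carrier_vec n \<longrightarrow>
        (map_vec of_int y) \<bullet> (A *\<^sub>v map_vec of_int y) \<in> \<int>)"

text \<open>Non-degenerate: the associated bilinear form b(x,y) = q(x+y)-q(x)-q(y) = 2 x.(A y)
  is non-degenerate, i.e. det A is nonzero.\<close>
definition nondegenerate_form :: "rat mat \<Rightarrow> bool" where
  "nondegenerate_form A \<longleftrightarrow> det A \<noteq> 0"

definition has_signature :: "rat mat \<Rightarrow> nat \<Rightarrow> nat \<Rightarrow> bool" where
  "has_signature A r s \<longleftrightarrow> (let n = dim_row A in
     r + s \<le> n \<and>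
     (\<exists>P \<in> carrier_mat n n. invertible_mat P \<and>
        transpose_mat P * map_mat (of_rat :: rat \<Rightarrow> real) A * P =
        mat n n (\<lambda>(i,j). if i = j then (if i < r then 1 else if i < r + s then -1 else 0) else 0)))"

definition sign_diag :: "nat \<Rightarrow> nat \<Rightarrow> nat \<Rightarrow> rat mat \<Rightarrow> bool" where
  "sign_diag N r s D \<longleftrightarrow> D \<in> carrier_mat N N \<and> diagonal_mat D \<and>
     (\<forall>i<N. D $$ (i,i) = 1 \<or> D $$ (i,i) = -1) \<and>
     card {i. i < N \<and> D $$ (i,i) = 1} = r \<and> card {i. i < N \<and> D $$ (i,i) = -1} = s"

definition isometric_embedding :: "nat \<Rightarrow> rat mat \<Rightarrow> nat \<Rightarrow> rat mat \<Rightarrow> rat mat \<Rightarrow> bool" where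
  "isometric_embedding n A N D M \<longleftrightarrow> M \<in> carrier_mat N n \<and>
     inj_on (\<lambda>x. M *\<^sub>v x) (carrier_vec n) \<and>
     (\<forall>x \<in> carrier_vec n. (M *\<^sub>v x) \<bullet> (D *\<^sub>v (M *\<^sub>v x)) = x \<bullet> (A *\<^sub>v x))"

end

(* Diagonalize the form over Q as <a_1,...,a_n> with integers a_i. It suffices to find a ternary form B
   of signature (k, 3 - k) such that A + B (orthogonal sum) has vanishing residues in the Witt groups of
   F_p for all odd primes p and a determinant that is +-1 up to squares: by Milnor's descent on the
   largest prime, such a form equals a sum of forms <1> and <-1> in the Grothendieck-Witt group of Q,
   and Witt cancellation turns this into an isometry. At 2 only the determinant matters.

   The form B is a multiple of the pure norm form <x, y, xy> of a quaternion algebra with a given set of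
   odd ramified primes, x being the product of these (and perhaps one more prime) and y = +-n. For n one
   needs prescribed Legendre symbols at the primes of x, and that -x is a square modulo every other prime
   dividing n to an odd power. This is weaker than Dirichlet's theorem: if r(n) is the sum over the
   divisors d of n of chi(d), where chi(l) = (-x/l), then r(n) is positive only if the second condition
   holds, and the sum of r(n) / sqrt n over the n with the prescribed symbols diverges: expanding in
   quadratic characters, the principal one contributes at least the harmonic series, from squares n, and
   all others stay bounded by the hyperbola argument of Dirichlet. *)
theory Submission
  imports Defs "HOL-Combinatorics.Permutations" "HOL-Number_Theory.Number_Theory" "HOL-Library.Poly_Mapping"
begin

subsection \<open>Diagonal forms and Witt cancellation\<close>

text \<open>The three extra dimensions match the obstruction. Parities of valuations fix the
  determinant d of B up to sign and squares, and the signature fixes the sign. At an odd prime the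
  residues of A and of <d> then differ by an even class modulo 4, so a single bit per prime has to
  be corrected. A ternary form of determinant d offers just this bit: it is d times a pure norm
  form, whose residue moves by 2 when the algebra ramifies. A quaternion algebra ramifies at an even
  number of places; the real place is dictated by the signature, and the prime 2, which carries no
  residue condition, absorbs the parity.

  By reciprocity, and because -x is 3 modulo 4, the symbol of -x at l is a product of one character
  of l for each prime of x and the character modulo 4. Symbols of n are prescribed at the primes of
  x only. The factor at 4 stays free, so none of the twists by prescribed symbols can be the whole
  product, and no second divergent sum can cancel the main term. The additional prime in x serves to
  reach this congruence modulo 4.\<close>

definition represents :: "'a::field list \<Rightarrow> nat \<Rightarrow> (nat \<Rightarrow> nat \<Rightarrow> 'a) \<Rightarrow> bool" where
  "represents xs m A \<longleftrightarrow>
     (\<exists>P. \<forall>j<m. \<forall>k<m. (\<Sum>i<length xs. xs ! i * P i j * P i k) = A j k)"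

lemma representsI:
  assumes "\<And>j k. j < m \<Longrightarrow> k < m \<Longrightarrow> (\<Sum>i<length xs. xs ! i * P i j * P i k) = A j k"
  shows "represents xs m A"
  unfolding represents_def by (rule exI[of _ P]) (simp add: assms)

lemma representsE:
  assumes "represents xs m A"
  obtains P where "\<forall>j<m. \<forall>k<m. (\<Sum>i<length xs. xs ! i * P i j * P i k) = A j k"
  using assms unfolding represents_def ..

text \<open>\<open>xs\<close> is the ambient form and \<open>ys\<close> the one pulled back into it.
  The lengths are independent, so isometries and embeddings into larger spaces are covered
  alike.\<close>

definition embeds :: "'a::field list \<Rightarrow> 'a list \<Rightarrow> bool" where
  "embeds xs ys \<longleftrightarrow> represents xs (length ys) (\<lambda>j k. if j = k then ys ! j else 0)"

lemma embedsI:
  assumes "\<And>j k. j < length ys \<Longrightarrow> k < length ys \<Longrightarrow>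
     (\<Sum>i<length xs. xs ! i * P i j * P i k) = (if j = k then ys ! j else 0)"
  shows "embeds xs ys"
  unfolding embeds_def using assms by (rule representsI)

lemma embedsE:
  assumes "embeds xs ys"
  obtains P where "\<forall>j<length ys. \<forall>k<length ys.
     (\<Sum>i<length xs. xs ! i * P i j * P i k) = (if j = k then ys ! j else 0)"
  using representsE[OF assms[unfolded embeds_def]] .

lemma embeds_represents:
  assumes "embeds xs ys" and "represents ys m A"
  shows "represents xs m A"
proof -
  let ?n = "length xs" and ?l = "length ys"
  obtain P where "\<forall>j<?l. \<forall>k<?l.
      (\<Sum>i<?n. xs ! i * P i j * P i k) = (if j = k then ys ! j else 0)"
    using embedsE[OF assms(1)] .
  note P = this[rule_format]
  obtain Q where "\<forall>j<m. \<forall>k<m.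
      (\<Sum>i<?l. ys ! i * Q i j * Q i k) = A j k"
    using representsE[OF assms(2)] .
  note Q = this[rule_format]
  define R where "R = (\<lambda>i j. \<Sum>a<?l. P i a * Q a j)"
  have "(\<Sum>i<?n. xs ! i * R i j * R i k) = A j k" if "j < m" "k < m" for j k
  proof -
    have "(\<Sum>i<?n. xs ! i * R i j * R i k)
        = (\<Sum>i<?n. \<Sum>a<?l. \<Sum>b<?l. Q a j * Q b k * (xs ! i * P i a * P i b))"
      unfolding R_def
      by (intro sum.cong refl, subst mult.assoc, subst sum_product)
        (simp add: sum_distrib_left mult_ac)
    also have "\<dots> = (\<Sum>a<?l. \<Sum>b<?l. \<Sum>i<?n. Q a j * Q b k * (xs ! i * P i a * P i b))"
      by (rule trans[OF sum.swap], rule sum.cong[OF refl], rule sum.swap)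
    also have "\<dots> = (\<Sum>a<?l. \<Sum>b<?l. Q a j * Q b k * (if a = b then ys ! a else 0))"
      by (intro sum.cong refl) (simp add: sum_distrib_left[symmetric] P)
    also have "\<dots> = (\<Sum>a<?l. ys ! a * Q a j * Q a k)"
      by (intro sum.cong refl) (simp add: if_distrib mult_ac cong: if_cong)
    finally show ?thesis using Q[OF that] by simp
  qed
  then show ?thesis by (rule representsI)
qed

lemma embeds_trans: "embeds xs ys \<Longrightarrow> embeds ys zs \<Longrightarrow> embeds xs zs"
  using embeds_represents unfolding embeds_def by blast

lemma embeds_perm:
  assumes "mset xs = mset ys"
  shows "embeds xs ys"
proof -
  obtain p where p: "p permutes {..<length ys}" "permute_list p ys = xs"
    using mset_eq_permutation[OF assms] .
  have len: "length xs = length ys" using assms by (rule mset_eq_length)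
  have nth: "xs ! i = ys ! p i" if "i < length ys" for i
    using p that permute_list_nth by metis
  show ?thesis
  proof (rule embedsI[where P = "\<lambda>i j. if p i = j then 1 else 0"])
    fix j k assume jk: "j < length ys" "k < length ys"
    have "(\<Sum>i<length xs. xs ! i * (if p i = j then 1 else 0) * (if p i = k then 1 else 0))
       = (\<Sum>i<length ys. (\<lambda>a. ys ! a * (if a = j then 1 else 0) * (if a = k then 1 else 0)) (p i))"
      by (intro sum.cong) (auto simp: len nth)
    also have "\<dots> = (\<Sum>a<length ys. ys ! a * (if a = j then 1 else 0) * (if a = k then 1 else 0))"
      by (rule sum.reindex_bij_betw) (rule permutes_imp_bij[OF p(1)])
    also have "\<dots> = (\<Sum>a<length ys. if a = j then (if j = k then ys ! j else 0) else 0)"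
      by (intro sum.cong) auto
    also have "\<dots> = (if j = k then ys ! j else 0)" using jk by simp
    finally show "(\<Sum>i<length xs. xs ! i * (if p i = j then 1 else 0) * (if p i = k then 1 else 0))
        = (if j = k then ys ! j else 0)" .
  qed
qed

lemma embeds_refl: "embeds xs xs"
  by (rule embeds_perm) simp

lemma embeds_drop: "embeds xs (y # ys) \<Longrightarrow> embeds xs ys"
proof -
  assume "embeds xs (y # ys)"
  then obtain P where P: "\<And>j k. j < Suc (length ys) \<Longrightarrow> k < Suc (length ys) \<Longrightarrow>
      (\<Sum>i<length xs. xs ! i * P i j * P i k) = (if j = k then (y # ys) ! j else 0)"
    unfolding embeds_def represents_def by auto
  show ?thesis
    by (rule embedsI[where P = "\<lambda>i j. P i (Suc j)"]) (simp add: P)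
qed

lemma embeds_drop_append: "embeds xs (ys @ zs) \<Longrightarrow> embeds xs zs"
  by (induction ys) (auto dest: embeds_drop)

lemma embeds_Cons:
  assumes "embeds xs ys"
  shows "embeds (z # xs) (z # ys)"
proof -
  obtain P where "\<forall>j<length ys. \<forall>k<length ys.
      (\<Sum>i<length xs. xs ! i * P i j * P i k) = (if j = k then ys ! j else 0)"
    using embedsE[OF assms] .
  note P = this[rule_format]
  define R where "R = (\<lambda>i j. case (i, j) of (0, 0) \<Rightarrow> 1 | (Suc i, Suc j) \<Rightarrow> P i j | _ \<Rightarrow> 0)"
  show ?thesis
  proof (rule embedsI[where P = R])
    fix j k assume "j < length (z # ys)" "k < length (z # ys)"
    then show "(\<Sum>i<length (z # xs). (z # xs) ! i * R i j * R i k)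
       = (if j = k then (z # ys) ! j else 0)"
      by (cases j; cases k) (simp_all add: R_def sum.lessThan_Suc_shift P del: sum.lessThan_Suc)
  qed
qed

lemma embeds_pairI:
  assumes "a * p * p + b * r * r = c" "a * q * q + b * s * s = d" "a * p * q + b * r * s = 0"
  shows "embeds [a, b] [c, d]"
proof (rule embedsI[where P = "\<lambda>i j. if i = 0 then (if j = 0 then p else q) else (if j = 0 then r else s)"])
  fix j k assume "j < length [c, d]" "k < length [c, d]"
  then show "(\<Sum>i<length [a, b]. [a, b] ! i * (if i = 0 then (if j = 0 then p else q) else (if j = 0 then r else s))
      * (if i = 0 then (if k = 0 then p else q) else (if k = 0 then r else s)))
      = (if j = k then [c, d] ! j else 0)"
    using assms by (cases j; cases k) (auto simp: numeral_2_eq_2 mult_ac)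
qed

text \<open>The vector (1, 1) has value a + b, and (-b, a) is orthogonal to it with value a b (a +
  b).\<close>

lemma embeds_binary_sum:
  fixes a b :: "'a::field"
  shows "embeds [a, b] [a + b, a * b * (a + b)]"
  by (rule embeds_pairI[where p = 1 and r = 1 and q = "- b" and s = a]) (simp_all add: algebra_simps)

lemma embeds_binary_sum_rev:
  fixes a b :: "'a::field"
  assumes "a + b \<noteq> 0"
  shows "embeds [a + b, a * b * (a + b)] [a, b]"
\<comment> \<open>The entries are those of the inverse of the matrix with columns (1, 1) and (-b,
  a), whose determinant is a + b.\<close>
proof (rule embeds_pairI[where p = "a / (a + b)" and r = "- 1 / (a + b)" and q = "b / (a + b)" and s = "1 / (a + b)"])
  show "(a + b) * (a / (a + b)) * (a / (a + b)) + a * b * (a + b) * (- 1 / (a + b)) * (- 1 / (a + b)) = a"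
    using assms by (simp add: divide_simps) (simp add: algebra_simps)
  show "(a + b) * (b / (a + b)) * (b / (a + b)) + a * b * (a + b) * (1 / (a + b)) * (1 / (a + b)) = b"
    using assms by (simp add: divide_simps) (simp add: algebra_simps)
  show "(a + b) * (a / (a + b)) * (b / (a + b)) + a * b * (a + b) * (- 1 / (a + b)) * (1 / (a + b)) = 0"
    using assms by (simp add: divide_simps)
qed

lemma embeds_square: "embeds (a # xs) (a * s * s # xs)"
proof (rule embedsI[where P = "\<lambda>i j. if i = j then (if i = 0 then s else 1) else 0"])
  fix j k assume jk: "j < length (a * s * s # xs)" "k < length (a * s * s # xs)"
  have "(\<Sum>i<length (a # xs). (a # xs) ! i * (if i = j then if i = 0 then s else 1 else 0)
       * (if i = k then if i = 0 then s else 1 else 0))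
     = (\<Sum>i<length (a # xs). if i = j then (if j = k then (a * s * s # xs) ! j else 0) else 0)"
    by (intro sum.cong) (auto simp: nth_Cons split: nat.splits)
  also have "\<dots> = (if j = k then (a * s * s # xs) ! j else 0)" using jk by simp
  finally show "(\<Sum>i<length (a # xs). (a # xs) ! i * (if i = j then if i = 0 then s else 1 else 0)
       * (if i = k then if i = 0 then s else 1 else 0))
     = (if j = k then (a * s * s # xs) ! j else 0)" .
qed

lemma embeds_square_rev: "s \<noteq> 0 \<Longrightarrow> embeds (a * s * s # xs) (a # xs)"
  using embeds_square[of "a * s * s" xs "inverse s"] by (simp add: field_simps)

text \<open>Write an isometry \<open>P\<close> of \<open>\<langle>z\<rangle> \<bottom> F\<close> into blocks \<open>\<alpha>, \<beta>\<^sup>T, \<gamma>, C\<close>. Then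
  \<open>C + t \<gamma>\<beta>\<^sup>T\<close> is an isometry for the roots \<open>t\<close> of \<open>((1-\<alpha>)t - 1)((1+\<alpha>)t + 1) = 0\<close>.\<close>

lemma embeds_cancel:
  fixes z :: "'a::field_char_0"
  assumes "embeds (z # xs) (z # ys)" and z: "z \<noteq> 0"
  shows "embeds xs ys"
proof -
  let ?n = "length xs"
  obtain P where P: "\<And>j k. j < Suc (length ys) \<Longrightarrow> k < Suc (length ys) \<Longrightarrow>
      z * P 0 j * P 0 k + (\<Sum>i<?n. xs ! i * P (Suc i) j * P (Suc i) k)
       = (if j = k then (z # ys) ! j else 0)"
    using assms(1) unfolding embeds_def represents_def
    by (auto simp: sum.lessThan_Suc_shift simp del: sum.lessThan_Suc)
  define \<alpha> where "\<alpha> = P 0 0"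
  define \<beta> where "\<beta> j = P 0 (Suc j)" for j
  define \<gamma> where "\<gamma> i = P (Suc i) 0" for i
  define C where "C i j = P (Suc i) (Suc j)" for i j
  \<comment> \<open>For \<alpha> = 1 the first factor is the constant -1 and the second is 2 t + 1,
    with root -1/2.\<close>
  define t where "t = (if \<alpha> = 1 then - 1 / 2 else 1 / (1 - \<alpha>))"
  have t: "((1 - \<alpha>) * t - 1) * ((1 + \<alpha>) * t + 1) = 0"
    by (cases "\<alpha> = 1") (simp_all add: t_def)
  have gg: "(\<Sum>i<?n. xs ! i * \<gamma> i * \<gamma> i) = z - z * \<alpha> * \<alpha>"
    using P[of 0 0] by (simp add: \<alpha>_def \<gamma>_def algebra_simps)
  have gc: "(\<Sum>i<?n. xs ! i * \<gamma> i * C i k) = - z * \<alpha> * \<beta> k" if "k < length ys" for k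
    using P[of 0 "Suc k"] that by (simp add: \<alpha>_def \<beta>_def \<gamma>_def C_def eq_neg_iff_add_eq_0 add.commute)
  have cc: "(\<Sum>i<?n. xs ! i * C i j * C i k) = (if j = k then ys ! j else 0) - z * \<beta> j * \<beta> k"
    if "j < length ys" "k < length ys" for j k
    using P[of "Suc j" "Suc k"] that by (simp add: \<beta>_def C_def algebra_simps)
  show ?thesis
  proof (rule embedsI[where P = "\<lambda>i j. C i j + t * \<gamma> i * \<beta> j"])
    fix j k assume jk: "j < length ys" "k < length ys"
    have "(\<Sum>i<?n. xs ! i * (C i j + t * \<gamma> i * \<beta> j) * (C i k + t * \<gamma> i * \<beta> k))
      = (\<Sum>i<?n. xs ! i * C i j * C i k) + t * \<beta> k * (\<Sum>i<?n. xs ! i * \<gamma> i * C i j)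
        + t * \<beta> j * (\<Sum>i<?n. xs ! i * \<gamma> i * C i k) + t * t * \<beta> j * \<beta> k * (\<Sum>i<?n. xs ! i * \<gamma> i * \<gamma> i)"
      by (simp add: sum_distrib_left sum.distrib[symmetric] algebra_simps)
    also have "\<dots> = (if j = k then ys ! j else 0)
        + z * \<beta> j * \<beta> k * (((1 - \<alpha>) * t - 1) * ((1 + \<alpha>) * t + 1))"
      unfolding gg gc[OF jk(1)] gc[OF jk(2)] cc[OF jk] by (simp add: algebra_simps)
    finally show "(\<Sum>i<?n. xs ! i * (C i j + t * \<gamma> i * \<beta> j) * (C i k + t * \<gamma> i * \<beta> k))
       = (if j = k then ys ! j else 0)" by (simp add: t)
  qed
qed

lemma embeds_append: "embeds xs ys \<Longrightarrow> embeds (zs @ xs) (zs @ ys)"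
  by (induction zs) (auto intro: embeds_Cons)

lemma embeds_append_cancel:
  fixes zs :: "'a::field_char_0 list"
  shows "embeds (zs @ xs) (zs @ ys) \<Longrightarrow> 0 \<notin> set zs \<Longrightarrow> embeds xs ys"
  by (induction zs) (auto dest: embeds_cancel)

subsection \<open>Diagonalization and inertia\<close>

lemma represents_complete_square:
  assumes sym: "\<And>j k. j < Suc n \<Longrightarrow> k < Suc n \<Longrightarrow> A j k = A k j"
    and nz: "A 0 0 \<noteq> 0"
    and xs: "represents xs n (\<lambda>j k. A (Suc j) (Suc k) - A 0 (Suc j) * A 0 (Suc k) / A 0 0)"
  shows "represents (A 0 0 # xs) (Suc n) A"
proof -
  obtain P where "\<forall>j<n. \<forall>k<n.
      (\<Sum>i<length xs. xs ! i * P i j * P i k)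
      = A (Suc j) (Suc k) - A 0 (Suc j) * A 0 (Suc k) / A 0 0"
    using representsE[OF xs] .
  note P = this[rule_format]
  define R where
    "R i j = (case i of 0 \<Rightarrow> A 0 j / A 0 0 | Suc i' \<Rightarrow> (case j of 0 \<Rightarrow> 0 | Suc j' \<Rightarrow> P i' j'))" for i j
  have "(\<Sum>i<length (A 0 0 # xs). (A 0 0 # xs) ! i * R i j * R i k) = A j k"
    if jk: "j < Suc n" "k < Suc n" for j k
  proof -
    have "(\<Sum>i<length (A 0 0 # xs). (A 0 0 # xs) ! i * R i j * R i k)
       = A 0 j * A 0 k / A 0 0 + (\<Sum>i<length xs. xs ! i * R (Suc i) j * R (Suc i) k)"
      using nz by (simp add: R_def sum.lessThan_Suc_shift del: sum.lessThan_Suc)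
    also have "\<dots> = A j k"
    proof (cases "j = 0 \<or> k = 0")
      case True
      then have "(\<Sum>i<length xs. xs ! i * R (Suc i) j * R (Suc i) k) = 0"
        by (intro sum.neutral) (auto simp: R_def)
      then show ?thesis using True nz sym[OF jk(1) zero_less_Suc] by auto
    next
      case False
      then obtain j' k' where "j = Suc j'" "k = Suc k'" by (meson not0_implies_Suc)
      then show ?thesis using jk by (simp add: R_def P)
    qed
    finally show ?thesis .
  qed
  then show ?thesis by (rule representsI)
qed

lemma represents_zero_row:
  assumes row: "\<And>j. j < Suc n \<Longrightarrow> A 0 j = 0 \<and> A j 0 = 0"
    and xs: "represents xs n (\<lambda>j k. A (Suc j) (Suc k))"
  shows "represents (0 # xs) (Suc n) A"
proof -
  obtain P where "\<forall>j<n. \<forall>k<n.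
      (\<Sum>i<length xs. xs ! i * P i j * P i k)
      = A (Suc j) (Suc k)"
    using representsE[OF xs] .
  note P = this[rule_format]
  define R where
    "R i j = (case i of 0 \<Rightarrow> 0 | Suc i' \<Rightarrow> (case j of 0 \<Rightarrow> 0 | Suc j' \<Rightarrow> P i' j'))" for i j
  have "(\<Sum>i<length (0 # xs). (0 # xs) ! i * R i j * R i k) = A j k"
    if "j < Suc n" "k < Suc n" for j k
    using that row[of j] row[of k]
    by (cases j; cases k) (simp_all add: R_def sum.lessThan_Suc_shift P del: sum.lessThan_Suc)
  then show ?thesis by (rule representsI)
qed

text \<open>The change of basis from e_j to e_j + c_j e_i fixes e_i because \<open>c i = 0\<close>,
  so subtracting \<open>c j\<close> times column \<open>i\<close> of \<open>P\<close> undoes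
  it.\<close>

lemma represents_transvection:
  fixes A :: "nat \<Rightarrow> nat \<Rightarrow> 'a::field"
  assumes i: "i < n" and ci: "c i = 0"
    and xs: "represents xs n (\<lambda>j k. A j k + c j * A i k + c k * A j i + c j * c k * A i i)"
  shows "represents xs n A"
proof -
  obtain P where "\<forall>j<n. \<forall>k<n.
      (\<Sum>a<length xs. xs ! a * P a j * P a k)
      = A j k + c j * A i k + c k * A j i + c j * c k * A i i"
    using representsE[OF xs] .
  note P = this[rule_format]
  have "(\<Sum>a<length xs. xs ! a * (P a j - c j * P a i) * (P a k - c k * P a i)) = A j k"
    if jk: "j < n" "k < n" for j k
  proof -
    have "(\<Sum>a<length xs. xs ! a * (P a j - c j * P a i) * (P a k - c k * P a i))
      = (\<Sum>a<length xs. xs ! a * P a j * P a k + (- c k) * (xs ! a * P a j * P a i)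
        + ((- c j) * (xs ! a * P a i * P a k) + c j * c k * (xs ! a * P a i * P a i)))"
      by (intro sum.cong refl) (simp add: algebra_simps)
    also have "\<dots> = (A j k + c j * A i k + c k * A j i + c j * c k * A i i)
        + (- c k) * (A j i + c j * A i i) + ((- c j) * (A i k + c k * A i i) + c j * c k * A i i)"
      unfolding sum.distrib sum_distrib_left[symmetric]
      using P[OF jk] P[OF jk(1) i] P[OF i jk(2)] P[OF i i] ci by simp
    also have "\<dots> = A j k" by (simp add: algebra_simps)
    finally show ?thesis .
  qed
  then show ?thesis by (rule representsI)
qed

theorem symmetric_form_diagonalizable:
  fixes A :: "nat \<Rightarrow> nat \<Rightarrow> 'a::field_char_0"
  assumes "\<And>j k. j < n \<Longrightarrow> k < n \<Longrightarrow> A j k = A k j"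
  shows "\<exists>xs. length xs = n \<and> represents xs n A"
  using assms
proof (induction n arbitrary: A)
  case 0
  then show ?case by (auto simp: represents_def)
next
  case (Suc n)
  have nonzero: "\<exists>xs. length xs = Suc n \<and> represents xs (Suc n) B"
    if "\<And>j k. j < Suc n \<Longrightarrow> k < Suc n \<Longrightarrow> B j k = B k j" "B 0 0 \<noteq> 0" for B :: "nat \<Rightarrow> nat \<Rightarrow> 'a"
  proof -
    obtain xs where "length xs = n" "represents xs n (\<lambda>j k. B (Suc j) (Suc k) - B 0 (Suc j) * B 0 (Suc k) / B 0 0)"
    proof -
      have "B (Suc j) (Suc k) - B 0 (Suc j) * B 0 (Suc k) / B 0 0
          = B (Suc k) (Suc j) - B 0 (Suc k) * B 0 (Suc j) / B 0 0" if "j < n" "k < n" for j k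
        using that \<open>\<And>j k. j < Suc n \<Longrightarrow> k < Suc n \<Longrightarrow> B j k = B k j\<close>[of "Suc j" "Suc k"]
        by simp
      then show ?thesis
        using Suc.IH[of "\<lambda>j k. B (Suc j) (Suc k) - B 0 (Suc j) * B 0 (Suc k) / B 0 0"] that
        by blast
    qed
    moreover from this have "represents (B 0 0 # xs) (Suc n) B"
      by (intro represents_complete_square that)
    ultimately show ?thesis by (intro exI[of _ "B 0 0 # xs"]) simp
  qed
  show ?case
  proof (cases "A 0 0 \<noteq> 0")
    case True
    then show ?thesis by (intro nonzero Suc.prems)
  next
    case A00: False
    show ?thesis
    proof (cases "\<forall>j < Suc n. A 0 j = 0")
      case True
      obtain xs where xs: "length xs = n" "represents xs n (\<lambda>j k. A (Suc j) (Suc k))"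
        using Suc.IH[of "\<lambda>j k. A (Suc j) (Suc k)"] Suc.prems Suc_mono by blast
      have "represents (0 # xs) (Suc n) A"
        by (rule represents_zero_row[OF _ xs(2)]) (metis True Suc.prems zero_less_Suc)
      then show ?thesis using xs(1) by (intro exI[of _ "0 # xs"]) simp
    next
      case False
      then obtain i where i: "i < Suc n" "A 0 i \<noteq> 0" by blast
      then have i0: "i \<noteq> 0" using A00 by metis
      \<comment> \<open>As \<open>A 0 0 = 0\<close>, this is the value of the form at e_0 + t e_i.
        For t = 1 and t = -1 the values differ by 4 \<open>A 0 i\<close>, so one of them is
        nonzero.\<close>
      obtain t :: 'a where t: "2 * t * A 0 i + t * t * A i i \<noteq> 0"
      proof (cases "2 * A 0 i + A i i = 0")
        case True
        then have "2 * (-1) * A 0 i + (-1) * (-1) * A i i \<noteq> 0"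
        proof -
          have "2 * (-1) * A 0 i + (-1) * (-1) * A i i = (2 * A 0 i + A i i) - 4 * A 0 i" by simp
          then have eq: "2 * (-1) * A 0 i + (-1) * (-1) * A i i = - (4 * A 0 i)"
            unfolding True by simp
          show ?thesis unfolding eq using i(2) by simp
        qed
        then show ?thesis by (rule that)
      next
        case False
        then show ?thesis using that[of 1] by simp
      qed
      define c where "c j = (if j = (0::nat) then t else 0)" for j
      define B where "B j k = A j k + c j * A i k + c k * A j i + c j * c k * A i i" for j k
      have "\<exists>xs. length xs = Suc n \<and> represents xs (Suc n) B"
      proof (rule nonzero)
        have "A i 0 = A 0 i" using Suc.prems i(1) by blast
        then show "B 0 0 \<noteq> 0" using t A00 by (simp add: B_def c_def algebra_simps)
        show "B j k = B k j" if "j < Suc n" "k < Suc n" for j k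
        proof -
          have sym: "A j k = A k j" "A i k = A k i" "A j i = A i j"
            using Suc.prems that i by blast+
          show ?thesis unfolding B_def sym by (simp add: algebra_simps)
        qed
      qed
      then show ?thesis
        using represents_transvection[of i "Suc n" c _ A] i(1) i0 unfolding B_def c_def by auto
    qed
  qed
qed

section \<open>Sylvester's law of inertia, from Witt cancellation\<close>

lemma embeds_signs:
  fixes xs :: "real list"
  assumes "0 \<notin> set xs"
  shows "embeds (replicate (length (filter (\<lambda>x. x > 0) xs)) 1
       @ replicate (length (filter (\<lambda>x. x < 0) xs)) (-1)) xs"
  using assms
proof (induction xs)
  case Nil
  then show ?case by (simp add: embeds_refl)
next
  case (Cons x xs)
  let ?r = "length (filter (\<lambda>x. x > 0) xs)" and ?s = "length (filter (\<lambda>x. x < 0) xs)"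
  let ?z = "replicate ?r 1 @ replicate ?s (-1) :: real list"
  have IH: "embeds ?z xs" using Cons by simp
  have scale: "embeds (sgn x # ?z) (x # xs)"
  proof (rule embeds_trans)
    show "embeds (sgn x # ?z) (sgn x # xs)" using IH by (rule embeds_Cons)
    show "embeds (sgn x # xs) (x # xs)"
      using embeds_square[of "sgn x" xs "sqrt \<bar>x\<bar>"] by (simp add: mult.assoc sgn_mult_abs)
  qed
  show ?case
  proof (cases "x > 0")
    case True
    then show ?thesis using scale by simp
  next
    case False
    then have "x < 0" using Cons.prems by auto
    have "embeds (replicate ?r 1 @ replicate (Suc ?s) (-1)) (- 1 # ?z)"
      by (rule embeds_perm) simp
    then show ?thesis using \<open>x < 0\<close> scale embeds_trans by auto
  qed
qed

text \<open>The entry at (0, 0) of such an embedding would exhibit -1 as a sum of squares of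
  reals.\<close>

lemma not_embeds_opposite_sign:
  fixes e :: real
  assumes "b > 0" "e \<noteq> 0"
  shows "\<not> embeds (replicate a e) (replicate b (- e))"
proof
  assume "embeds (replicate a e) (replicate b (- e))"
  then obtain P where "\<forall>j<b. \<forall>k<b. (\<Sum>i<length (replicate a e). replicate a e ! i * P i j * P i k)
      = (if j = k then replicate b (- e) ! j else 0)"
    unfolding embeds_def represents_def by auto
  from this[rule_format, OF assms(1) assms(1)]
  have "(\<Sum>i<a. e * P i 0 * P i 0) = - e" using assms(1) by simp
  then have "e * (\<Sum>i<a. P i 0 * P i 0) = e * (- 1)"
    by (simp add: sum_distrib_left mult.assoc)
  then have "(\<Sum>i<a. P i 0 * P i 0) = - 1" using assms(2) mult_left_cancel by blast
  moreover have "(\<Sum>i<a. P i 0 * P i 0) \<ge> 0" by (intro sum_nonneg) simp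
  ultimately show False by simp
qed

text \<open>Both forms are reduced to signs and their common part is cancelled. If the numbers of
  positive entries differed, a definite form would remain that represents a value of the opposite
  sign.\<close>

theorem sylvester_inertia:
  fixes xs :: "real list"
  assumes xs: "0 \<notin> set xs" and len: "length xs = r + s"
    and emb: "embeds xs (replicate r 1 @ replicate s (-1))"
  shows "length (filter (\<lambda>x. x > 0) xs) = r"
proof -
  let ?p = "length (filter (\<lambda>x. x > 0) xs)" and ?q = "length (filter (\<lambda>x. x < 0) xs)"
  have "filter (\<lambda>x. \<not> x > 0) xs = filter (\<lambda>x. x < 0) xs"
    using xs by (intro filter_cong refl) (metis linorder_less_linear order_less_asym)
  then have pq: "?p + ?q = r + s"
    using sum_length_filter_compl[of "\<lambda>x. x > 0" xs] len by simp
  have emb: "embeds (replicate ?p 1 @ replicate ?q (-1)) (replicate r 1 @ replicate s (-1 :: real))"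
    using embeds_trans[OF embeds_signs[OF xs] emb] .
  show ?thesis
  proof (rule linorder_cases[of ?p r])
    assume less: "?p < r"
    define d where "d = r - ?p"
    have d: "r = ?p + d" "?q = s + d" using less pq by (auto simp: d_def)
    let ?z = "replicate ?p 1 @ replicate s (-1 :: real)"
    have "embeds (?z @ replicate (?q - s) (-1)) (?z @ replicate (r - ?p) (- (- 1)))"
      by (intro embeds_trans[OF embeds_perm embeds_trans[OF emb embeds_perm]])
        (simp_all add: d replicate_add)
    then have "embeds (replicate (?q - s) (-1)) (replicate (r - ?p) (- (- 1 :: real)))"
      by (rule embeds_append_cancel) simp
    then show ?thesis using not_embeds_opposite_sign[of "r - ?p" "-1"] less by simp
  next
    assume less: "r < ?p"
    define d where "d = ?p - r"
    have d: "?p = r + d" "s = ?q + d" using less pq by (auto simp: d_def)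
    let ?z = "replicate r 1 @ replicate ?q (-1 :: real)"
    have "embeds (?z @ replicate (?p - r) 1) (?z @ replicate (s - ?q) (- 1))"
      by (intro embeds_trans[OF embeds_perm embeds_trans[OF emb embeds_perm]])
        (simp_all add: d replicate_add)
    then have "embeds (replicate (?p - r) 1) (replicate (s - ?q) (- 1 :: real))"
      by (rule embeds_append_cancel) simp
    then show ?thesis using not_embeds_opposite_sign[of "s - ?q" 1] less pq by simp
  qed
qed

subsection \<open>Legendre symbols\<close>

lemma Legendre_cong: "[a = b] (mod p) \<Longrightarrow> Legendre a p = Legendre b p"
  by (simp add: Legendre_def QuadRes_def cong_def)

lemma Legendre_values: "\<not> p dvd a \<Longrightarrow> Legendre a p = 1 \<or> Legendre a p = - 1"
  by (auto simp: Legendre_def cong_0_iff)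

lemma Legendre_eq_0_iff: "Legendre a p = 0 \<longleftrightarrow> p dvd a"
  by (auto simp: Legendre_def cong_0_iff)

lemma Legendre_square: "\<not> p dvd a * a \<Longrightarrow> Legendre (a * a) p = 1"
  by (auto simp: Legendre_def QuadRes_def cong_0_iff power2_eq_square intro!: exI[of _ a])

lemma Legendre_euler:
  fixes p :: int
  assumes "prime p" "p > 2"
  shows "[Legendre a p = a ^ ((nat p - 1) div 2)] (mod p)"
proof -
  have "prime (nat p)" using assms(1) prime_int_nat_transfer by blast
  then show ?thesis using euler_criterion[of "nat p" a] assms(2) by simp
qed

lemma sign_cong_imp_eq:
  fixes p :: int
  assumes "p > 2" "x \<in> {-1, 0, 1}" "y \<in> {-1, 0, 1}" "[x = y] (mod p)"
  shows "x = y"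
proof -
  have "p dvd x - y" using assms(4) by (simp add: cong_iff_dvd_diff)
  moreover have "\<bar>x - y\<bar> < p" using assms(1-3) by auto
  ultimately show ?thesis using zdvd_not_zless[of "\<bar>x - y\<bar>" p] by fastforce
qed

lemma Legendre_range: "Legendre a p \<in> {-1, 0, 1}"
  by (auto simp: Legendre_def)

lemma Legendre_mult:
  fixes p :: int
  assumes "prime p" "p > 2"
  shows "Legendre (a * b) p = Legendre a p * Legendre b p"
proof (rule sign_cong_imp_eq[OF assms(2) Legendre_range])
  show "Legendre a p * Legendre b p \<in> {-1, 0, 1}"
    using Legendre_range[of a p] Legendre_range[of b p] by auto
  have "[Legendre a p * Legendre b p = (a * b) ^ ((nat p - 1) div 2)] (mod p)"
    unfolding power_mult_distrib by (intro cong_mult Legendre_euler assms)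
  then show "[Legendre (a * b) p = Legendre a p * Legendre b p] (mod p)"
    using Legendre_euler[OF assms, of "a * b"] cong_sym cong_trans by blast
qed

lemma odd_prime_int:
  fixes p :: int
  assumes "prime p" "p > 2"
  shows "p mod 4 = 1 \<or> p mod 4 = 3"
proof -
  have "odd p" using assms prime_odd_int by blast
  then show ?thesis by presburger
qed

lemma Legendre_minus_one:
  fixes p :: int
  assumes "prime p" "p > 2"
  shows "Legendre (- 1) p = (if p mod 4 = 1 then 1 else - 1)"
proof (rule sign_cong_imp_eq[OF assms(2) Legendre_range])
  have "(- 1) ^ ((nat p - 1) div 2) = (if p mod 4 = 1 then 1 else - 1 :: int)"
  proof -
    have "nat p mod 4 = nat (p mod 4)" using assms(2) nat_mod_distrib[of p 4] by simp
    then have "nat p mod 4 = (if p mod 4 = 1 then 1 else 3)" using odd_prime_int[OF assms] by auto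
    moreover have "q mod 4 = 1 \<Longrightarrow> even ((q - 1) div 2)" "q mod 4 = 3 \<Longrightarrow> odd ((q - 1) div 2)" for q :: nat
      by presburger+
    ultimately have "even ((nat p - 1) div 2) \<longleftrightarrow> p mod 4 = 1" by metis
    then show ?thesis by simp
  qed
  then show "[Legendre (- 1) p = (if p mod 4 = 1 then 1 else - 1)] (mod p)"
    using Legendre_euler[OF assms, of "-1"] by simp
qed auto

text \<open>Equal symbols make a b a square y^2 modulo p, and t = y / a works; \<open>c\<close>
  below is the inverse of a.\<close>

lemma Legendre_eq_imp_square_relation:
  fixes p :: int
  assumes "prime p" "p > 2" "\<not> p dvd a" "Legendre a p = Legendre b p"
  obtains t where "[a * t * t = b] (mod p)" "\<not> p dvd t"
proof -
  have b: "\<not> p dvd b" using assms(3,4) Legendre_eq_0_iff by metis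
  have "\<not> p dvd a * b" using assms b by (simp add: prime_dvd_mult_iff)
  moreover have "Legendre (a * b) p = 1"
    using Legendre_values[OF assms(3)] assms by (auto simp: Legendre_mult)
  ultimately obtain y where y: "[y\<^sup>2 = a * b] (mod p)"
    by (auto simp: Legendre_def QuadRes_def split: if_splits)
  have "coprime a p"
    using assms(1,3) by (meson coprime_commute prime_imp_coprime)
  then obtain c where c: "[a * c = 1] (mod p)"
    by (metis cong_solve_coprime_int)
  have *: "[a * (c * y) * (c * y) = (a * c) * c * y\<^sup>2] (mod p)"
    by (simp add: power2_eq_square mult_ac)
  have "[(a * c) * c * y\<^sup>2 = 1 * c * (a * b)] (mod p)"
    using c y by (intro cong_mult cong_refl)
  also have "[1 * c * (a * b) = (a * c) * b] (mod p)" by (simp add: mult_ac)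
  also have "[(a * c) * b = 1 * b] (mod p)" using c by (intro cong_mult cong_refl)
  finally have t: "[a * (c * y) * (c * y) = b] (mod p)" using * cong_trans by auto
  moreover have "\<not> p dvd c * y" using t b
    by (metis cong_dvd_iff dvd_mult)
  ultimately show ?thesis using that by blast
qed

text \<open>Otherwise squaring maps the units modulo p onto themselves, hence injectively, although
  1 and p - 1 have the same square.\<close>

lemma quadratic_nonresidue_exists:
  fixes p :: int
  assumes "prime p" "p > 2"
  shows "\<exists>u. 1 < u \<and> u < p \<and> Legendre u p = - 1"
proof (rule ccontr)
  assume *: "\<not> ?thesis"
  let ?f = "\<lambda>x. (x * x) mod p"
  have "{1..<p} \<subseteq> ?f ` {1..<p}"
  proof
    fix u assume u: "u \<in> {1..<p}"
    then have nd: "\<not> p dvd u" using zdvd_not_zless[of u p] by auto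
    have "Legendre u p = 1"
    proof (cases "u = 1")
      case True
      then show ?thesis using Legendre_square[of p 1] nd by simp
    next
      case False
      then have "Legendre u p \<noteq> - 1" using * u by auto
      then show ?thesis using Legendre_values[OF nd] by blast
    qed
    then obtain y where y: "[y\<^sup>2 = u] (mod p)"
      by (auto simp: Legendre_def QuadRes_def split: if_splits)
    have "\<not> p dvd y"
    proof
      assume "p dvd y"
      then have "p dvd y\<^sup>2" by (simp add: power2_eq_square)
      then show False using y nd cong_dvd_iff by blast
    qed
    then have "y mod p \<noteq> 0" by (simp add: dvd_eq_mod_eq_0)
    then have "y mod p \<in> {1..<p}"
      using pos_mod_sign[of p y] pos_mod_bound[of p y] assms(2)
      unfolding atLeastLessThan_iff by linarith
    moreover have "u = ?f (y mod p)"
      using y u by (simp add: cong_def power2_eq_square mod_mult_eq)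
    ultimately show "u \<in> ?f ` {1..<p}" by (rule rev_image_eqI)
  qed
  then have "inj_on ?f {1..<p}" by (intro finite_surj_inj) auto
  moreover have "?f 1 = ?f (p - 1)"
  proof -
    have "(p - 1) * (p - 1) = 1 + p * (p - 2)" by (simp add: algebra_simps)
    then have "(p - 1) * (p - 1) mod p = 1 mod p" by (simp only: mod_mult_self2)
    then show ?thesis by (simp only: mult_1)
  qed
  moreover have "1 \<in> {1..<p}" "p - 1 \<in> {1..<p}" using assms(2) by simp_all
  ultimately have "1 = p - 1" by (rule inj_onD)
  then show False using assms(2) by simp
qed

subsection \<open>Residue invariants\<close>

definition unit_part :: "int \<Rightarrow> int \<Rightarrow> int" where
  "unit_part p a = a div p ^ multiplicity p a"

definition unit_symbol :: "int \<Rightarrow> int \<Rightarrow> int" where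
  "unit_symbol p a = Legendre (unit_part p a) p"

text \<open>The second residue \<open>\<partial>\<^sub>p\<close> of \<open>\<langle>a\<rangle>\<close>, followed by a homomorphism from the Witt group of the
  field with \<open>p\<close> elements to \<open>\<int>/4\<close>. That homomorphism is an isomorphism if \<open>p \<equiv> 3\<close>; if
  \<open>p \<equiv> 1\<close> mod 4 it kills the form \<open>\<langle>1\<rangle>\<close> and only becomes injective together with the rank mod 2.\<close>

definition residue_class :: "int \<Rightarrow> int \<Rightarrow> int" where
  "residue_class p a = (if even (multiplicity p a) then 0
     else if p mod 4 = 1 then 1 - unit_symbol p a else unit_symbol p a)"

lemma unit_part_decompose:
  fixes p :: int
  assumes "prime p" "a \<noteq> 0"
  shows "a = p ^ multiplicity p a * unit_part p a" "\<not> p dvd unit_part p a"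
proof -
  show eq: "a = p ^ multiplicity p a * unit_part p a"
    unfolding unit_part_def by (simp add: multiplicity_dvd)
  obtain x where x: "a = p ^ multiplicity p a * x" "\<not> p dvd x"
    using multiplicity_decompose'[of a p] assms not_prime_unit by metis
  have "p ^ multiplicity p a \<noteq> 0" using assms by auto
  then have "x = unit_part p a" using x(1) eq by (metis mult_left_cancel)
  then show "\<not> p dvd unit_part p a" using x(2) by simp
qed

lemma unit_part_eqI:
  fixes p :: int
  assumes "prime p" "\<not> p dvd x" "a = p ^ k * x"
  shows "multiplicity p a = k" "unit_part p a = x"
proof -
  show "multiplicity p a = k"
    using assms by (intro multiplicity_decomposeI[of _ _ _ x]) auto
  then show "unit_part p a = x" using assms by (auto simp: unit_part_def)
qed

lemma unit_symbol_eqI: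
  fixes p :: int
  assumes "prime p" "\<not> p dvd x" "a = p ^ k * x"
  shows "unit_symbol p a = Legendre x p"
  using unit_part_eqI[OF assms] by (simp add: unit_symbol_def)

lemma unit_symbol_values:
  fixes p :: int
  assumes "prime p" "a \<noteq> 0"
  shows "unit_symbol p a = 1 \<or> unit_symbol p a = - 1"
  unfolding unit_symbol_def by (intro Legendre_values unit_part_decompose(2) assms)

lemma multiplicity_prime_mult:
  fixes p :: int
  assumes "prime p" "a \<noteq> 0" "b \<noteq> 0"
  shows "multiplicity p (a * b) = multiplicity p a + multiplicity p b"
  using assms by (intro prime_elem_multiplicity_mult_distrib prime_imp_prime_elem)

lemma unit_symbol_mult:
  fixes p :: int
  assumes p: "prime p" "p > 2" and "a \<noteq> 0" "b \<noteq> 0"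
  shows "unit_symbol p (a * b) = unit_symbol p a * unit_symbol p b"
proof -
  note a = unit_part_decompose[OF p(1) assms(3)] and b = unit_part_decompose[OF p(1) assms(4)]
  have "a * b = p ^ (multiplicity p a + multiplicity p b) * (unit_part p a * unit_part p b)"
    by (subst a(1), subst b(1)) (simp add: power_add mult_ac)
  moreover have "\<not> p dvd unit_part p a * unit_part p b"
    using a(2) b(2) p(1) by (simp add: prime_dvd_mult_iff)
  ultimately have "unit_symbol p (a * b) = Legendre (unit_part p a * unit_part p b) p"
    using unit_symbol_eqI[OF p(1)] by blast
  then show ?thesis by (simp add: unit_symbol_def Legendre_mult[OF p])
qed

lemma residue_class_square:
  fixes p :: int
  assumes p: "prime p" "p > 2" and "a \<noteq> 0" "s \<noteq> 0"
  shows "residue_class p (a * s * s) = residue_class p a"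
  using assms unit_symbol_values[OF p(1) assms(4)]
  by (auto simp: residue_class_def multiplicity_prime_mult unit_symbol_mult)

text \<open>Divide by p^v, where v is the valuation of a, and let x, y be the quotients. If p
  divides x + y, the units of a and b are opposite modulo p, and both binary forms have a hyperbolic
  or zero residue. If p divides y but not x + y, then a + b has the class of a, and the fourth entry
  that of b. In the remaining case a, b and a + b have valuation v, and the claim reflects that
  binary forms over the field with p elements are determined by their determinant.\<close>

lemma residue_class_binary_le:
  fixes p :: int
  assumes p: "prime p" "p > 2" and ab: "a \<noteq> 0" "b \<noteq> 0" "a + b \<noteq> 0"
    and le: "multiplicity p a \<le> multiplicity p b"
  shows "4 dvd residue_class p a + residue_class p b - residue_class p (a + b)
             - residue_class p (a * b * (a + b))"
proof -
  define v where "v = multiplicity p a"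
  define x where "x = unit_part p a"
  define y where "y = unit_part p b * p ^ (multiplicity p b - v)"
  have a: "a = p ^ v * x" "\<not> p dvd x"
    using unit_part_decompose[OF p(1) ab(1)] by (simp_all add: v_def x_def)
  have b: "b = p ^ v * y"
  proof -
    have "p ^ multiplicity p b = p ^ v * p ^ (multiplicity p b - v)"
      using le by (simp add: v_def power_add[symmetric])
    then show ?thesis using unit_part_decompose(1)[OF p(1) ab(2)]
      by (simp add: y_def mult_ac)
  qed
  have sum: "a + b = p ^ v * (x + y)" using a(1) b by (simp add: algebra_simps)
  have ab': "a * b \<noteq> 0" using ab by simp
  note vs = unit_symbol_values[OF p(1) ab(1)] unit_symbol_values[OF p(1) ab(2)]
    unit_symbol_values[OF p(1) ab(3)]
  have prod: "multiplicity p (a * b * (a + b)) = multiplicity p a + multiplicity p b + multiplicity p (a + b)"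
     "unit_symbol p (a * b * (a + b)) = unit_symbol p a * unit_symbol p b * unit_symbol p (a + b)"
    using ab ab' p by (simp_all add: multiplicity_prime_mult unit_symbol_mult)
  show ?thesis
  proof (cases "p dvd x + y")
    case False
    have va: "multiplicity p (a + b) = multiplicity p a"
      using unit_part_eqI(1)[OF p(1) False sum] by (simp add: v_def)
    show ?thesis
    proof (cases "p dvd y")
      case True
      then have "[x + y = x] (mod p)" by (simp add: cong_iff_dvd_diff)
      then have "unit_symbol p (a + b) = unit_symbol p a"
        using unit_symbol_eqI[OF p(1) False sum] unit_symbol_eqI[OF p(1) a(2,1)] Legendre_cong by metis
      then show ?thesis using vs va by (auto simp: residue_class_def prod)
    next
      case False
      then have "multiplicity p b = multiplicity p a"
        using unit_part_eqI(1)[OF p(1) False b] by (simp add: v_def)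
      then show ?thesis using vs va by (auto simp: residue_class_def prod)
    qed
  next
    case True
    have y: "\<not> p dvd y" using True a(2) by (metis dvd_add_left_iff)
    have vb: "multiplicity p b = multiplicity p a"
      using unit_part_eqI(1)[OF p(1) y b] by (simp add: v_def)
    have "[y = - 1 * x] (mod p)" using True by (simp add: cong_iff_dvd_diff add.commute)
    then have "Legendre y p = Legendre (- 1 * x) p" by (rule Legendre_cong)
    then have "Legendre y p = Legendre (- 1) p * Legendre x p" by (simp only: Legendre_mult[OF p])
    then have "unit_symbol p b = (if p mod 4 = 1 then 1 else - 1) * unit_symbol p a"
      using unit_symbol_eqI[OF p(1) y b] unit_symbol_eqI[OF p(1) a(2,1)] Legendre_minus_one[OF p] by simp
    then show ?thesis using vs vb by (auto simp: residue_class_def prod)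
  qed
qed

lemma residue_class_binary:
  fixes p :: int
  assumes "prime p" "p > 2" "a \<noteq> 0" "b \<noteq> 0" "a + b \<noteq> 0"
  shows "4 dvd residue_class p a + residue_class p b - residue_class p (a + b)
             - residue_class p (a * b * (a + b))"
  using residue_class_binary_le[of p a b] residue_class_binary_le[of p b a] assms
  by (cases "multiplicity p a \<le> multiplicity p b") (simp_all add: add.commute mult.commute)

subsection \<open>The Grothendieck--Witt group of the rationals\<close>

text \<open>Formal \<open>\<int>\<close>-combinations of one-dimensional forms. Dividing by \<open>gw_span {}\<close> gives the
  Grothendieck--Witt group of the rationals; a generator set \<open>X\<close> is killed in addition.\<close>

inductive_set gw_span :: "int set \<Rightarrow> (int \<Rightarrow>\<^sub>0 int) set" for X where
  zero: "0 \<in> gw_span X"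
| diff: "x \<in> gw_span X \<Longrightarrow> y \<in> gw_span X \<Longrightarrow> x - y \<in> gw_span X"
| gen: "a \<in> X \<Longrightarrow> frag_of a \<in> gw_span X"
| square: "a \<noteq> 0 \<Longrightarrow> s \<noteq> 0 \<Longrightarrow> frag_of (a * s * s) - frag_of a \<in> gw_span X"
| binary: "a \<noteq> 0 \<Longrightarrow> b \<noteq> 0 \<Longrightarrow> a + b \<noteq> 0 \<Longrightarrow>
    frag_of a + frag_of b - frag_of (a + b) - frag_of (a * b * (a + b)) \<in> gw_span X"

definition gw_cong :: "int set \<Rightarrow> (int \<Rightarrow>\<^sub>0 int) \<Rightarrow> (int \<Rightarrow>\<^sub>0 int) \<Rightarrow> bool" where
  "gw_cong X x y \<longleftrightarrow> x - y \<in> gw_span X"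

lemma gw_span_minus: "x \<in> gw_span X \<Longrightarrow> - x \<in> gw_span X"
  using gw_span.diff[OF gw_span.zero, of x X] by simp

lemma gw_span_add: "x \<in> gw_span X \<Longrightarrow> y \<in> gw_span X \<Longrightarrow> x + y \<in> gw_span X"
  using gw_span.diff[OF _ gw_span_minus, of x X y] by simp

lemma gw_cong_refl: "gw_cong X x x"
  by (simp add: gw_cong_def gw_span.zero)

lemma gw_cong_sym: "gw_cong X x y \<Longrightarrow> gw_cong X y x"
  using gw_span_minus[of "x - y" X] by (simp add: gw_cong_def)

lemma gw_cong_trans [trans]: "gw_cong X x y \<Longrightarrow> gw_cong X y z \<Longrightarrow> gw_cong X x z"
  using gw_span_add[of "x - y" X "y - z"] by (simp add: gw_cong_def)

lemma gw_cong_diff: "gw_cong X x y \<Longrightarrow> gw_cong X x' y' \<Longrightarrow> gw_cong X (x - x') (y - y')"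
  using gw_span.diff[of "x - y" X "x' - y'"] by (simp add: gw_cong_def algebra_simps)

lemma gw_cong_add: "gw_cong X x y \<Longrightarrow> gw_cong X x' y' \<Longrightarrow> gw_cong X (x + x') (y + y')"
  using gw_span_add[of "x - y" X "x' - y'"] by (simp add: gw_cong_def algebra_simps)

lemma gw_cong_0_iff: "gw_cong X x 0 \<longleftrightarrow> x \<in> gw_span X"
  by (simp add: gw_cong_def)

lemma gw_span_cmul: "x \<in> gw_span X \<Longrightarrow> frag_cmul k x \<in> gw_span X"
  by (rule frag_closure_minus_cmul[where P = "\<lambda>x. x \<in> gw_span X"]) (auto intro: gw_span.intros)

lemma gw_cong_cmul: "gw_cong X x y \<Longrightarrow> gw_cong X (frag_cmul k x) (frag_cmul k y)"
proof -
  assume "gw_cong X x y"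
  then have "frag_cmul k (x - y) \<in> gw_span X" unfolding gw_cong_def by (rule gw_span_cmul)
  moreover have "frag_cmul k (x - y) = frag_cmul k x - frag_cmul k y"
    by (rule poly_mapping_eqI) (simp add: lookup_minus algebra_simps)
  ultimately show ?thesis by (simp add: gw_cong_def)
qed

lemma gw_cong_square: "a \<noteq> 0 \<Longrightarrow> s \<noteq> 0 \<Longrightarrow> gw_cong X (frag_of (a * s * s)) (frag_of a)"
  by (simp add: gw_cong_def gw_span.square)

lemma gw_cong_binary: "a \<noteq> 0 \<Longrightarrow> b \<noteq> 0 \<Longrightarrow> a + b \<noteq> 0 \<Longrightarrow>
    gw_cong X (frag_of a + frag_of b) (frag_of (a + b) + frag_of (a * b * (a + b)))"
  using gw_span.binary[of a b X] by (simp add: gw_cong_def algebra_simps)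

lemma gw_span_times_square: "a \<in> X \<Longrightarrow> a \<noteq> 0 \<Longrightarrow> s \<noteq> 0 \<Longrightarrow> frag_of (a * s * s) \<in> gw_span X"
  using gw_cong_trans[OF gw_cong_square] gw_span.gen gw_cong_0_iff by metis

text \<open>The identity (a + 1)^2 - (a - 1)^2 = 4 a turns a binary relation between multiples of 1
  and -1 by squares into this one; for a = 1 or a = -1 one of the squares would vanish.\<close>

lemma gw_cong_hyperbolic:
  assumes "a \<noteq> 0"
  shows "gw_cong X (frag_of a + frag_of (- a)) (frag_of 1 + frag_of (- 1))"
proof (cases "a = 1 \<or> a = - 1")
  case True
  then show ?thesis by (auto simp: gw_cong_refl add.commute)
next
  case False
  then have nz: "a + 1 \<noteq> 0" "a - 1 \<noteq> 0" by auto
  have "gw_cong X (frag_of (1 * (a + 1) * (a + 1)) + frag_of (- 1 * (a - 1) * (a - 1)))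
      (frag_of (a * 2 * 2) + frag_of (- a * (2 * (a + 1) * (a - 1)) * (2 * (a + 1) * (a - 1))))"
  proof -
    have sum: "1 * (a + 1) * (a + 1) + - 1 * (a - 1) * (a - 1) = a * 2 * 2"
      by (simp add: algebra_simps)
    have prod: "1 * (a + 1) * (a + 1) * (- 1 * (a - 1) * (a - 1)) * (a * 2 * 2)
        = - a * (2 * (a + 1) * (a - 1)) * (2 * (a + 1) * (a - 1))"
      by (simp add: algebra_simps)
    show ?thesis
      using gw_cong_binary[of "1 * (a + 1) * (a + 1)" "- 1 * (a - 1) * (a - 1)" X] nz assms
      unfolding sum prod by simp
  qed
  moreover have "gw_cong X (frag_of (1 * (a + 1) * (a + 1)) + frag_of (- 1 * (a - 1) * (a - 1)))
      (frag_of 1 + frag_of (- 1))"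
    using nz by (intro gw_cong_add gw_cong_square) auto
  moreover have "gw_cong X (frag_of (a * 2 * 2) + frag_of (- a * (2 * (a + 1) * (a - 1)) * (2 * (a + 1) * (a - 1))))
      (frag_of a + frag_of (- a))"
    using nz assms by (intro gw_cong_add gw_cong_square) auto
  ultimately show ?thesis using gw_cong_sym gw_cong_trans by blast
qed

subsection \<open>Additive invariants\<close>

text \<open>The homomorphism to the integers that extends \<open>g\<close>. Since
  \<open>frag_extend\<close> takes values in formal combinations, the integers appear as the
  combinations of the single element \<open>()\<close>.\<close>

definition weight :: "(int \<Rightarrow> int) \<Rightarrow> (int \<Rightarrow>\<^sub>0 int) \<Rightarrow> int" where
  "weight g x = Poly_Mapping.lookup (frag_extend (\<lambda>a. frag_cmul (g a) (frag_of ())) x) ()"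

lemma weight_0 [simp]: "weight g 0 = 0"
  by (simp add: weight_def)

lemma weight_frag_of [simp]: "weight g (frag_of a) = g a"
  by (simp add: weight_def)

lemma weight_diff [simp]: "weight g (x - y) = weight g x - weight g y"
  by (simp add: weight_def frag_extend_diff lookup_minus)

lemma weight_add [simp]: "weight g (x + y) = weight g x + weight g y"
  by (simp add: weight_def frag_extend_add lookup_add)

lemma weight_cmul [simp]: "weight g (frag_cmul k x) = k * weight g x"
  by (simp add: weight_def frag_extend_cmul)

text \<open>The modulus m = 0 is meant to be included: divisibility by 0 is vanishing, and the same
  induction then yields the invariance of rank and signature.\<close>

lemma weight_gw_span_dvd:
  assumes "x \<in> gw_span X"
    and sq: "\<And>a s. a \<noteq> 0 \<Longrightarrow> s \<noteq> 0 \<Longrightarrow> m dvd g (a * s * s) - g a"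
    and bin: "\<And>a b. a \<noteq> 0 \<Longrightarrow> b \<noteq> 0 \<Longrightarrow> a + b \<noteq> 0 \<Longrightarrow>
      m dvd g a + g b - g (a + b) - g (a * b * (a + b))"
    and gen: "\<And>a. a \<in> X \<Longrightarrow> m dvd g a"
  shows "m dvd weight g x"
  using assms(1) by induction (auto intro: sq bin gen)

lemma weight_residue_class_dvd:
  assumes "x \<in> gw_span X" "prime p" "p > 2" "\<And>a. a \<in> X \<Longrightarrow> residue_class p a = 0"
  shows "4 dvd weight (residue_class p) x"
  using assms by (intro weight_gw_span_dvd) (auto simp: residue_class_square residue_class_binary)

lemma weight_multiplicity_dvd:
  assumes "x \<in> gw_span X" "prime p" "\<And>a. a \<in> X \<Longrightarrow> multiplicity p a = 0"
  shows "2 dvd weight (\<lambda>a. int (multiplicity p a)) x"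
  using assms by (intro weight_gw_span_dvd) (auto simp: multiplicity_prime_mult)

lemma weight_length_eq_0:
  assumes "x \<in> gw_span {}"
  shows "weight (\<lambda>a. 1) x = 0"
  using weight_gw_span_dvd[OF assms, of 0 "\<lambda>a. 1"] by simp

lemma weight_positive_eq_0:
  assumes "x \<in> gw_span {}"
  shows "weight (\<lambda>a. if a > 0 then 1 else 0) x = 0"
proof -
  have "0 dvd weight (\<lambda>a. if a > 0 then 1 else 0) x"
  proof (rule weight_gw_span_dvd[OF assms])
    fix a s :: int assume "a \<noteq> 0" "s \<noteq> 0"
    then have "s * s > 0" by (auto simp: zero_less_mult_iff linorder_neq_iff)
    then have "0 < a * (s * s) \<longleftrightarrow> 0 < a" by (simp add: zero_less_mult_iff)
    then show "0 dvd (if 0 < a * s * s then 1 else 0) - (if 0 < a then 1 else (0 :: int))"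
      by (simp add: mult.assoc)
  next
    fix a b :: int assume ab: "a \<noteq> 0" "b \<noteq> 0" "a + b \<noteq> 0"
    then consider "a > 0" "b > 0" | "a < 0" "b < 0" | "a > 0" "b < 0" | "a < 0" "b > 0"
      by linarith
    then show "0 dvd (if 0 < a then 1 else 0) + (if 0 < b then 1 else 0) - (if 0 < a + b then 1 else 0)
        - (if 0 < a * b * (a + b) then 1 else (0 :: int))"
    proof cases
      case 1
      then show ?thesis by simp
    next
      case 2
      then have "a * b > 0" "a + b < 0" by (simp_all add: mult_neg_neg)
      then show ?thesis using 2 by (simp add: zero_less_mult_iff mult_less_0_iff)
    next
      case 3
      then have "a * b < 0" by (simp add: mult_pos_neg)
      then show ?thesis using 3 ab by (auto simp: zero_less_mult_iff)
    next
      case 4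
      then have "a * b < 0" by (simp add: mult_neg_pos)
      then show ?thesis using 4 ab by (auto simp: zero_less_mult_iff)
    qed
  qed auto
  then show ?thesis by simp
qed

subsection \<open>Descent on the largest prime\<close>

definition below :: "int \<Rightarrow> int set" where
  "below p = {a. a \<noteq> 0 \<and> (\<forall>q. prime q \<longrightarrow> q dvd a \<longrightarrow> q < p)}"

lemma below_mult: "a \<in> below p \<Longrightarrow> b \<in> below p \<Longrightarrow> a * b \<in> below p"
  by (auto simp: below_def prime_dvd_mult_iff)

lemma below_abs_less: "a \<noteq> 0 \<Longrightarrow> \<bar>a\<bar> < p \<Longrightarrow> a \<in> below p"
proof -
  assume a: "a \<noteq> 0" "\<bar>a\<bar> < p"
  have "q < p" if "q dvd a" for q
    using dvd_imp_le_int[OF a(1) that] a(2) by linarith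
  then show ?thesis using a(1) by (simp add: below_def)
qed

lemma below_not_dvd: "prime p \<Longrightarrow> a \<in> below p \<Longrightarrow> \<not> p dvd a"
  by (auto simp: below_def)

text \<open>Write p c mn as the sum of c l p^2 and p c r. In the binary relation for this sum the
  first summand and the fourth entry, which is c l r mn times a square, involve only primes below p.
  They vanish in the quotient, and the asserted congruence remains.\<close>

lemma gw_cong_reduction_step:
  fixes p :: int
  assumes "mn = p * l + r" "c \<in> below p" "mn \<in> below p" "r \<in> below p" "l \<noteq> 0 \<Longrightarrow> l \<in> below p"
    and p: "p > 1"
  shows "gw_cong (below p) (frag_of (p * c * mn)) (frag_of (p * c * r))"
proof (cases "l = 0")
  case True
  then show ?thesis using assms by (simp add: gw_cong_refl)
next
  case False
  let ?G = "gw_span (below p)"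
  have nz: "c \<noteq> 0" "mn \<noteq> 0" "r \<noteq> 0" "l \<noteq> 0" "p \<noteq> 0"
    using assms False by (auto simp: below_def)
  have l: "l \<in> below p" using assms(5) False .
  define a b where "a = c * l * p * p" and "b = p * c * r"
  have sum: "a + b = p * c * mn"
    unfolding a_def b_def assms(1) by (simp add: algebra_simps)
  have prod: "a * b * (a + b) = (c * l * r * mn) * (p * p * c) * (p * p * c)"
    unfolding sum unfolding a_def b_def by (simp add: mult_ac)
  have bin: "frag_of a + frag_of b - frag_of (a + b) - frag_of (a * b * (a + b)) \<in> ?G"
    by (rule gw_span.binary) (use nz sum in \<open>auto simp: a_def b_def\<close>)
  have A: "frag_of a \<in> ?G"
    unfolding a_def using nz assms l by (intro gw_span_times_square below_mult) auto
  have N: "frag_of (a * b * (a + b)) \<in> ?G"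
    unfolding prod using nz assms l by (intro gw_span_times_square below_mult) auto
  have "frag_of (a * b * (a + b)) - (frag_of a
      - (frag_of a + frag_of b - frag_of (a + b) - frag_of (a * b * (a + b)))) \<in> ?G"
    by (rule gw_span.diff[OF N gw_span.diff[OF A bin]])
  moreover have "w - (x - (x + y - z - w)) = y - z" for w x y z :: "int \<Rightarrow>\<^sub>0 int"
    by (simp add: algebra_simps)
  ultimately have "gw_cong (below p) (frag_of b) (frag_of (a + b))"
    by (simp only: gw_cong_def)
  then have "gw_cong (below p) (frag_of (a + b)) (frag_of b)" by (rule gw_cong_sym)
  then show ?thesis unfolding sum unfolding b_def .
qed

text \<open>The bound (p - 1)^2 for the absolute value of m n keeps the quotient by p smaller than p
  in absolute value, so that its prime factors are below p. Negative n occur as the unit -1.\<close>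

lemma gw_cong_reduction_small:
  fixes p :: int
  assumes p: "prime p" and c: "c \<in> below p" and m: "0 < m" "m < p" and n: "n \<noteq> 0" "\<bar>n\<bar> < p"
  shows "gw_cong (below p) (frag_of (p * c * (m * n))) (frag_of (p * c * ((m * n) mod p)))"
proof (rule gw_cong_reduction_step[where l = "m * n div p"])
  have p1: "p > 1" using prime_gt_1_int[OF p] .
  have b: "m \<in> below p" "n \<in> below p" using m n by (auto intro!: below_abs_less)
  then show mn: "m * n \<in> below p" by (rule below_mult)
  show "m * n mod p \<in> below p"
  proof (rule below_abs_less)
    show "m * n mod p \<noteq> 0" using below_not_dvd[OF p mn] by (simp add: dvd_eq_mod_eq_0)
    show "\<bar>m * n mod p\<bar> < p" using p1 by simp
  qed
  show "m * n div p \<in> below p" if "m * n div p \<noteq> 0"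
  proof (rule below_abs_less[OF that])
    have le: "\<bar>m * n\<bar> \<le> (p - 1) * (p - 1)"
      unfolding abs_mult using m n by (intro mult_mono) auto
    have "m * n div p < p"
    proof (rule ccontr)
      assume "\<not> ?thesis"
      then have "p * p \<le> p * (m * n div p)" using p1 by (intro mult_left_mono) auto
      also have "\<dots> \<le> m * n"
        using p1 pos_mod_sign[of p "m * n"] minus_mod_eq_mult_div[of "m * n" p] by linarith
      finally show False using le p1 by (simp add: algebra_simps)
    qed
    moreover have "- p < m * n div p"
    proof (rule ccontr)
      assume "\<not> ?thesis"
      then have "p * (m * n div p) \<le> p * (- p)" using p1 by (intro mult_left_mono) auto
      moreover have "m * n = p * (m * n div p) + m * n mod p" by simp
      moreover have "m * n mod p < p" using p1 by simp
      ultimately have "m * n < p - p * p" by (simp only: mult_minus_right)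
      then show False using le p1 by (simp add: algebra_simps)
    qed
    ultimately show "\<bar>m * n div p\<bar> < p" by simp
  qed
qed (use p c in \<open>auto simp: prime_gt_1_int\<close>)

text \<open>The factor \<open>m\<close> is an accumulator: the prime factors of \<open>a\<close>
  move into it one at a time, and it is reduced modulo p after each of them. Every product to be
  reduced is thus small, however large \<open>a\<close> is.\<close>

lemma gw_cong_reduction:
  fixes p :: int
  assumes p: "prime p" and "a \<in> below p" "0 < m" "m < p"
  shows "gw_cong (below p) (frag_of (p * (m * a))) (frag_of (p * ((m * a) mod p)))"
  using assms(2-4)
proof (induction a arbitrary: m rule: prime_divisors_induct)
  case zero
  then show ?case by (simp add: below_def)
next
  case (unit a)
  then have "\<bar>a\<bar> = 1" by simp
  then show ?case
    using gw_cong_reduction_small[OF p, of 1 m a] unit prime_gt_1_int[OF p] below_abs_less[of 1 p]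
    by auto
next
  case (factor q a)
  have p1: "p > 1" using prime_gt_1_int[OF p] .
  have a: "a \<in> below p" and q: "0 < q" "q < p"
    using factor by (auto simp: below_def prime_gt_0_int)
  let ?r = "m * q mod p"
  have "\<not> p dvd m" "\<not> p dvd q"
    using zdvd_not_zless[of m p] zdvd_not_zless[of q p] factor.prems q by simp_all
  then have "\<not> p dvd m * q" by (simp add: prime_dvd_mult_iff[OF p])
  then have "?r \<noteq> 0" by (simp add: dvd_eq_mod_eq_0)
  then have r: "0 < ?r" "?r < p"
    using pos_mod_sign[of p "m * q"] pos_mod_bound[of p "m * q"] p1 by linarith+
  have "gw_cong (below p) (frag_of (p * a * (m * q))) (frag_of (p * a * ?r))"
    using q factor by (intro gw_cong_reduction_small p a) auto
  also have "p * a * ?r = p * (?r * a)" by simp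
  also have "gw_cong (below p) (frag_of (p * (?r * a))) (frag_of (p * ((?r * a) mod p)))"
    by (rule factor.IH[OF a r])
  also have "(?r * a) mod p = (m * (q * a)) mod p" by (simp add: mod_mult_left_eq mult.assoc)
  finally show ?case by (simp add: mult_ac)
qed

lemma gw_cong_same_residue:
  fixes p :: int
  assumes p: "prime p" and a: "a \<in> below p" and b: "b \<in> below p" and "[a = b] (mod p)"
  shows "gw_cong (below p) (frag_of (p * a)) (frag_of (p * b))"
proof -
  have eq: "a mod p = b mod p" using assms(4) by (simp add: cong_def)
  have "gw_cong (below p) (frag_of (p * a)) (frag_of (p * (a mod p)))"
    using gw_cong_reduction[OF p a, of 1] prime_gt_1_int[OF p] by simp
  also have "gw_cong (below p) (frag_of (p * (a mod p))) (frag_of (p * b))"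
    unfolding eq using gw_cong_reduction[OF p b, of 1] prime_gt_1_int[OF p] by (simp add: gw_cong_sym)
  finally show ?thesis .
qed

lemma gw_cong_same_Legendre:
  fixes p :: int
  assumes p: "prime p" "p > 2" and a: "a \<in> below p" and b: "b \<in> below p"
    and "Legendre a p = Legendre b p"
  shows "gw_cong (below p) (frag_of (p * a)) (frag_of (p * b))"
proof -
  obtain t where t: "[a * t * t = b] (mod p)" "\<not> p dvd t"
    using Legendre_eq_imp_square_relation[OF p below_not_dvd[OF p(1) a] assms(5)] .
  \<comment> \<open>The reduced root is smaller than p and therefore lies in \<open>below p\<close>,
    as does its square.\<close>
  define s where "s = t mod p"
  have s: "s \<in> below p" "s \<noteq> 0"
    using t(2) p by (auto simp: s_def dvd_eq_mod_eq_0 intro!: below_abs_less)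
  have "[a * s * s = a * t * t] (mod p)"
    unfolding s_def by (intro cong_mult cong_refl) (simp_all add: cong_def)
  then have cong: "[a * s * s = b] (mod p)" using t(1) by (rule cong_trans)
  have "gw_cong (below p) (frag_of (p * a)) (frag_of (p * a * s * s))"
    using a s p by (intro gw_cong_sym[OF gw_cong_square]) (auto simp: below_def)
  also have "p * a * s * s = p * (a * s * s)" by (simp add: mult_ac)
  also have "gw_cong (below p) (frag_of (p * (a * s * s))) (frag_of (p * b))"
    by (intro gw_cong_same_residue p below_mult a b s cong)
  finally show ?thesis .
qed

lemma below_not_dvd_imp_below:
  assumes "a \<in> below (p + 1)" "\<not> p dvd b" "b dvd a"
  shows "b \<in> below p"
  unfolding below_def
proof (intro CollectI conjI allI impI)
  show "b \<noteq> 0" using assms by auto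
  fix q assume "prime q" "q dvd b"
  then have "q < p + 1" "q \<noteq> p" using assms dvd_trans by (auto simp: below_def)
  then show "q < p" by simp
qed

lemma frag_of_below_cases:
  fixes p :: int
  assumes p: "prime p" and a: "a \<in> below (p + 1)"
  obtains "frag_of a \<in> gw_span (below p)"
  | b where "b \<in> below p" "gw_cong (below p) (frag_of a) (frag_of (p * b))"
proof -
  define v where "v = multiplicity p a"
  define b where "b = unit_part p a"
  have nz: "a \<noteq> 0" "p \<noteq> 0" using a p by (auto simp: below_def)
  have ab: "a = p ^ v * b" "\<not> p dvd b"
    using unit_part_decompose[OF p nz(1)] by (simp_all add: v_def b_def)
  have b: "b \<in> below p" using below_not_dvd_imp_below[OF a ab(2)] ab(1) by (metis dvd_triv_right)
  then have b0: "b \<noteq> 0" by (simp add: below_def)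
  show thesis
  proof (cases "even v")
    case True
    then have "a = b * p ^ (v div 2) * p ^ (v div 2)"
      using ab(1) by (simp add: mult.assoc mult.commute[of b] power_add[symmetric] mult_2[symmetric])
    then show ?thesis using that(1) gw_span_times_square[OF b b0, of "p ^ (v div 2)"] nz by simp
  next
    case False
    then have "a = (p * b) * p ^ (v div 2) * p ^ (v div 2)"
    proof -
      obtain k where k: "v = 2 * k + 1" using False by (elim oddE)
      have "p ^ v = p * p ^ k * p ^ k" unfolding k by (simp add: mult_2 power_add)
      moreover have "v div 2 = k" using k by simp
      ultimately show ?thesis using ab(1) by (simp add: mult_ac)
    qed
    then show ?thesis using that(2)[OF b] gw_cong_square[of "p * b" "p ^ (v div 2)"] nz b0 by simp
  qed
qed

lemma below_Suc_not_prime: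
  assumes "\<not> prime p"
  shows "below (p + 1) = below p"
proof -
  have "q < p + 1 \<longleftrightarrow> q < p" if "prime q" for q
    using assms that by (cases "q = p") auto
  then show ?thesis by (auto simp: below_def)
qed

lemma weight_below_dvd:
  fixes p :: int
  assumes "gw_cong (below p) x y" and p: "prime p"
  shows "2 dvd weight (\<lambda>a. int (multiplicity p a)) x - weight (\<lambda>a. int (multiplicity p a)) y"
    and "p > 2 \<Longrightarrow> 4 dvd weight (residue_class p) x - weight (residue_class p) y"
proof -
  have m: "multiplicity p a = 0" if "a \<in> below p" for a
    using below_not_dvd[OF p that] by (simp add: not_dvd_imp_multiplicity_0)
  show "2 dvd weight (\<lambda>a. int (multiplicity p a)) x - weight (\<lambda>a. int (multiplicity p a)) y"
    using weight_multiplicity_dvd[of "x - y" "below p" p] assms m by (simp add: gw_cong_def)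
  show "4 dvd weight (residue_class p) x - weight (residue_class p) y" if "p > 2"
    using weight_residue_class_dvd[of "x - y" "below p" p] assms m that
    by (simp add: gw_cong_def residue_class_def)
qed

text \<open>Modulo smaller primes, \<open>\<langle>p\<rangle>\<close> and \<open>\<langle>pu\<rangle>\<close> with a nonresidue \<open>u\<close> generate everything, and the two
  relations below make the quotient the Witt group of the field with \<open>p\<close> elements.\<close>

lemma least_nonresidue_relation:
  fixes p :: int
  assumes p: "prime p" "p > 2"
  obtains u where "u \<in> below p" "Legendre u p = - 1"
    "gw_cong (below p) (frag_of p + frag_of p) (frag_of (p * u) + frag_of (p * u))"
proof -
  define P where "P n \<longleftrightarrow> 1 < int n \<and> int n < p \<and> Legendre (int n) p = - 1" for n
  obtain u0 where "1 < u0" "u0 < p" "Legendre u0 p = - 1"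
    using quadratic_nonresidue_exists[OF p] by blast
  then have ex: "P (nat u0)" by (simp add: P_def)
  define u where "u = int (LEAST n. P n)"
  have u: "1 < u" "u < p" "Legendre u p = - 1"
    using LeastI[of P, OF ex] by (simp_all add: P_def u_def)
  have below: "1 \<in> below p" "u - 1 \<in> below p" "u \<in> below p"
    using u by (auto intro!: below_abs_less)
  have one: "Legendre 1 p = 1"
    using Legendre_square[of p 1] p(2) by (simp add: zdvd_not_zless)
  \<comment> \<open>By minimality u - 1 is a residue, which makes u = 1 + (u - 1) a sum of two
    residues. The binary relation for p + p (u - 1) = p u then transforms 2 <p> into 2 <p
    u>.\<close>
  have "Legendre (u - 1) p = 1"
  proof (cases "u = 2")
    case True
    then show ?thesis using one by simp
  next
    case False
    have "\<not> P (nat (u - 1))"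
    proof
      assume "P (nat (u - 1))"
      then have "(LEAST n. P n) \<le> nat (u - 1)" by (rule Least_le)
      then show False using u(1) unfolding u_def by linarith
    qed
    then have "Legendre (u - 1) p \<noteq> - 1" using u False by (auto simp: P_def)
    then show ?thesis using Legendre_values[OF below_not_dvd[OF p(1) below(2)]] by blast
  qed
  then have r1: "gw_cong (below p) (frag_of (p * 1)) (frag_of (p * (u - 1)))"
    by (intro gw_cong_same_Legendre p below) (simp add: one)
  then have r2: "gw_cong (below p) (frag_of (p * ((u - 1) * u))) (frag_of (p * u))"
    using \<open>Legendre (u - 1) p = 1\<close>
    by (intro gw_cong_same_Legendre p below below_mult) (simp add: Legendre_mult[OF p])
  have "gw_cong (below p) (frag_of p + frag_of p) (frag_of p + frag_of (p * (u - 1)))"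
    using r1 by (intro gw_cong_add gw_cong_refl) simp
  also have "gw_cong (below p) (frag_of p + frag_of (p * (u - 1)))
      (frag_of (p + p * (u - 1)) + frag_of (p * (p * (u - 1)) * (p + p * (u - 1))))"
    using u p by (intro gw_cong_binary) (auto simp: algebra_simps)
  also have "p + p * (u - 1) = p * u" by (simp add: algebra_simps)
  also have "p * (p * (u - 1)) * (p * u) = p * ((u - 1) * u) * p * p" by (simp add: mult_ac)
  also have "gw_cong (below p) (frag_of (p * u) + frag_of (p * ((u - 1) * u) * p * p))
      (frag_of (p * u) + frag_of (p * ((u - 1) * u)))"
    using u p by (intro gw_cong_add gw_cong_refl gw_cong_square) auto
  also have "gw_cong (below p) (frag_of (p * u) + frag_of (p * ((u - 1) * u)))
      (frag_of (p * u) + frag_of (p * u))"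
    by (intro gw_cong_add gw_cong_refl r2)
  finally show ?thesis using that below(3) u(3) by blast
qed

lemma frag_cmul_2: "frag_cmul 2 x = x + x"
  by (rule poly_mapping_eqI) (simp add: lookup_add)

text \<open>Modulo smaller primes x is i <p> + j <p u>, and i + j is even by the valuation. Since
  <p> + <-p> vanishes, the class of -1 modulo p decides. For p = 1 mod 4 both generators have order
  dividing 2, and the residue shows that j is even. For p = 3 mod 4 the generator <p u> is -<p>,
  four copies of <p> vanish, and the residue is i - j modulo 4.\<close>

lemma gw_span_descent_odd:
  fixes p :: int
  assumes p: "prime p" "p > 2" and x: "x \<in> gw_span (below (p + 1))"
    and v: "2 dvd weight (\<lambda>a. int (multiplicity p a)) x"
    and res: "4 dvd weight (residue_class p) x"
  shows "x \<in> gw_span (below p)"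
proof -
  let ?cong = "gw_cong (below p)"
  obtain u where u: "u \<in> below p" "Legendre u p = - 1"
    and two: "?cong (frag_of p + frag_of p) (frag_of (p * u) + frag_of (p * u))"
    using least_nonresidue_relation[OF p] .
  have p0: "p \<noteq> 0" using p(2) by simp
  have one_below: "1 \<in> below p" "- 1 \<in> below p" using p(2) by (auto intro!: below_abs_less)
  have nd1: "\<not> p dvd 1" using p(2) by (simp add: zdvd_not_zless)
  have one: "Legendre 1 p = 1" using Legendre_square[of p 1] nd1 by simp
  have generator: "?cong (frag_of (p * b)) (frag_of (if Legendre b p = 1 then p else p * u))"
    if "b \<in> below p" for b
  proof (cases "Legendre b p = 1")
    case True
    then show ?thesis using gw_cong_same_Legendre[OF p that one_below(1)] one by simp
  next
    case False
    then have "Legendre b p = - 1" using Legendre_values[OF below_not_dvd[OF p(1) that]] by blast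
    then show ?thesis using gw_cong_same_Legendre[OF p that u(1)] u(2) by simp
  qed
  have "\<exists>i j. ?cong x (frag_cmul i (frag_of p) + frag_cmul j (frag_of (p * u)))"
    using x
  proof induction
    case zero
    then show ?case by (intro exI[of _ 0]) (simp add: gw_cong_refl)
  next
    case (diff x y)
    then obtain i j i' j' where
      "?cong x (frag_cmul i (frag_of p) + frag_cmul j (frag_of (p * u)))"
      "?cong y (frag_cmul i' (frag_of p) + frag_cmul j' (frag_of (p * u)))" by blast
    then have "?cong (x - y) ((frag_cmul i (frag_of p) + frag_cmul j (frag_of (p * u)))
        - (frag_cmul i' (frag_of p) + frag_cmul j' (frag_of (p * u))))" by (rule gw_cong_diff)
    also have "(frag_cmul i (frag_of p) + frag_cmul j (frag_of (p * u)))
        - (frag_cmul i' (frag_of p) + frag_cmul j' (frag_of (p * u)))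
        = frag_cmul (i - i') (frag_of p) + frag_cmul (j - j') (frag_of (p * u))"
      by (simp add: frag_cmul_diff_distrib algebra_simps)
    finally show ?case by blast
  next
    case (gen a)
    show ?case
    proof (rule frag_of_below_cases[OF p(1) gen])
      assume "frag_of a \<in> gw_span (below p)"
      then show ?thesis by (intro exI[of _ 0]) (simp add: gw_cong_0_iff)
    next
      fix b assume "b \<in> below p" "?cong (frag_of a) (frag_of (p * b))"
      then have "?cong (frag_of a) (frag_of (if Legendre b p = 1 then p else p * u))"
        using generator gw_cong_trans by blast
      then show ?thesis
        by (cases "Legendre b p = 1")
          (intro exI[of _ 1] exI[of _ 0], simp, intro exI[of _ 0] exI[of _ 1], simp)
    qed
  next
    case (square a s)
    then show ?case
      by (intro exI[of _ 0]) (simp add: gw_cong_0_iff gw_span.square)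
  next
    case (binary a b)
    then show ?case
      by (intro exI[of _ 0]) (simp add: gw_cong_0_iff gw_span.binary)
  qed
  then obtain i j where x': "?cong x (frag_cmul i (frag_of p) + frag_cmul j (frag_of (p * u)))"
    by blast
  have nd: "\<not> p dvd u" using below_not_dvd[OF p(1) u(1)] .
  have mult: "multiplicity p p = 1" "multiplicity p (p * u) = 1"
    using unit_part_eqI(1)[OF p(1) nd1, of p 1] unit_part_eqI(1)[OF p(1) nd, of "p * u" 1] by simp_all
  have symbol: "unit_symbol p p = 1" "unit_symbol p (p * u) = - 1"
    using unit_symbol_eqI[OF p(1) nd1, of p 1] unit_symbol_eqI[OF p(1) nd, of "p * u" 1] one u(2)
    by simp_all
  have even: "even (i + j)"
    using weight_below_dvd(1)[OF x' p(1)] v by (simp add: mult)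
  have four: "4 dvd i * residue_class p p + j * residue_class p (p * u)"
    using weight_below_dvd(2)[OF x' p] res by (simp add: dvd_diff_right_iff)
  have hyp: "frag_of p + frag_of (- p) \<in> gw_span (below p)"
  proof -
    have "?cong (frag_of p + frag_of (- p)) (frag_of 1 + frag_of (- 1))"
      by (rule gw_cong_hyperbolic[OF p0])
    moreover have "frag_of 1 + frag_of (- 1) \<in> gw_span (below p)"
      by (intro gw_span_add gw_span.gen one_below)
    ultimately show ?thesis using gw_cong_trans gw_cong_0_iff by blast
  qed
  have neg: "?cong (frag_of (- p)) (frag_of (if p mod 4 = 1 then p else p * u))"
    using generator[OF one_below(2)] by (cases "p mod 4 = 1") (simp_all add: Legendre_minus_one[OF p])
  have zero: "?cong (frag_of p + frag_of (if p mod 4 = 1 then p else p * u)) 0"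
    using gw_cong_trans[OF gw_cong_sym[OF gw_cong_add[OF gw_cong_refl neg]], of "frag_of p" 0] hyp
    by (simp add: gw_cong_0_iff)
  show ?thesis
  proof (cases "p mod 4 = 1")
    case True
    then have "residue_class p p = 0" "residue_class p (p * u) = 2"
      by (simp_all add: residue_class_def mult symbol)
    then have "even j" using four by auto
    then obtain i' j' where ij: "i = i' * 2" "j = j' * 2" using even by (auto elim!: evenE)
    have z: "?cong (frag_cmul 2 (frag_of p)) 0" using zero True by (simp add: frag_cmul_2)
    then have z': "?cong (frag_cmul 2 (frag_of (p * u))) 0"
      using gw_cong_trans[OF gw_cong_sym[OF two]] by (simp add: frag_cmul_2)
    have "?cong (frag_cmul i' (frag_cmul 2 (frag_of p)) + frag_cmul j' (frag_cmul 2 (frag_of (p * u))))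
        (frag_cmul i' 0 + frag_cmul j' 0)"
      by (intro gw_cong_add gw_cong_cmul z z')
    then have "?cong (frag_cmul i (frag_of p) + frag_cmul j (frag_of (p * u))) 0"
      by (simp add: ij)
    then show ?thesis using gw_cong_trans[OF x'] gw_cong_0_iff by blast
  next
    case False
    then have "residue_class p p = 1" "residue_class p (p * u) = - 1"
      by (simp_all add: residue_class_def mult symbol)
    then have "4 dvd i - j" using four by simp
    then obtain k where k: "i = j + 4 * k" by (auto elim!: dvdE simp: algebra_simps)
    have z: "?cong (frag_of p + frag_of (p * u)) 0" using zero False by simp
    have "?cong ((frag_of p + frag_of p) + (frag_of p + frag_of p))
       ((frag_of p + frag_of p) + (frag_of (p * u) + frag_of (p * u)))"
      by (intro gw_cong_add gw_cong_refl two)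
    also have "(frag_of p + frag_of p) + (frag_of (p * u) + frag_of (p * u))
       = (frag_of p + frag_of (p * u)) + (frag_of p + frag_of (p * u))" by simp
    also have "?cong \<dots> (0 + 0)" by (intro gw_cong_add z)
    finally have "?cong ((frag_of p + frag_of p) + (frag_of p + frag_of p)) 0" by simp
    moreover have "(frag_of p + frag_of p) + (frag_of p + frag_of p) = frag_cmul 4 (frag_of p)"
      using frag_cmul_distrib[of 2 2 "frag_of p"] unfolding frag_cmul_2 by simp
    ultimately have z4: "?cong (frag_cmul 4 (frag_of p)) 0" by simp
    have "?cong (frag_cmul j (frag_of p + frag_of (p * u)) + frag_cmul k (frag_cmul 4 (frag_of p)))
        (frag_cmul j 0 + frag_cmul k 0)"
      by (intro gw_cong_add gw_cong_cmul z z4)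
    moreover have "frag_cmul j (frag_of p + frag_of (p * u)) + frag_cmul k (frag_cmul 4 (frag_of p))
        = frag_cmul i (frag_of p) + frag_cmul j (frag_of (p * u))"
      by (rule poly_mapping_eqI) (simp add: lookup_add k algebra_simps)
    ultimately have "?cong (frag_cmul i (frag_of p) + frag_cmul j (frag_of (p * u))) 0" by simp
    then show ?thesis using gw_cong_trans[OF x'] gw_cong_0_iff by blast
  qed
qed

lemma below_2:
  assumes "a \<in> below 2"
  shows "a = 1 \<or> a = - 1"
proof -
  have "is_unit a"
  proof (rule ccontr)
    assume "\<not> is_unit a"
    moreover have "a \<noteq> 0" using assms by (simp add: below_def)
    ultimately obtain q where q: "prime q" "q dvd a" using prime_divisor_exists[of a] by blast
    then have "q < 2" using assms by (simp add: below_def)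
    then show False using prime_ge_2_int[OF q(1)] by simp
  qed
  then show ?thesis by (auto simp: abs_if split: if_splits)
qed

text \<open>Here the determinant suffices: 1 + 1 = 2 gives <1> + <1> = <2> + <2>, so modulo <1> and
  <-1> the class <2> has order at most 2 and agrees with <-2>. The coefficient of <2> matters modulo
  2 only, and its parity is read off from the valuation.\<close>

lemma gw_span_descent_two:
  assumes x: "x \<in> gw_span (below 3)"
    and v: "2 dvd weight (\<lambda>a. int (multiplicity 2 a)) x"
  shows "x \<in> gw_span (below 2)"
proof -
  let ?cong = "gw_cong (below 2)"
  have p: "prime (2 :: int)" by simp
  have one_below: "1 \<in> below 2" "- 1 \<in> below 2" by (auto intro!: below_abs_less)
  have ones: "frag_of 1 + frag_of 1 \<in> gw_span (below 2)" "frag_of 1 + frag_of (- 1) \<in> gw_span (below 2)"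
    by (intro gw_span_add gw_span.gen one_below)+
  have two: "?cong (frag_of 2 + frag_of 2) 0"
    using gw_cong_trans[OF gw_cong_sym[OF gw_cong_binary[of 1 1]], of "below 2" 0] ones(1)
    by (simp add: gw_cong_0_iff)
  have mtwo: "?cong (frag_of (- 2)) (frag_of 2)"
  proof -
    have "?cong (frag_of 2 + frag_of (- 2)) 0"
      using gw_cong_trans[OF gw_cong_hyperbolic[of 2 "below 2"], of 0] ones(2) by (simp add: gw_cong_0_iff)
    then have "?cong (frag_of 2 + frag_of (- 2) - (frag_of 2 + frag_of 2)) (0 - 0)"
      using two by (rule gw_cong_diff)
    then show ?thesis by (simp add: gw_cong_def)
  qed
  have "\<exists>i. ?cong x (frag_cmul i (frag_of 2))"
    using x
  proof induction
    case zero
    then show ?case by (intro exI[of _ 0]) (simp add: gw_cong_refl)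
  next
    case (diff x y)
    then obtain i i' where "?cong x (frag_cmul i (frag_of 2))" "?cong y (frag_cmul i' (frag_of 2))"
      by blast
    then have "?cong (x - y) (frag_cmul i (frag_of 2) - frag_cmul i' (frag_of 2))" by (rule gw_cong_diff)
    then show ?case unfolding frag_cmul_diff_distrib[symmetric] by blast
  next
    case (gen a)
    then have "a \<in> below (2 + 1)" by simp
    then show ?case
    proof (rule frag_of_below_cases[OF p])
      assume "frag_of a \<in> gw_span (below 2)"
      then show ?thesis by (intro exI[of _ 0]) (simp add: gw_cong_0_iff)
    next
      fix b assume b: "b \<in> below 2" "?cong (frag_of a) (frag_of (2 * b))"
      have "b = 1 \<or> b = - 1" using below_2[OF b(1)] .
      then have "?cong (frag_of a) (frag_of 2)"
        using b(2) gw_cong_trans[OF _ mtwo] by auto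
      then show ?thesis by (intro exI[of _ 1]) simp
    qed
  next
    case (square a s)
    then show ?case by (intro exI[of _ 0]) (simp add: gw_cong_0_iff gw_span.square)
  next
    case (binary a b)
    then show ?case by (intro exI[of _ 0]) (simp add: gw_cong_0_iff gw_span.binary)
  qed
  then obtain i where x': "?cong x (frag_cmul i (frag_of 2))" by blast
  have "even i"
    using weight_below_dvd(1)[OF x' p] v by simp
  then obtain k where "i = k * 2" by (auto elim!: evenE)
  then have "?cong (frag_cmul i (frag_of 2)) 0"
    using gw_cong_cmul[OF two, of k] by (simp add: frag_cmul_2[symmetric])
  then show ?thesis using gw_cong_trans[OF x'] gw_cong_0_iff by blast
qed

theorem gw_span_descent:
  assumes "x \<in> gw_span (below (int n))"
    and "\<And>p. prime p \<Longrightarrow> 2 dvd weight (\<lambda>a. int (multiplicity p a)) x"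
    and "\<And>p. prime p \<Longrightarrow> p > 2 \<Longrightarrow> 4 dvd weight (residue_class p) x"
  shows "x \<in> gw_span (below 2)"
  using assms(1)
proof (induction n)
  case 0
  have "q < 2" if "q < 0" for q :: int using that by simp
  then have "below 0 \<subseteq> below 2" unfolding below_def by blast
  moreover have "gw_span X \<subseteq> gw_span Y" if "X \<subseteq> Y" for X Y
  proof
    fix y assume "y \<in> gw_span X"
    then show "y \<in> gw_span Y" using that by induction (auto intro: gw_span.intros)
  qed
  ultimately show ?case using 0 by auto
next
  case (Suc n)
  then have x: "x \<in> gw_span (below (int n + 1))" by (simp add: add.commute)
  show ?case
  proof (cases "prime (int n)")
    case False
    then show ?thesis using Suc.IH x below_Suc_not_prime[OF False] by simp
  next
    case True
    show ?thesis
    proof (cases "n = 2")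
      case True
      then show ?thesis using gw_span_descent_two x assms(2)[of 2] by simp
    next
      case False
      then have "int n > 2" using prime_ge_2_int[OF True] by linarith
      then show ?thesis
        using Suc.IH gw_span_descent_odd[OF True _ x] assms(2,3) True by blast
    qed
  qed
qed

text \<open>After the descent only i <1> + j <-1> is left; the rank i + j and the number i of
  positive entries are both zero.\<close>

theorem gw_span_empty_if_invariants:
  assumes "x \<in> gw_span (below (int n))"
    and "\<And>p. prime p \<Longrightarrow> 2 dvd weight (\<lambda>a. int (multiplicity p a)) x"
    and "\<And>p. prime p \<Longrightarrow> p > 2 \<Longrightarrow> 4 dvd weight (residue_class p) x"
    and "weight (\<lambda>a. 1) x = 0" and "weight (\<lambda>a. if a > 0 then 1 else 0) x = 0"
  shows "x \<in> gw_span {}"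
proof -
  have "x \<in> gw_span (below 2)" by (rule gw_span_descent[OF assms(1-3)])
  then have "\<exists>i j. gw_cong {} x (frag_cmul i (frag_of 1) + frag_cmul j (frag_of (- 1)))"
  proof induction
    case zero
    then show ?case by (intro exI[of _ 0]) (simp add: gw_cong_refl)
  next
    case (diff x y)
    then obtain i j i' j' where
      "gw_cong {} x (frag_cmul i (frag_of 1) + frag_cmul j (frag_of (- 1)))"
      "gw_cong {} y (frag_cmul i' (frag_of 1) + frag_cmul j' (frag_of (- 1)))" by blast
    then have "gw_cong {} (x - y) ((frag_cmul i (frag_of 1) + frag_cmul j (frag_of (- 1)))
        - (frag_cmul i' (frag_of 1) + frag_cmul j' (frag_of (- 1))))" by (rule gw_cong_diff)
    also have "(frag_cmul i (frag_of 1) + frag_cmul j (frag_of (- 1)))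
        - (frag_cmul i' (frag_of 1) + frag_cmul j' (frag_of (- 1)))
        = frag_cmul (i - i') (frag_of 1) + frag_cmul (j - j') (frag_of (- 1))"
      by (simp add: frag_cmul_diff_distrib algebra_simps)
    finally show ?case by blast
  next
    case (gen a)
    then have "a = 1 \<or> a = - 1" by (rule below_2)
    then show ?case
      by (elim disjE) (intro exI[of _ 1] exI[of _ 0], simp add: gw_cong_refl,
        intro exI[of _ 0] exI[of _ 1], simp add: gw_cong_refl)
  next
    case (square a s)
    then show ?case by (intro exI[of _ 0]) (simp add: gw_cong_0_iff gw_span.square)
  next
    case (binary a b)
    then show ?case by (intro exI[of _ 0]) (simp add: gw_cong_0_iff gw_span.binary)
  qed
  then obtain i j where x: "gw_cong {} x (frag_cmul i (frag_of 1) + frag_cmul j (frag_of (- 1)))"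
    by blast
  have "i + j = 0" "i = 0"
    using weight_length_eq_0[OF x[unfolded gw_cong_def]] weight_positive_eq_0[OF x[unfolded gw_cong_def]]
      assms(4,5) by simp_all
  then show ?thesis using x by (simp add: gw_cong_0_iff)
qed

subsection \<open>From the Grothendieck--Witt group to isometries\<close>

abbreviation rat_form :: "int list \<Rightarrow> rat list" where
  "rat_form xs \<equiv> map rat_of_int xs"

text \<open>Embeddings in both directions stand for an invertible matrix. Transitivity and Witt
  cancellation then apply to each direction separately, and no inverse has to be formed.\<close>

definition isometric_forms :: "int list \<Rightarrow> int list \<Rightarrow> bool" where
  "isometric_forms xs ys \<longleftrightarrow> embeds (rat_form xs) (rat_form ys) \<and> embeds (rat_form ys) (rat_form xs)"

definition gw_class :: "int list \<Rightarrow> (int \<Rightarrow>\<^sub>0 int)" where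
  "gw_class xs = (\<Sum>a\<leftarrow>xs. frag_of a)"

lemma gw_class_simps [simp]:
  "gw_class [] = 0" "gw_class (a # xs) = frag_of a + gw_class xs"
  "gw_class (xs @ ys) = gw_class xs + gw_class ys"
  by (simp_all add: gw_class_def)

lemma weight_gw_class [simp]: "weight g (gw_class xs) = (\<Sum>a\<leftarrow>xs. g a)"
  by (induction xs) auto

lemma lookup_gw_class: "Poly_Mapping.lookup (gw_class xs) a = int (count (mset xs) a)"
  by (induction xs) (auto simp: lookup_add)

lemma gw_class_eq_imp_mset_eq: "gw_class xs = gw_class ys \<Longrightarrow> mset xs = mset ys"
  by (rule multiset_eqI) (metis lookup_gw_class of_nat_eq_iff)

lemma isometric_forms_sym: "isometric_forms xs ys \<Longrightarrow> isometric_forms ys xs"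
  by (simp add: isometric_forms_def)

lemma isometric_forms_trans [trans]:
  "isometric_forms xs ys \<Longrightarrow> isometric_forms ys zs \<Longrightarrow> isometric_forms xs zs"
  unfolding isometric_forms_def using embeds_trans by blast

lemma isometric_forms_perm: "mset xs = mset ys \<Longrightarrow> isometric_forms xs ys"
  unfolding isometric_forms_def by (auto intro!: embeds_perm)

lemma isometric_forms_append: "isometric_forms xs ys \<Longrightarrow> isometric_forms (zs @ xs) (zs @ ys)"
  unfolding isometric_forms_def by (auto intro!: embeds_append)

lemma isometric_forms_append2:
  assumes "isometric_forms xs ys" "isometric_forms xs' ys'"
  shows "isometric_forms (xs @ xs') (ys @ ys')"
proof -
  have "isometric_forms (xs @ xs') (xs @ ys')" by (rule isometric_forms_append[OF assms(2)])
  also have "isometric_forms (xs @ ys') (ys' @ xs)" by (rule isometric_forms_perm) simp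
  also have "isometric_forms (ys' @ xs) (ys' @ ys)" by (rule isometric_forms_append[OF assms(1)])
  also have "isometric_forms (ys' @ ys) (ys @ ys')" by (rule isometric_forms_perm) simp
  finally show ?thesis .
qed

lemma isometric_forms_cancel:
  assumes "isometric_forms (zs @ xs) (zs @ ys)" "0 \<notin> set zs"
  shows "isometric_forms xs ys"
proof -
  have "0 \<notin> set (rat_form zs)" using assms(2) by auto
  then show ?thesis
    using assms(1) embeds_append_cancel unfolding isometric_forms_def map_append by blast
qed

text \<open>Every relation is a difference of two isometric lists. A difference x - y exchanges the
  two lists of y, so both are kept free of 0, as Witt cancellation demands.\<close>

lemma gw_span_empty_isometric:
  assumes "x \<in> gw_span {}"
  shows "\<exists>xs ys. 0 \<notin> set xs \<and> x = gw_class xs - gw_class ys \<and> isometric_forms xs ys \<and> 0 \<notin> set ys"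
  using assms
proof induction
  case zero
  show ?case by (intro exI[of _ "[]"]) (simp add: isometric_forms_perm)
next
  case (diff x y)
  then obtain xs ys xs' ys' where h: "0 \<notin> set xs" "x = gw_class xs - gw_class ys" "isometric_forms xs ys"
     "0 \<notin> set ys" "0 \<notin> set xs'" "y = gw_class xs' - gw_class ys'" "isometric_forms xs' ys'" "0 \<notin> set ys'"
    by blast
  show ?case
    using h by (intro exI[of _ "xs @ ys'"] exI[of _ "ys @ xs'"])
      (simp add: isometric_forms_append2 isometric_forms_sym)
next
  case (gen a)
  then show ?case by simp
next
  case (square a s)
  have "isometric_forms [a * s * s] [a]"
    using embeds_square[of "rat_of_int a" "[]" "rat_of_int s"]
      embeds_square_rev[of "rat_of_int s" "rat_of_int a" "[]"] square
    by (simp add: isometric_forms_def)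
  then show ?case
    using square by (intro exI[of _ "[a * s * s]"] exI[of _ "[a]"]) simp
next
  case (binary a b)
  have "rat_of_int a + rat_of_int b \<noteq> 0" using binary by (simp flip: of_int_add)
  then have "isometric_forms [a, b] [a + b, a * b * (a + b)]"
    using embeds_binary_sum[of "rat_of_int a" "rat_of_int b"]
      embeds_binary_sum_rev[of "rat_of_int a" "rat_of_int b"]
    by (simp add: isometric_forms_def)
  then show ?case
    using binary by (intro exI[of _ "[a, b]"] exI[of _ "[a + b, a * b * (a + b)]"]) simp
qed

text \<open>Equality in the free abelian group is equality of multisets. So \<open>xs @ ys0\<close>
  is a permutation of \<open>ys @ xs0\<close>; replacing \<open>ys0\<close> by the isometric
  \<open>xs0\<close> leaves a common summand that Witt cancellation removes.\<close>

theorem gw_cong_imp_isometric_forms: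
  assumes "gw_cong {} (gw_class xs) (gw_class ys)"
  shows "isometric_forms xs ys"
proof -
  obtain xs0 ys0 where h: "0 \<notin> set xs0" "gw_class xs - gw_class ys = gw_class xs0 - gw_class ys0"
      "isometric_forms xs0 ys0"
    using gw_span_empty_isometric assms unfolding gw_cong_def by blast
  have "gw_class (xs @ ys0) = gw_class (ys @ xs0)"
    using h(2) by (simp add: algebra_simps)
  then have eq: "mset (xs @ ys0) = mset (ys @ xs0)" by (rule gw_class_eq_imp_mset_eq)
  have "isometric_forms (xs0 @ xs) (xs @ xs0)" by (rule isometric_forms_perm) simp
  also have "isometric_forms (xs @ xs0) (xs @ ys0)" by (rule isometric_forms_append[OF h(3)])
  also have "isometric_forms (xs @ ys0) (xs0 @ ys)" using eq by (intro isometric_forms_perm) simp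
  finally show ?thesis using h(1) by (rule isometric_forms_cancel)
qed

theorem isometric_to_signs_if_residues_vanish:
  assumes nz: "0 \<notin> set xs"
    and len: "length xs = r + s" "length (filter (\<lambda>a. a > 0) xs) = r"
    and v: "\<And>p. prime p \<Longrightarrow> 2 dvd (\<Sum>a\<leftarrow>xs. int (multiplicity p a))"
    and res: "\<And>p. prime p \<Longrightarrow> p > 2 \<Longrightarrow> 4 dvd (\<Sum>a\<leftarrow>xs. residue_class p a)"
  shows "isometric_forms (replicate r 1 @ replicate s (- 1)) xs"
proof -
  let ?D = "replicate r 1 @ replicate s (- 1) :: int list"
  define n where "n = nat (1 + (\<Sum>a\<leftarrow>xs. \<bar>a\<bar>))"
  have nonneg: "0 \<le> (\<Sum>a\<leftarrow>ys. \<bar>a\<bar>)" for ys :: "int list" by (induction ys) auto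
  have "\<bar>a\<bar> \<le> (\<Sum>a\<leftarrow>ys. \<bar>a\<bar>)" if "a \<in> set ys" for a :: int and ys
    using that nonneg by (induction ys) (auto intro: add_increasing add_increasing2)
  then have "\<bar>a\<bar> < int n" if "a \<in> set xs" for a
    using that nonneg[of xs] unfolding n_def by fastforce
  then have "a \<in> below (int n)" if "a \<in> set xs" for a
    using that nz by (intro below_abs_less) auto
  moreover have "1 \<in> below (int n)" "-1 \<in> below (int n)" by (auto simp: below_def)
  ultimately have below: "set xs \<subseteq> below (int n)" "set ?D \<subseteq> below (int n)" by auto
  have "gw_class ys \<in> gw_span (below (int n))" if "set ys \<subseteq> below (int n)" for ys
    using that by (induction ys) (auto intro: gw_span.zero gw_span_add gw_span.gen)
  from gw_span.diff[OF this[OF below(2)] this[OF below(1)]]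
  have x: "gw_class ?D - gw_class xs \<in> gw_span (below (int n))" .
  have W: "weight g (gw_class ?D - gw_class xs) = int r * g 1 + int s * g (- 1) - (\<Sum>a\<leftarrow>xs. g a)" for g
    by (simp add: sum_list_replicate)
  have unit: "multiplicity p (- 1) = 0" if "prime p" for p :: int
    using that by (intro not_dvd_imp_multiplicity_0) auto
  have pos: "(\<Sum>a\<leftarrow>ys. if a > 0 then 1 else 0) = int (length (filter (\<lambda>a. a > 0) ys))" for ys :: "int list"
    by (induction ys) auto
  have length: "(\<Sum>a\<leftarrow>ys. 1) = int (length ys)" for ys :: "int list"
    by (induction ys) auto
  have "gw_class ?D - gw_class xs \<in> gw_span {}"
  proof (rule gw_span_empty_if_invariants[OF x])
    fix p :: int assume p: "prime p"
    show "2 dvd weight (\<lambda>a. int (multiplicity p a)) (gw_class ?D - gw_class xs)"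
      unfolding W using v[OF p] unit[OF p] by simp
    show "4 dvd weight (residue_class p) (gw_class ?D - gw_class xs)" if "p > 2"
    proof -
      have "residue_class p 1 = 0" "residue_class p (- 1) = 0"
        using unit[OF p] by (simp_all add: residue_class_def)
      then show ?thesis unfolding W using res[OF p that] by simp
    qed
  next
    show "weight (\<lambda>a. 1) (gw_class ?D - gw_class xs) = 0"
      unfolding W length using len by simp
    show "weight (\<lambda>a. if a > 0 then 1 else 0) (gw_class ?D - gw_class xs) = 0"
      unfolding W pos using len by simp
  qed
  then show ?thesis by (intro gw_cong_imp_isometric_forms) (simp add: gw_cong_def)
qed

subsection \<open>Sums over a hyperbola\<close>

text \<open>The conditions on \<open>g\<close> start at k = 1 since the intended weight 1 / sqrt k
  has the default value 0 at k = 0 and is not decreasing there.\<close>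

lemma abel_summation_tail:
  fixes f g :: "nat \<Rightarrow> real"
  assumes M: "\<And>n. \<bar>\<Sum>k=1..n. f k\<bar> \<le> M"
    and g: "\<And>k. k > 0 \<Longrightarrow> g (Suc k) \<le> g k" "\<And>k. k > 0 \<Longrightarrow> g k \<ge> 0"
  shows "\<bar>\<Sum>k\<in>{u<..v}. f k * g k\<bar> \<le> 2 * M * g (Suc u)"
proof (cases "u < v")
  case False
  then show ?thesis using M[of 0] g(2)[of "Suc u"] by simp
next
  case True
  define F where "F n = (\<Sum>k=1..n. f k)" for n
  define T where "T n = (\<Sum>k\<in>{u<..n}. f k * g k)" for n
  have D: "\<bar>F n - F u\<bar> \<le> 2 * M" for n using M[of n] M[of u] unfolding F_def by linarith
  \<comment> \<open>Summation by parts in inductive form: each step adds (F n - F u) times a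
    decrement of \<open>g\<close>, and the decrements telescope.\<close>
  have "\<bar>T n - (F n - F u) * g n\<bar> \<le> 2 * M * (g (Suc u) - g n)" if "u < n" for n
    using that
  proof (induction n)
    case 0
    then show ?case by simp
  next
    case (Suc n)
    have F: "F (Suc n) = F n + f (Suc n)" by (simp add: F_def)
    show ?case
    proof (cases "u = n")
      case True
      then have "{u<..Suc n} = {Suc n}" by auto
      then show ?thesis using True F by (simp add: T_def)
    next
      case False
      then have less: "u < n" using Suc.prems by simp
      have "{u<..Suc n} = insert (Suc n) {u<..n}" using Suc.prems by auto
      then have T: "T (Suc n) = T n + f (Suc n) * g (Suc n)" by (simp add: T_def)
      have "T (Suc n) - (F (Suc n) - F u) * g (Suc n)
         = (T n - (F n - F u) * g n) + (F n - F u) * (g n - g (Suc n))"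
        unfolding T F by (simp add: algebra_simps)
      moreover have "\<bar>(F n - F u) * (g n - g (Suc n))\<bar> \<le> 2 * M * (g n - g (Suc n))"
        unfolding abs_mult using D[of n] g(1)[of n] less by (intro mult_mono) auto
      ultimately show ?thesis using Suc.IH[OF less] by (simp add: algebra_simps)
    qed
  qed
  from this[OF True] have "\<bar>T v\<bar> \<le> 2 * M * (g (Suc u) - g v) + \<bar>(F v - F u) * g v\<bar>" by linarith
  also have "\<bar>(F v - F u) * g v\<bar> \<le> 2 * M * g v"
    unfolding abs_mult using D[of v] g(2)[of v] True by (intro mult_mono) auto
  finally show ?thesis by (simp add: T_def algebra_simps)
qed

lemma sum_inverse_sqrt_le: "(\<Sum>k=1..n. 1 / sqrt (real k)) \<le> 2 * sqrt (real n)"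
proof (induction n)
  case (Suc n)
  have "1 / sqrt (real (Suc n)) \<le> 2 * (sqrt (real (Suc n)) - sqrt (real n))"
  proof -
    let ?a = "sqrt (real (Suc n))" and ?b = "sqrt (real n)"
    have ab: "?a > 0" "?b \<le> ?a" "?a * ?a - ?b * ?b = 1" by simp_all
    have "0 \<le> (?a - ?b) * (?a - ?b)" by simp
    then have "1 \<le> 2 * (?a - ?b) * ?a" using ab(3) by (simp add: algebra_simps)
    then show ?thesis using ab(1) by (simp add: divide_le_eq)
  qed
  then show ?case using Suc by simp
qed simp

text \<open>The bound is a square so that the cut of the hyperbola method falls on the integer
  \<open>Y\<close>: no point has both coordinates beyond it.\<close>

definition hyperbola_region :: "nat \<Rightarrow> (nat \<times> nat) set" where
  "hyperbola_region Y = {(a, b). 0 < a \<and> 0 < b \<and> a * b \<le> Y * Y}"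

lemma hyperbola_region_split:
  "hyperbola_region Y = {1..Y} \<times> {1..Y} \<union> ((SIGMA a:{1..Y}. {Y<..Y * Y div a})
     \<union> prod.swap ` (SIGMA b:{1..Y}. {Y<..Y * Y div b}))"
proof (rule Set.set_eqI)
  fix z :: "nat \<times> nat"
  obtain a b where z: "z = (a, b)" by (cases z)
  have corner: "a * b \<le> Y * Y \<longleftrightarrow> b \<le> Y * Y div a" if "0 < a" for a b
    using that by (simp add: less_eq_div_iff_mult_less_eq mult.commute)
  have "\<not> (Y < a \<and> Y < b \<and> a * b \<le> Y * Y)"
    using mult_strict_mono[of Y a Y b] by auto
  moreover have "a * b \<le> Y * Y" if "a \<le> Y" "b \<le> Y" using that by (intro mult_mono) auto
  moreover have "0 < b" if "Y < b" using that by simp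
  ultimately show "z \<in> hyperbola_region Y \<longleftrightarrow> z \<in> {1..Y} \<times> {1..Y} \<union> ((SIGMA a:{1..Y}. {Y<..Y * Y div a})
     \<union> prod.swap ` (SIGMA b:{1..Y}. {Y<..Y * Y div b}))"
    using corner[of a b] corner[of b a] unfolding z hyperbola_region_def
    by (auto simp: image_iff mult.commute Suc_le_eq)
qed

text \<open>Each inner tail beyond Y is at most 2 M / sqrt (Y + 1) by partial summation, and the sum
  of 1 / sqrt a over a up to Y is at most 2 sqrt Y. The roots cancel, uniformly in the upper limits
  \<open>h a\<close>.\<close>

lemma corner_sum_bound:
  fixes f g :: "nat \<Rightarrow> real"
  assumes M: "\<And>n. \<bar>\<Sum>k=1..n. g k\<bar> \<le> M" and f: "\<And>k. \<bar>f k\<bar> \<le> 1"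
  shows "\<bar>\<Sum>a\<in>{1..Y}. \<Sum>b\<in>{Y<..h a}. f a * g b / (sqrt (real a) * sqrt (real b))\<bar> \<le> 4 * M"
proof -
  have M0: "M \<ge> 0" using M[of 0] by simp
  have tail: "\<bar>\<Sum>b\<in>{Y<..v}. g b * (1 / sqrt (real b))\<bar> \<le> 2 * M * (1 / sqrt (real (Suc Y)))" for v
    by (rule abel_summation_tail[OF M]) (auto simp: frac_le)
  have "\<bar>\<Sum>a\<in>{1..Y}. \<Sum>b\<in>{Y<..h a}. f a * g b / (sqrt (real a) * sqrt (real b))\<bar>
      \<le> (\<Sum>a\<in>{1..Y}. \<bar>\<Sum>b\<in>{Y<..h a}. f a * g b / (sqrt (real a) * sqrt (real b))\<bar>)"
    by (rule sum_abs)
  also have "\<dots> \<le> (\<Sum>a\<in>{1..Y}. 1 / sqrt (real a) * (2 * M * (1 / sqrt (real (Suc Y)))))"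
  proof (rule sum_mono)
    fix a
    have "(\<Sum>b\<in>{Y<..h a}. f a * g b / (sqrt (real a) * sqrt (real b)))
        = f a * (1 / sqrt (real a)) * (\<Sum>b\<in>{Y<..h a}. g b * (1 / sqrt (real b)))"
      by (simp add: sum_distrib_left)
    also have "\<bar>\<dots>\<bar> \<le> 1 / sqrt (real a) * (2 * M * (1 / sqrt (real (Suc Y))))"
      unfolding abs_mult
      using mult_right_mono[OF f[of a], of "1 / sqrt (real a)"] tail[of "h a"]
      by (intro mult_mono) auto
    finally show "\<bar>\<Sum>b\<in>{Y<..h a}. f a * g b / (sqrt (real a) * sqrt (real b))\<bar>
        \<le> 1 / sqrt (real a) * (2 * M * (1 / sqrt (real (Suc Y))))" .
  qed
  also have "\<dots> = (\<Sum>a\<in>{1..Y}. 1 / sqrt (real a)) * (2 * M / sqrt (real (Suc Y)))"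
    by (subst sum_distrib_right) simp
  also have "\<dots> \<le> 2 * sqrt (real Y) * (2 * M / sqrt (real (Suc Y)))"
    using M0 by (intro mult_right_mono sum_inverse_sqrt_le) auto
  also have "\<dots> \<le> 4 * M"
  proof -
    have "sqrt (real Y) / sqrt (real (Suc Y)) \<le> 1" by simp
    then have "4 * M * (sqrt (real Y) / sqrt (real (Suc Y))) \<le> 4 * M * 1"
      using M0 by (intro mult_left_mono) auto
    then show ?thesis by (simp add: mult_ac)
  qed
  finally show ?thesis .
qed

text \<open>The square part is a product of two sums bounded by 2 M each, and each of the two
  corners contributes at most 4 M.\<close>

theorem hyperbola_sum_bound:
  fixes f g :: "nat \<Rightarrow> real"
  assumes Mf: "\<And>n. \<bar>\<Sum>k=1..n. f k\<bar> \<le> M" and Mg: "\<And>n. \<bar>\<Sum>k=1..n. g k\<bar> \<le> M"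
    and f: "\<And>k. \<bar>f k\<bar> \<le> 1" and g: "\<And>k. \<bar>g k\<bar> \<le> 1"
  shows "\<bar>\<Sum>(a, b)\<in>hyperbola_region Y. f a * g b / sqrt (real (a * b))\<bar> \<le> 4 * M * M + 8 * M"
proof -
  let ?F = "\<lambda>(a, b). f a * g b / sqrt (real (a * b))"
  let ?S = "\<lambda>f. \<Sum>k=1..Y. f k * (1 / sqrt (real k))"
  have M0: "M \<ge> 0" using Mf[of 0] by simp
  have square: "\<bar>?S h\<bar> \<le> 2 * M" if "\<And>n. \<bar>\<Sum>k=1..n. h k\<bar> \<le> M" for h
  proof -
    have "{0<..Y} = {1..Y}" by auto
    then show ?thesis
      using abel_summation_tail[OF that, of "\<lambda>k. 1 / sqrt (real k)" 0 Y] by (simp add: frac_le)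
  qed
  have "sum ?F ({1..Y} \<times> {1..Y}) = ?S f * ?S g"
    by (simp add: sum_product sum.cartesian_product real_sqrt_mult)
  then have A: "\<bar>sum ?F ({1..Y} \<times> {1..Y})\<bar> \<le> 4 * M * M"
    using mult_mono[OF square[OF Mf] square[OF Mg]] M0 by (simp add: abs_mult)
  have B: "\<bar>sum ?F (SIGMA a:{1..Y}. {Y<..Y * Y div a})\<bar> \<le> 4 * M"
    using corner_sum_bound[OF Mg f, where Y = Y and h = "\<lambda>a. Y * Y div a"]
    by (simp add: sum.Sigma real_sqrt_mult)
  have "sum ?F (prod.swap ` (SIGMA b:{1..Y}. {Y<..Y * Y div b}))
      = (\<Sum>(b, a)\<in>(SIGMA b:{1..Y}. {Y<..Y * Y div b}). f a * g b / sqrt (real (a * b)))"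
    by (subst sum.reindex) (auto simp: case_prod_beta intro!: inj_onI)
  then have C: "\<bar>sum ?F (prod.swap ` (SIGMA b:{1..Y}. {Y<..Y * Y div b}))\<bar> \<le> 4 * M"
    using corner_sum_bound[OF Mf g, where Y = Y and h = "\<lambda>a. Y * Y div a"]
    by (simp add: sum.Sigma real_sqrt_mult mult.commute)
  have "sum ?F (hyperbola_region Y) = sum ?F ({1..Y} \<times> {1..Y})
     + (sum ?F (SIGMA a:{1..Y}. {Y<..Y * Y div a})
     + sum ?F (prod.swap ` (SIGMA b:{1..Y}. {Y<..Y * Y div b})))"
    unfolding hyperbola_region_split
    by (subst sum.union_disjoint, simp, simp, fastforce)+ simp
  then show ?thesis using A B C by linarith
qed

lemma harmonic_unbounded: "\<exists>n. (\<Sum>k<n. 1 / real (Suc k)) \<ge> C"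
proof -
  have dyadic: "(\<Sum>k<2 ^ t. 1 / real (Suc k)) \<ge> real t / 2" for t
  proof (induction t)
    case (Suc t)
    have "(\<Sum>k<2 ^ Suc t. 1 / real (Suc k))
       = (\<Sum>k<2 ^ t. 1 / real (Suc k)) + (\<Sum>k\<in>{2 ^ t..<2 ^ Suc t}. 1 / real (Suc k))"
      by (subst sum.union_disjoint[symmetric]) (auto intro!: sum.cong)
    moreover have "(\<Sum>k\<in>{2 ^ t..<2 ^ Suc t}. 1 / real (Suc k)) \<ge> (\<Sum>k\<in>{2 ^ t..<2 ^ Suc t :: nat}. 1 / 2 ^ Suc t)"
    proof (rule sum_mono)
      fix k :: nat assume "k \<in> {2 ^ t..<2 ^ Suc t}"
      then have "Suc k \<le> 2 ^ Suc t" by auto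
      then have "real (Suc k) \<le> 2 ^ Suc t" by (metis of_nat_le_iff of_nat_numeral of_nat_power)
      then show "1 / 2 ^ Suc t \<le> 1 / real (Suc k)" by (intro divide_left_mono) auto
    qed
    ultimately show ?case using Suc by simp
  qed simp
  obtain t :: nat where t: "2 * C \<le> real t"
    using real_arch_simple by blast
  have "C \<le> (\<Sum>k<2 ^ t. 1 / real (Suc k))"
    using dyadic[of t] t by linarith
  then show ?thesis by (rule exI)
qed

subsection \<open>Divisor sums of quadratic characters\<close>

definition divisor_sum :: "(nat \<Rightarrow> real) \<Rightarrow> nat \<Rightarrow> real" where
  "divisor_sum \<chi> n = (\<Sum>d | d dvd n. \<chi> d)"

lemma divisor_sum_prime_power:
  assumes mult: "\<And>a b. \<chi> (a * b) = \<chi> a * \<chi> b" and one: "\<chi> 1 = 1"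
    and l: "prime l" "\<not> l dvd m"
  shows "divisor_sum \<chi> (l ^ k * m) = (\<Sum>i\<le>k. \<chi> l ^ i) * divisor_sum \<chi> m"
proof -
  have m: "m > 0" using l(2) by (cases m) auto
  have l0: "l > 0" "\<not> is_unit l" "l \<noteq> 0" using l(1) not_prime_unit[of l] by (auto simp: prime_gt_0_nat)
  have pow: "\<chi> (l ^ i) = \<chi> l ^ i" for i
    by (induction i) (simp_all add: mult one[simplified])
  let ?T = "{..k} \<times> {d. d dvd m}" and ?f = "\<lambda>(i, d). l ^ i * d"
  have inj: "inj_on ?f ?T"
  proof (rule inj_onI, clarify)
    fix i d j e assume h: "d dvd m" "e dvd m" "l ^ i * d = l ^ j * e"
    have nd: "\<not> l dvd d" "\<not> l dvd e" using h l(2) dvd_trans by blast+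
    have "multiplicity l (l ^ i * d) = i"
      using nd(1) l0 by (intro multiplicity_decomposeI[of _ _ _ d]) auto
    moreover have "multiplicity l (l ^ i * d) = j"
      using nd(2) l0 h(3) by (intro multiplicity_decomposeI[of _ _ _ e]) auto
    ultimately show "i = j \<and> d = e" using h(3) l0 by simp
  qed
  have image: "?f ` ?T = {d. d dvd l ^ k * m}"
  proof (intro Set.equalityI subsetI)
    fix x assume "x \<in> ?f ` ?T"
    then show "x \<in> {d. d dvd l ^ k * m}" by (auto intro!: mult_dvd_mono le_imp_power_dvd)
  next
    fix x assume "x \<in> {d. d dvd l ^ k * m}"
    then have x: "x dvd l ^ k * m" by simp
    then have x0: "x \<noteq> 0" using m l0 by (intro notI) simp
    obtain d where d: "x = l ^ multiplicity l x * d" "\<not> l dvd d"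
      using multiplicity_decompose'[OF x0 l0(2)] .
    have "coprime (l ^ k) d" using l(1) d(2) by (simp add: prime_imp_coprime)
    then have "d dvd m" using x d(1)
      by (metis coprime_commute coprime_dvd_mult_right_iff dvd_mult_right)
    moreover have "multiplicity l x \<le> k"
    proof -
      have "multiplicity l x \<le> multiplicity l (l ^ k * m)"
        using x m l0 by (intro dvd_imp_multiplicity_le) auto
      also have "\<dots> = k" using l(2) l0 by (intro multiplicity_decomposeI[of _ _ _ m]) auto
      finally show ?thesis .
    qed
    ultimately have "(multiplicity l x, d) \<in> ?T" by simp
    then show "x \<in> ?f ` ?T" using d(1) by (intro rev_image_eqI[of "(multiplicity l x, d)"]) auto
  qed
  have "divisor_sum \<chi> (l ^ k * m) = (\<Sum>z\<in>?T. \<chi> (?f z))"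
    unfolding divisor_sum_def image[symmetric] by (rule sum.reindex[OF inj, unfolded o_def])
  also have "\<dots> = (\<Sum>(i, d)\<in>?T. \<chi> l ^ i * \<chi> d)"
    by (intro sum.cong) (auto simp: mult pow)
  also have "\<dots> = (\<Sum>i\<le>k. \<chi> l ^ i) * divisor_sum \<chi> m"
    by (simp add: divisor_sum_def sum_product sum.cartesian_product)
  finally show ?thesis .
qed

text \<open>These are the local factors of a divisor sum at a prime power. For x = 0 the sum is its
  first term 0^0 = 1.\<close>

lemma geometric_sum_sign:
  fixes x :: real
  assumes "x \<in> {-1, 0, 1}"
  shows "(\<Sum>i\<le>k. x ^ i) \<ge> 0" "even k \<Longrightarrow> (\<Sum>i\<le>k. x ^ i) \<ge> 1"
    "x = - 1 \<Longrightarrow> odd k \<Longrightarrow> (\<Sum>i\<le>k. x ^ i) = 0"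
proof -
  have alt: "(\<Sum>i\<le>k. (- 1) ^ i) = (if even k then 1 else 0 :: real)" for k
    by (induction k) auto
  have zero: "(\<Sum>i\<le>k. 0 ^ i) = (1 :: real)" for k by (induction k) auto
  show "(\<Sum>i\<le>k. x ^ i) \<ge> 0" "even k \<Longrightarrow> (\<Sum>i\<le>k. x ^ i) \<ge> 1"
    "x = - 1 \<Longrightarrow> odd k \<Longrightarrow> (\<Sum>i\<le>k. x ^ i) = 0"
    using assms by (auto simp: alt zero)
qed

text \<open>By multiplicativity the divisor sum is a product of geometric sums over the primes of n;
  each is nonnegative, and at least 1 when the exponent is even.\<close>

lemma divisor_sum_nonneg:
  assumes mult: "\<And>a b. \<chi> (a * b) = \<chi> a * \<chi> b" and one: "\<chi> 1 = 1"
    and range: "\<And>a. \<chi> a \<in> {-1, 0, 1}" and "n > 0"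
  shows "divisor_sum \<chi> n \<ge> (if \<forall>l. prime l \<longrightarrow> even (multiplicity l n) then 1 else 0)"
  using \<open>n > 0\<close>
proof (induction n rule: less_induct)
  case (less n)
  show ?case
  proof (cases "n = 1")
    case True
    then show ?thesis using one by (simp add: divisor_sum_def)
  next
    case False
    then obtain l where l: "prime l" "l dvd n" using prime_factor_nat by blast
    have l1: "l > 1" using prime_gt_1_nat[OF l(1)] .
    have "n \<noteq> 0" "\<not> is_unit l" using less.prems l(1) not_prime_unit by auto
    then obtain m where m: "n = l ^ multiplicity l n * m" "\<not> l dvd m"
      by (rule multiplicity_decompose')
    let ?k = "multiplicity l n"
    have "?k > 0" using l less.prems by (simp add: prime_multiplicity_gt_zero_iff)
    then have "l ^ ?k > 1" using l1 by (intro one_less_power)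
    have m0: "m > 0" using m(2) by (cases m) auto
    then have "m < n" using \<open>l ^ ?k > 1\<close> by (subst m(1)) simp
    then have IH: "divisor_sum \<chi> m \<ge> (if \<forall>l. prime l \<longrightarrow> even (multiplicity l m) then 1 else 0)"
      using less.IH m0 by blast
    have eq: "divisor_sum \<chi> n = (\<Sum>i\<le>?k. \<chi> l ^ i) * divisor_sum \<chi> m"
      by (subst m(1), rule divisor_sum_prime_power[OF mult one l(1) m(2)])
    have other: "multiplicity q m = (if q = l then 0 else multiplicity q n)" if "prime q" for q
    proof (cases "q = l")
      case True
      then show ?thesis using m(2) by (simp add: not_dvd_imp_multiplicity_0)
    next
      case False
      have "multiplicity q n = multiplicity q (l ^ ?k) + multiplicity q m"
        using that m0 l1 by (subst m(1), intro prime_elem_multiplicity_mult_distrib) auto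
      moreover have "multiplicity q (l ^ ?k) = 0"
        using False that l(1) by (simp add: multiplicity_distinct_prime_power)
      ultimately show ?thesis using False by simp
    qed
    show ?thesis
    proof (cases "\<forall>l. prime l \<longrightarrow> even (multiplicity l n)")
      case True
      then have "divisor_sum \<chi> m \<ge> 1" using IH other by (auto split: if_splits)
      moreover have "(\<Sum>i\<le>?k. \<chi> l ^ i) \<ge> 1"
        using geometric_sum_sign(2)[OF range] True l(1) by blast
      ultimately have "divisor_sum \<chi> n \<ge> 1 * 1" unfolding eq by (intro mult_mono) auto
      then show ?thesis using True by simp
    next
      case False
      have "divisor_sum \<chi> m \<ge> 0" using IH by (auto split: if_splits)
      then have "divisor_sum \<chi> n \<ge> 0"
        unfolding eq using geometric_sum_sign(1)[OF range] by (intro mult_nonneg_nonneg)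
      then show ?thesis using False by (simp only: if_False)
    qed
  qed
qed

text \<open>The local factor at l is an alternating sum with an even number of terms. Read
  backwards, a nonzero divisor sum forces the desired condition on all primes that divide n to an
  odd power.\<close>

lemma divisor_sum_eq_0:
  assumes mult: "\<And>a b. \<chi> (a * b) = \<chi> a * \<chi> b" and one: "\<chi> 1 = 1"
    and l: "prime l" "\<chi> l = - 1" "odd (multiplicity l n)" and n: "n > 0"
  shows "divisor_sum \<chi> n = 0"
proof -
  have "n \<noteq> 0" "\<not> is_unit l" using n l(1) not_prime_unit by auto
  then obtain m where m: "n = l ^ multiplicity l n * m" "\<not> l dvd m"
    by (rule multiplicity_decompose')
  have "divisor_sum \<chi> n = (\<Sum>i\<le>multiplicity l n. \<chi> l ^ i) * divisor_sum \<chi> m"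
    by (subst m(1), rule divisor_sum_prime_power[OF mult one l(1) m(2)])
  also have "(\<Sum>i\<le>multiplicity l n. \<chi> l ^ i) = 0"
    using l by (intro geometric_sum_sign(3)) auto
  finally show ?thesis by simp
qed

lemma sum_hyperbola_region_divisors:
  "(\<Sum>(a, b)\<in>hyperbola_region Y. w (a * b) * \<chi> b) = (\<Sum>n=1..Y * Y. w n * divisor_sum \<chi> n)"
proof -
  have "(\<Sum>n=1..Y * Y. w n * divisor_sum \<chi> n)
     = (\<Sum>(n, b)\<in>(SIGMA n:{1..Y * Y}. {b. b dvd n}). w n * \<chi> b)"
    unfolding divisor_sum_def sum_distrib_left by (subst sum.Sigma) auto
  also have "\<dots> = (\<Sum>(a, b)\<in>hyperbola_region Y. w (a * b) * \<chi> b)"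
    by (rule sum.reindex_bij_witness[of _ "\<lambda>(a, b). (a * b, b)" "\<lambda>(n, b). (n div b, b)"])
      (auto simp: hyperbola_region_def Suc_le_eq mult.commute elim!: dvdE)
  finally show ?thesis by simp
qed

text \<open>Multiplication by c permutes the residues modulo m and changes the sign of f, so sums
  over full periods vanish and less than one period remains. Periods are counted from 0, the sum
  starts at 1; the additional 1 pays for f 0.\<close>

lemma periodic_character_sum_bounded:
  fixes f :: "nat \<Rightarrow> real"
  assumes m: "m > 0" and per: "\<And>k. f (k + m) = f k" and mult: "\<And>a b. f (a * b) = f a * f b"
    and c: "coprime c m" "f c = - 1" and le: "\<And>k. \<bar>f k\<bar> \<le> 1"
  shows "\<bar>\<Sum>k=1..n. f k\<bar> \<le> real m + 1"
proof -
  have per_mod: "f (k mod m) = f k" for k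
  proof (induction k rule: less_induct)
    case (less k)
    show ?case
    proof (cases "k < m")
      case False
      then have "f (k mod m) = f (k - m)" using less[of "k - m"] m by (simp add: le_mod_geq)
      also have "\<dots> = f k" using per[of "k - m"] False by simp
      finally show ?thesis .
    qed simp
  qed
  have bij: "bij_betw (\<lambda>k. (c * k) mod m) {..<m} {..<m}"
  proof (rule bij_betw_imageI)
    show inj: "inj_on (\<lambda>k. (c * k) mod m) {..<m}"
    proof (rule inj_onI)
      fix x y assume xy: "x \<in> {..<m}" "y \<in> {..<m}" "(c * x) mod m = (c * y) mod m"
      then have "[c * x = c * y] (mod m)" by (simp add: cong_def)
      then have "[x = y] (mod m)" using c(1) by (simp add: cong_mult_lcancel_nat)
      then show "x = y" using xy by (simp add: cong_def)
    qed
    show "(\<lambda>k. (c * k) mod m) ` {..<m} = {..<m}"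
      using m by (intro endo_inj_surj inj) auto
  qed
  have "(\<Sum>k<m. f k) = (\<Sum>k<m. f ((c * k) mod m))"
    by (rule sum.reindex_bij_betw[OF bij, symmetric])
  also have "\<dots> = - (\<Sum>k<m. f k)"
    by (simp add: per_mod mult c(2) sum_negf)
  finally have zero: "(\<Sum>k<m. f k) = 0" by simp
  have block: "\<bar>\<Sum>k<n. f k\<bar> \<le> real m" for n
  proof (induction n rule: less_induct)
    case (less n)
    show ?case
    proof (cases "n < m")
      case True
      have "\<bar>\<Sum>k<n. f k\<bar> \<le> (\<Sum>k<n. \<bar>f k\<bar>)" by (rule sum_abs)
      also have "\<dots> \<le> (\<Sum>k<n. 1)" by (intro sum_mono le)
      finally show ?thesis using True by simp
    next
      case False
      have split: "(\<Sum>k<m + t. f k) = (\<Sum>k<m. f k) + (\<Sum>k<t. f (m + k))" for t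
        by (induction t) simp_all
      have "(\<Sum>k<n. f k) = (\<Sum>k<m. f k) + (\<Sum>k<n - m. f (m + k))"
        using False by (simp flip: split)
      also have "\<dots> = (\<Sum>k<n - m. f k)" using zero per by (simp add: add.commute)
      finally show ?thesis using less[of "n - m"] False m by simp
    qed
  qed
  have "{..<Suc n} = insert 0 {1..n}" by auto
  then have "(\<Sum>k<Suc n. f k) = f 0 + (\<Sum>k=1..n. f k)" by simp
  then show ?thesis using block[of "Suc n"] le[of 0] by linarith
qed

subsection \<open>Integers in a prescribed genus\<close>

definition local_modulus :: "int \<Rightarrow> bool" where
  "local_modulus q \<longleftrightarrow> q = 4 \<or> (prime q \<and> q > 2)"

text \<open>The modulus 4 stands for the prime 2 and carries the nontrivial character modulo 4,
  which at an odd prime l is the Legendre symbol of -1.\<close>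

definition local_character :: "int \<Rightarrow> int \<Rightarrow> int" where
  "local_character q n = (if q = 4 then (if n mod 4 = 1 then 1 else if n mod 4 = 3 then - 1 else 0)
     else Legendre n q)"

text \<open>Coprimality to all of \<open>\<Prod>I\<close> is imposed for every \<open>V\<close>,
  which gives all these characters the same modulus; \<open>V = {}\<close> is the principal one.
  Values are real because they enter sums with weights 1 / sqrt n.\<close>

definition product_character :: "int set \<Rightarrow> int set \<Rightarrow> nat \<Rightarrow> real" where
  "product_character I V n =
     (if coprime (int n) (\<Prod>I) then real_of_int (\<Prod>q\<in>V. local_character q (int n)) else 0)"

lemma local_modulus_cases: "local_modulus q \<Longrightarrow> q = 4 \<or> q \<noteq> 4 \<and> prime q \<and> q > 2"
  by (auto simp: local_modulus_def)

lemma local_character_mult: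
  assumes "local_modulus q"
  shows "local_character q (a * b) = local_character q a * local_character q b"
proof (cases "q = 4")
  case True
  have m: "(a * b) mod 4 = ((a mod 4) * (b mod 4)) mod 4" by (simp add: mod_mult_eq)
  have "x mod 4 = 0 \<or> x mod 4 = 1 \<or> x mod 4 = 2 \<or> x mod 4 = 3" for x :: int by presburger
  from this[of a] this[of b] show ?thesis
    unfolding local_character_def True m by (elim disjE) simp_all
next
  case False
  then show ?thesis using local_modulus_cases[OF assms] by (simp add: local_character_def Legendre_mult)
qed

lemma local_character_cong:
  "[a = b] (mod q) \<Longrightarrow> local_character q a = local_character q b"
  using Legendre_cong[of a b q] by (cases "q = 4") (simp_all add: local_character_def cong_def)

lemma local_character_1: "local_modulus q \<Longrightarrow> local_character q 1 = 1"
  using local_modulus_cases[of q] Legendre_square[of q 1]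
  by (auto simp: local_character_def zdvd_not_zless)

lemma local_character_coprime:
  assumes "local_modulus q" "coprime n q"
  shows "local_character q n = 1 \<or> local_character q n = - 1"
proof (cases "q = 4")
  case True
  have "coprime n (2 * 2)" using assms(2) True by simp
  then have "coprime n 2" by (simp only: coprime_mult_right_iff)
  then have "odd n" by simp
  then have "n mod 4 = 1 \<or> n mod 4 = 3" by presburger
  then show ?thesis using True by (auto simp: local_character_def)
next
  case False
  then have "prime q" using local_modulus_cases[OF assms(1)] by blast
  then have "\<not> q dvd n" using assms(2) by (metis coprime_commute coprime_def dvd_refl not_prime_unit)
  then show ?thesis using False Legendre_values by (simp add: local_character_def)
qed

lemma local_character_negative:
  assumes "local_modulus q"
  obtains u where "local_character q u = - 1" "coprime u q"
proof (cases "q = 4")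
  case True
  have "coprime 3 (4 :: int)" using coprime_add_one_right[of "3 :: int"] by simp
  then show ?thesis using that[of 3] True by (simp add: local_character_def)
next
  case False
  then have q: "prime q" "q > 2" using local_modulus_cases[OF assms] by auto
  obtain u where u: "Legendre u q = - 1" using quadratic_nonresidue_exists[OF q] by blast
  then have "\<not> q dvd u" using Legendre_eq_0_iff[of u q] by simp
  then have "coprime u q" using q(1) by (simp add: coprime_commute prime_imp_coprime)
  then show ?thesis using that[of u] u False by (simp add: local_character_def)
qed

lemma local_moduli_coprime:
  assumes "local_modulus p" "local_modulus q" "p \<noteq> q"
  shows "coprime p q"
proof -
  have "coprime (4 :: int) q" if "prime q" "q > 2" for q
  proof -
    have "coprime (2 :: int) q" using primes_coprime[of 2 q] that by simp
    then have "coprime (2 * 2 :: int) q" by (simp only: coprime_mult_left_iff)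
    then show ?thesis by simp
  qed
  then show ?thesis
    using local_modulus_cases[OF assms(1)] local_modulus_cases[OF assms(2)] assms(3)
    by (auto simp: primes_coprime coprime_commute)
qed

section \<open>Characters modulo a product of local moduli\<close>

locale moduli =
  fixes I :: "int set"
  assumes finite: "finite I" and local: "\<And>q. q \<in> I \<Longrightarrow> local_modulus q"
begin

lemma modulus_pos: "q \<in> I \<Longrightarrow> q > 2"
  using local local_modulus_cases by fastforce

lemma prod_pos: "\<Prod>I > 0"
  using modulus_pos by (intro prod_pos) fastforce

lemma coprime_prod_iff: "coprime n (\<Prod>I) \<longleftrightarrow> (\<forall>q\<in>I. coprime n q)"
  using finite
proof (induction rule: finite_induct)
  case (insert q J)
  then show ?case by (simp add: coprime_mult_right_iff)
qed simp

lemma product_character_mult: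
  assumes "V \<subseteq> I"
  shows "product_character I V (a * b) = product_character I V a * product_character I V b"
proof -
  have "(\<Prod>q\<in>V. local_character q (int (a * b)))
      = (\<Prod>q\<in>V. local_character q (int a)) * (\<Prod>q\<in>V. local_character q (int b))"
    using assms local by (simp add: local_character_mult prod.distrib[symmetric] subset_iff)
  then show ?thesis by (simp add: product_character_def coprime_mult_left_iff)
qed

lemma product_character_1: "V \<subseteq> I \<Longrightarrow> product_character I V 1 = 1"
  using local by (auto simp: product_character_def local_character_1 subset_iff intro!: prod.neutral)

lemma product_character_coprime:
  assumes "V \<subseteq> I" "coprime (int n) (\<Prod>I)"
  shows "product_character I V n \<in> {-1, 1}"
proof -
  have val: "local_character q (int n) = 1 \<or> local_character q (int n) = - 1" if "q \<in> V" for q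
    using assms that local coprime_prod_iff by (intro local_character_coprime) auto
  have "finite V" using assms(1) finite finite_subset by blast
  from this val have "(\<Prod>q\<in>V. local_character q (int n)) \<in> {-1, 1}"
    by (induction V rule: finite_induct) force+
  then show ?thesis using assms(2) by (auto simp: product_character_def simp del: of_int_prod)
qed

lemma product_character_range: "V \<subseteq> I \<Longrightarrow> product_character I V n \<in> {-1, 0, 1}"
  using product_character_coprime[of V n] by (cases "coprime (int n) (\<Prod>I)") (auto simp: product_character_def)

lemma product_character_periodic:
  assumes "V \<subseteq> I"
  shows "product_character I V (n + nat (\<Prod>I)) = product_character I V n"
proof -
  have eq: "int (n + nat (\<Prod>I)) = int n + \<Prod>I" using prod_pos by simp
  have "local_character q (int n + \<Prod>I) = local_character q (int n)" if "q \<in> V" for q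
  proof (rule local_character_cong)
    have "q dvd \<Prod>I" using that assms finite by (intro dvd_prodI) auto
    then show "[int n + \<Prod>I = int n] (mod q)" by (simp add: cong_iff_dvd_diff)
  qed
  moreover have "coprime (int n + \<Prod>I) (\<Prod>I) \<longleftrightarrow> coprime (int n) (\<Prod>I)"
    by (simp add: coprime_iff_gcd_eq_1)
  ultimately show ?thesis unfolding product_character_def eq by simp
qed

text \<open>By the Chinese remainder theorem some c is negative at one chosen modulus of
  \<open>V\<close> and congruent to 1 at all others.\<close>

lemma product_character_negative:
  assumes V: "V \<subseteq> I" "V \<noteq> {}"
  obtains c where "coprime c (nat (\<Prod>I))" "product_character I V c = - 1"
proof -
  obtain q where q: "q \<in> V" "q \<in> I" using V by auto
  obtain u where u: "local_character q u = - 1" "coprime u q"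
    using local_character_negative[OF local[OF q(2)]] .
  let ?R = "\<Prod>(I - {q})"
  have R: "coprime q ?R"
    using q(2) local by (intro prod_coprime_right) (auto intro!: local_moduli_coprime)
  obtain x where x: "[x = u] (mod q)" "[x = 1] (mod ?R)"
    using binary_chinese_remainder_int[OF R] by blast
  define c where "c = nat (x mod \<Prod>I)"
  have "int c = x mod \<Prod>I" using prod_pos by (simp add: c_def)
  then have cx: "[int c = x] (mod r)" if "r \<in> I" for r
  proof -
    have "r dvd \<Prod>I" using that finite by (intro dvd_prodI) auto
    then show ?thesis unfolding \<open>int c = x mod \<Prod>I\<close> by (simp add: cong_def mod_mod_cancel)
  qed
  have c1: "[int c = 1] (mod r)" if "r \<in> I" "r \<noteq> q" for r
  proof -
    have "r dvd ?R" using that finite by (intro dvd_prodI) auto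
    then have "[x = 1] (mod r)" using x(2) by (rule cong_dvd_modulus[rotated])
    then show ?thesis using cx[OF that(1)] cong_trans by blast
  qed
  have cu: "[int c = u] (mod q)" using cx[OF q(2)] x(1) by (rule cong_trans)
  have "coprime (int c) r" if "r \<in> I" for r
  proof (cases "r = q")
    case True
    then show ?thesis using cu u(2) by (metis cong_imp_coprime cong_sym)
  next
    case False
    then show ?thesis using c1[OF that False] by (metis cong_imp_coprime cong_sym coprime_1_left)
  qed
  then have cop: "coprime (int c) (\<Prod>I)" by (simp add: coprime_prod_iff)
  have "local_character r (int c) = (if r = q then - 1 else 1)" if "r \<in> V" for r
    using that V(1) c1[of r] cu u(1) local_character_cong[of "int c" u q]
      local_character_cong[of "int c" 1 r] local_character_1[OF local, of r] by auto
  then have "(\<Prod>r\<in>V. local_character r (int c)) = (\<Prod>r\<in>V. if r = q then - 1 else 1)"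
    by (intro prod.cong) auto
  also have "\<dots> = - 1" using q(1) finite_subset[OF V(1) finite] by simp
  finally have "product_character I V c = - 1" using cop by (simp add: product_character_def)
  moreover have "coprime c (nat (\<Prod>I))" using cop prod_pos
    by (metis coprime_int_iff int_nat_eq less_imp_le)
  ultimately show ?thesis using that by blast
qed

lemma product_character_sum_bounded:
  assumes "V \<subseteq> I" "V \<noteq> {}"
  shows "\<bar>\<Sum>k=1..n. product_character I V k\<bar> \<le> real (nat (\<Prod>I)) + 1"
proof -
  obtain c where c: "coprime c (nat (\<Prod>I))" "product_character I V c = - 1"
    using product_character_negative[OF assms] .
  show ?thesis
  proof (rule periodic_character_sum_bounded[where m = "nat (\<Prod>I)" and c = c])
    show "nat (\<Prod>I) > 0" using prod_pos by simp
    show "\<bar>product_character I V k\<bar> \<le> 1" for k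
      using product_character_range[OF assms(1), of k] by auto
  qed (use c in \<open>auto simp: product_character_periodic product_character_mult assms\<close>)
qed

text \<open>Only squares are needed for the divergence, so no non-vanishing of \<open>L\<close>-functions enters.\<close>

lemma principal_divisor_sum_unbounded:
  "\<exists>Y. (\<Sum>n=1..Y * Y. product_character I {} n / sqrt (real n) * divisor_sum (product_character I I) n) \<ge> C"
proof -
  let ?m = "nat (\<Prod>I)"
  let ?w = "\<lambda>n. product_character I {} n / sqrt (real n) * divisor_sum (product_character I I) n"
  have m: "?m > 0" using prod_pos by simp
  note D = divisor_sum_nonneg[of "product_character I I", OF product_character_mult[OF order_refl]
      product_character_1[OF order_refl] product_character_range[OF order_refl]]
  have w0: "product_character I {} n \<ge> 0" for n by (simp add: product_character_def)
  have D0: "divisor_sum (product_character I I) n \<ge> 0" if "n > 0" for n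
    using D[OF that] by (auto split: if_splits)
  obtain J where J: "(\<Sum>j<J. 1 / real (Suc j)) \<ge> real ?m * C"
    using harmonic_unbounded by blast
  define Y where "Y = ?m * J + 1"
  \<comment> \<open>Numbers congruent to 1 modulo \<open>\<Prod>I\<close> are coprime to it, so at
    their squares the principal character is 1 and the divisor sum is at least 1. With the weight 1
    / sqrt n a harmonic series over a progression appears.\<close>
  define sq where "sq j = (?m * j + 1) * (?m * j + 1)" for j
  have inj: "inj_on sq {..<J}"
  proof (rule inj_onI)
    fix x y assume "sq x = sq y"
    then have "(?m * x + 1)\<^sup>2 = (?m * y + 1)\<^sup>2" unfolding sq_def by (simp only: power2_eq_square)
    then have "?m * x + 1 = ?m * y + 1" by (metis power2_eq_imp_eq zero_le)
    then show "x = y" using m by simp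
  qed
  have sub: "sq ` {..<J} \<subseteq> {1..Y * Y}"
  proof (rule image_subsetI)
    fix j assume "j \<in> {..<J}"
    then have "?m * j + 1 \<le> Y" unfolding Y_def by simp
    then have "sq j \<le> Y * Y" unfolding sq_def by (rule mult_le_mono) fact
    then show "sq j \<in> {1..Y * Y}" by (simp add: sq_def)
  qed
  have lower: "?w (sq j) \<ge> 1 / (real ?m * real (Suc j))" for j
  proof -
    let ?a = "?m * j + 1"
    have "coprime (int ?a) (\<Prod>I)"
    proof -
      have "int ?a = 1 + \<Prod>I * int j" using prod_pos by simp
      then show ?thesis by (simp add: coprime_iff_gcd_eq_1) (metis add.commute gcd_1_int gcd.commute gcd_add_mult mult.commute)
    qed
    then have "coprime (int ?a * int ?a) (\<Prod>I)" by (simp only: coprime_mult_left_iff)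
    then have "coprime (int (sq j)) (\<Prod>I)" by (simp only: sq_def of_nat_mult)
    then have "product_character I {} (sq j) = 1" by (simp add: product_character_def)
    moreover have "even (multiplicity l (sq j))" if "prime l" for l
      unfolding sq_def using that by (subst prime_elem_multiplicity_mult_distrib) auto
    then have "divisor_sum (product_character I I) (sq j) \<ge> 1"
      using D[of "sq j"] by (simp add: sq_def)
    moreover have "sqrt (real (sq j)) = real ?a"
      by (simp only: sq_def of_nat_mult real_sqrt_abs2 abs_of_nat)
    ultimately have w: "?w (sq j) \<ge> 1 / real ?a"
      by (simp add: divide_right_mono)
    have "real ?a \<le> real ?m * real (Suc j)"
    proof -
      have "?a \<le> ?m * Suc j" using m by simp
      then show ?thesis by (metis of_nat_le_iff of_nat_mult)
    qed
    moreover have "0 < real ?m * real (Suc j) * real ?a"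
      using m by (simp only: of_nat_mult[symmetric] of_nat_0_less_iff) simp
    ultimately have "1 / (real ?m * real (Suc j)) \<le> 1 / real ?a"
      by (rule divide_left_mono[OF _ zero_le_one])
    then show ?thesis using w by (rule order_trans)
  qed
  have "C \<le> (\<Sum>j<J. 1 / (real ?m * real (Suc j)))"
  proof -
    have "real ?m > 0" using m by (simp only: of_nat_0_less_iff)
    then have "C \<le> (\<Sum>j<J. 1 / real (Suc j)) / real ?m"
      using J by (simp only: pos_le_divide_eq mult.commute)
    also have "\<dots> = (\<Sum>j<J. 1 / (real ?m * real (Suc j)))"
      unfolding sum_divide_distrib by (intro sum.cong refl) (simp only: divide_divide_eq_left mult.commute)
    finally show ?thesis .
  qed
  also have "\<dots> \<le> (\<Sum>j<J. ?w (sq j))" by (intro sum_mono lower)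
  also have "\<dots> = sum ?w (sq ` {..<J})" by (simp add: sum.reindex[OF inj])
  also have "\<dots> \<le> sum ?w {1..Y * Y}"
    using sub w0 D0 by (intro sum_mono2) (auto intro!: mult_nonneg_nonneg divide_nonneg_nonneg)
  finally show ?thesis by blast
qed

text \<open>On n = a b the twisted term splits into the character of \<open>T\<close> at a and that
  of \<open>I - T\<close> at b, since the square of the former at b is 1 for b coprime to the
  modulus. Both are non-principal because \<open>T\<close> is neither empty nor \<open>I\<close>,
  and the hyperbola bound applies.\<close>

lemma nonprincipal_divisor_sum_bounded:
  assumes "T \<subseteq> I" "T \<noteq> {}" "T \<noteq> I"
  shows "\<bar>\<Sum>n=1..Y * Y. product_character I T n / sqrt (real n) * divisor_sum (product_character I I) n\<bar>
     \<le> 4 * (real (nat (\<Prod>I)) + 1) * (real (nat (\<Prod>I)) + 1) + 8 * (real (nat (\<Prod>I)) + 1)"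
proof -
  have split: "product_character I T b * product_character I I b = product_character I (I - T) b" for b
  proof (cases "coprime (int b) (\<Prod>I)")
    case True
    have "(\<Prod>q\<in>I. local_character q (int b))
       = (\<Prod>q\<in>I - T. local_character q (int b)) * (\<Prod>q\<in>T. local_character q (int b))"
      by (rule prod.subset_diff[OF assms(1) finite])
    moreover have "product_character I T b * product_character I T b = 1"
      using product_character_coprime[OF assms(1) True] by auto
    ultimately show ?thesis using True by (simp add: product_character_def)
  qed (simp add: product_character_def)
  have "(\<Sum>n=1..Y * Y. product_character I T n / sqrt (real n) * divisor_sum (product_character I I) n)
     = (\<Sum>(a, b)\<in>hyperbola_region Y. product_character I T (a * b) / sqrt (real (a * b)) * product_character I I b)"
    by (rule sum_hyperbola_region_divisors[symmetric])
  also have "\<dots> = (\<Sum>(a, b)\<in>hyperbola_region Y.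
      product_character I T a * product_character I (I - T) b / sqrt (real (a * b)))"
    by (intro sum.cong refl) (auto simp: product_character_mult[OF assms(1)] split[symmetric])
  also have "\<bar>\<dots>\<bar> \<le> 4 * (real (nat (\<Prod>I)) + 1) * (real (nat (\<Prod>I)) + 1) + 8 * (real (nat (\<Prod>I)) + 1)"
  proof (rule hyperbola_sum_bound)
    show "\<bar>product_character I T k\<bar> \<le> 1" for k using product_character_range[OF assms(1), of k] by auto
    show "\<bar>product_character I (I - T) k\<bar> \<le> 1" for k using product_character_range[of "I - T" k] by auto
    show "\<bar>\<Sum>k=1..n. product_character I T k\<bar> \<le> real (nat (\<Prod>I)) + 1" for n
      by (rule product_character_sum_bounded[OF assms(1,2)])
    have "I - T \<noteq> {}" using assms(1,3) by blast
    then show "\<bar>\<Sum>k=1..n. product_character I (I - T) k\<bar> \<le> real (nat (\<Prod>I)) + 1" for n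
      by (intro product_character_sum_bounded) auto
  qed
  finally show ?thesis .
qed

text \<open>If no n were admissible, expanding over the subsets of \<open>S\<close> would bound the
  divergent principal sum by finitely many bounded ones. Strictness of \<open>S \<subset> I\<close>
  excludes the twist by \<open>I\<close> itself, whose product with the character of the divisor sum
  is principal.\<close>

theorem genus_exists:
  fixes \<epsilon> :: "int \<Rightarrow> int"
  assumes S: "S \<subset> I" and \<epsilon>: "\<And>p. p \<in> S \<Longrightarrow> \<epsilon> p = 1 \<or> \<epsilon> p = - 1"
  obtains n where "n > 0" "coprime (int n) (\<Prod>I)" "\<And>p. p \<in> S \<Longrightarrow> local_character p (int n) = \<epsilon> p"
    "\<And>l. prime l \<Longrightarrow> odd (multiplicity l n) \<Longrightarrow> product_character I I l = 1"
proof -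
  let ?D = "divisor_sum (product_character I I)"
  let ?B = "4 * (real (nat (\<Prod>I)) + 1) * (real (nat (\<Prod>I)) + 1) + 8 * (real (nat (\<Prod>I)) + 1)"
  have SI: "S \<subseteq> I" and finS: "finite S" using S finite finite_subset by auto
  \<comment> \<open>For n coprime to the moduli each factor is 0 or 2, so \<open>w\<close> is
    supported on the n with the prescribed symbols.\<close>
  define w where "w n = product_character I {} n * (\<Prod>p\<in>S. 1 + real_of_int (\<epsilon> p * local_character p (int n)))" for n
  have expand: "w n = (\<Sum>T\<in>Pow S. real_of_int (\<Prod>p\<in>T. \<epsilon> p) * product_character I T n)" for n
  proof -
    have "(\<Prod>p\<in>S. 1 + real_of_int (\<epsilon> p * local_character p (int n)))
       = (\<Sum>T\<in>Pow S. (\<Prod>p\<in>T. real_of_int (\<epsilon> p * local_character p (int n))))"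
      using prod_add[OF finS, of "\<lambda>p. real_of_int (\<epsilon> p * local_character p (int n))" "\<lambda>_. 1"]
      by (simp add: add.commute)
    then show ?thesis
      unfolding w_def by (auto simp: product_character_def prod.distrib sum_distrib_left)
  qed
  have "\<exists>n>0. w n * ?D n \<noteq> 0"
  proof (rule ccontr)
    assume *: "\<not> ?thesis"
    obtain Y where Y: "(\<Sum>n=1..Y * Y. product_character I {} n / sqrt (real n) * ?D n)
        \<ge> real (card (Pow S)) * ?B + 1"
      using principal_divisor_sum_unbounded by blast
    define Z where "Z T = (\<Sum>n=1..Y * Y. product_character I T n / sqrt (real n) * ?D n)" for T
    have "0 = (\<Sum>n=1..Y * Y. w n / sqrt (real n) * ?D n)"
    proof (rule sum.neutral[symmetric], rule ballI)
      fix n assume "n \<in> {1..Y * Y}"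
      then have "n > 0" by simp
      then have "w n * ?D n = 0" using * by blast
      then show "w n / sqrt (real n) * ?D n = 0" by (simp only: times_divide_eq_left div_0)
    qed
    also have "\<dots> = (\<Sum>n=1..Y * Y. \<Sum>T\<in>Pow S. real_of_int (\<Prod>p\<in>T. \<epsilon> p) *
        (product_character I T n / sqrt (real n) * ?D n))"
      unfolding expand by (simp add: sum_divide_distrib sum_distrib_right mult.assoc)
    also have "\<dots> = (\<Sum>T\<in>Pow S. real_of_int (\<Prod>p\<in>T. \<epsilon> p) * Z T)"
      unfolding Z_def by (subst sum.swap) (simp add: sum_distrib_left)
    also have "\<dots> = Z {} + (\<Sum>T\<in>Pow S - {{}}. real_of_int (\<Prod>p\<in>T. \<epsilon> p) * Z T)"
      using finS by (subst sum.remove[of _ "{}"]) auto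
    finally have "Z {} = - (\<Sum>T\<in>Pow S - {{}}. real_of_int (\<Prod>p\<in>T. \<epsilon> p) * Z T)" by simp
    also have "\<dots> \<le> \<bar>\<Sum>T\<in>Pow S - {{}}. real_of_int (\<Prod>p\<in>T. \<epsilon> p) * Z T\<bar>" by simp
    also have "\<dots> \<le> (\<Sum>T\<in>Pow S - {{}}. \<bar>real_of_int (\<Prod>p\<in>T. \<epsilon> p) * Z T\<bar>)" by (rule sum_abs)
    also have "\<dots> \<le> (\<Sum>T\<in>Pow S - {{}}. ?B)"
    proof (rule sum_mono)
      fix T assume T: "T \<in> Pow S - {{}}"
      then have "finite T" using finS finite_subset by auto
      then have "\<bar>real_of_int (\<Prod>p\<in>T. \<epsilon> p)\<bar> = 1"
        using T \<epsilon> by (subst of_int_prod, subst abs_prod) (force intro!: prod.neutral)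
      moreover have "\<bar>Z T\<bar> \<le> ?B"
        unfolding Z_def using T S by (intro nonprincipal_divisor_sum_bounded) auto
      ultimately show "\<bar>real_of_int (\<Prod>p\<in>T. \<epsilon> p) * Z T\<bar> \<le> ?B" by (simp only: abs_mult mult_1)
    qed
    also have "\<dots> \<le> real (card (Pow S)) * ?B"
    proof -
      have "card (Pow S - {{}}) \<le> card (Pow S)" using finS by (intro card_mono) auto
      then have "real (card (Pow S - {{}})) * ?B \<le> real (card (Pow S)) * ?B"
        by (intro mult_right_mono) auto
      then show ?thesis by simp
    qed
    finally show False using Y unfolding Z_def by simp
  qed
  then obtain n where n: "n > 0" "w n \<noteq> 0" "?D n \<noteq> 0" by auto
  have cop: "coprime (int n) (\<Prod>I)"
    using n(2) by (auto simp: w_def product_character_def split: if_splits)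
  show ?thesis
  proof (rule that[OF n(1) cop])
    fix p assume p: "p \<in> S"
    have "1 + real_of_int (\<epsilon> p * local_character p (int n)) \<noteq> 0"
      using n(2) p finS unfolding w_def by (auto simp del: of_int_mult)
    then have "1 + \<epsilon> p * local_character p (int n) \<noteq> 0"
      by (metis of_int_0 of_int_1 of_int_add)
    moreover have "local_character p (int n) = 1 \<or> local_character p (int n) = - 1"
      using p SI cop coprime_prod_iff local by (intro local_character_coprime) auto
    ultimately show "local_character p (int n) = \<epsilon> p" using \<epsilon>[OF p] by auto
  next
    fix l :: nat assume l: "prime l" "odd (multiplicity l n)"
    have "l dvd n" using l(2) not_dvd_imp_multiplicity_0 by fastforce
    then have "coprime (int l) (\<Prod>I)" using cop
      by (meson coprime_divisors dvd_refl int_dvd_int_iff)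
    then have "product_character I I l \<in> {-1, 1}" by (rule product_character_coprime[OF order_refl])
    moreover have "product_character I I l \<noteq> - 1"
      using divisor_sum_eq_0[of "product_character I I", OF product_character_mult[OF order_refl]
        product_character_1[OF order_refl] l(1) _ l(2) n(1)] n(3) by blast
    ultimately show "product_character I I l = 1" by auto
  qed
qed

end

subsection \<open>Prescribed Legendre symbols\<close>

text \<open>Reciprocity arranged so that l is the argument of every character on the right: the
  exchange costs the symbol of -1 at l exactly when p is 3 modulo 4.\<close>

lemma odd_prime_reciprocity:
  fixes p l :: int
  assumes p: "prime p" "p > 2" and l: "prime l" "l > 2" and "p \<noteq> l"
  shows "Legendre p l = Legendre l p * (if p mod 4 = 3 then local_character 4 l else 1)"
proof -
  have primes: "prime (nat p)" "prime (nat l)" using p l prime_int_nat_transfer by blast+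
  have half: "even ((q - 1) div 2) \<longleftrightarrow> q mod 4 = 1" if "q mod 4 = 1 \<or> q mod 4 = 3" for q :: int
    using that by presburger
  have nonneg: "(p - 1) div 2 \<ge> 0" "(l - 1) div 2 \<ge> 0" using p l by simp_all
  then have "even (nat ((p - 1) div 2 * ((l - 1) div 2))) \<longleftrightarrow> p mod 4 = 1 \<or> l mod 4 = 1"
    using half[OF odd_prime_int[OF p]] half[OF odd_prime_int[OF l]] by (simp add: even_nat_iff)
  then have qr: "Legendre p l * Legendre l p = (if p mod 4 = 1 \<or> l mod 4 = 1 then 1 else - 1)"
    using Quadratic_Reciprocity_int[OF primes(1) p(2) primes(2) l(2) assms(5)] by simp
  have "\<not> p dvd l" using primes_dvd_imp_eq[of p l] p(1) l(1) assms(5) by blast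
  then have "Legendre l p = 1 \<or> Legendre l p = - 1" by (rule Legendre_values)
  then show ?thesis
    using qr odd_prime_int[OF p] odd_prime_int[OF l] by (auto simp: local_character_def)
qed

text \<open>The sign -1 and every prime congruent to 3 modulo 4 contribute one factor
  \<open>local_character 4 l\<close>. Its square is 1, and the parity of the number of these
  contributions is the class of the product modulo 4.\<close>

lemma Legendre_prod_primes:
  fixes l s :: int
  assumes "finite S" and S: "\<And>p. p \<in> S \<Longrightarrow> prime p \<and> p > 2" and l: "prime l" "l > 2" "l \<notin> S"
    and s: "s = 1 \<or> s = - 1"
  shows "((s * \<Prod>S) mod 4 = 1 \<or> (s * \<Prod>S) mod 4 = 3) \<and> Legendre (s * \<Prod>S) l =
     (\<Prod>p\<in>S. Legendre l p) * (if (s * \<Prod>S) mod 4 = 3 then local_character 4 l else 1)"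
  using assms(1) S l(3)
proof (induction rule: finite_induct)
  case empty
  have "Legendre 1 l = 1" using local_character_1[of l] l by (simp add: local_modulus_def local_character_def split: if_splits)
  then show ?case
    using s odd_prime_int[OF l(1,2)] by (auto simp: Legendre_minus_one[OF l(1,2)] local_character_def)
next
  case (insert p S)
  let ?N = "s * \<Prod>S"
  have p: "prime p" "p > 2" "p \<noteq> l" using insert.prems by auto
  have IH: "?N mod 4 = 1 \<or> ?N mod 4 = 3"
    "Legendre ?N l = (\<Prod>p\<in>S. Legendre l p) * (if ?N mod 4 = 3 then local_character 4 l else 1)"
    using insert.IH insert.prems by blast+
  have N: "s * \<Prod>(insert p S) = p * ?N" using insert.hyps by (simp add: mult_ac)
  have mod: "(p * ?N) mod 4 = ((p mod 4) * (?N mod 4)) mod 4" by (simp add: mod_mult_eq)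
  have "local_character 4 l * local_character 4 l = 1"
    using odd_prime_int[OF l(1,2)] by (auto simp: local_character_def)
  then show ?case
    unfolding N mod Legendre_mult[OF l(1,2), of p ?N] IH(2) odd_prime_reciprocity[OF p(1,2) l(1,2) p(3)]
    using insert.hyps IH(1) odd_prime_int[OF p(1,2)] by (elim disjE) (simp_all add: mult_ac)
qed

text \<open>Euclid's argument for 4 \<open>\<Prod>S\<close> - 1, which cannot consist of primes
  congruent to 1 modulo 4 alone.\<close>

lemma prime_mod_4_3_not_in:
  fixes S :: "int set"
  assumes "finite S" and S: "\<And>p. p \<in> S \<Longrightarrow> prime p \<and> p > 2"
  obtains q where "prime q" "q mod 4 = 3" "q \<notin> S"
proof -
  have one_mod_4: "n mod 4 = 1" if "n > 0" "\<And>q. prime q \<Longrightarrow> q dvd n \<Longrightarrow> q mod 4 = 1" for n :: int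
    using that
  proof (induction n rule: prime_divisors_induct)
    case zero
    then show ?case by simp
  next
    case (unit n)
    then have "n = 1" by auto
    then show ?case by simp
  next
    case (factor q n)
    have "n > 0" using factor.prems(1) prime_gt_0_int[OF factor.hyps] by (simp add: zero_less_mult_iff)
    then have "n mod 4 = 1" using factor.IH factor.prems(2) by simp
    moreover have "q mod 4 = 1" using factor by simp
    ultimately show ?case using mod_mult_eq[of q 4 n] by simp
  qed
  define M where "M = 4 * \<Prod>S - 1"
  have pos: "\<Prod>S > 0" using S by (intro prod_pos) fastforce
  then have "M > 0" by (simp add: M_def)
  have M: "M mod 4 = 3" unfolding M_def by presburger
  then obtain q where q: "prime q" "q dvd M" "q mod 4 \<noteq> 1"
    using one_mod_4[OF \<open>M > 0\<close>] by auto
  have "odd M" using M by presburger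
  then have "q \<noteq> 2" using q(2) by auto
  then have "q > 2" using prime_ge_2_int[OF q(1)] by simp
  then have "q mod 4 = 3" using odd_prime_int[OF q(1)] q(3) by blast
  moreover have "q \<notin> S"
  proof
    assume "q \<in> S"
    then have "q dvd \<Prod>S" using assms(1) by (intro dvd_prodI) auto
    then have "q dvd 4 * \<Prod>S - M" using q(2) by (intro dvd_diff) auto
    moreover have "4 * \<Prod>S - M = 1" by (simp add: M_def)
    ultimately have "is_unit q" by (simp only:)
    then show False using q(1) not_prime_unit by blast
  qed
  ultimately show ?thesis using that q(1) by blast
qed

lemma multiplicity_int_nat:
  assumes "prime (l :: int)" "n > 0"
  shows "multiplicity l (int n) = multiplicity (nat l) n"
proof -
  have l: "prime (nat l)" using assms(1) prime_int_nat_transfer by blast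
  have nat_l: "int (nat l) = l" using prime_ge_0_int[OF assms(1)] by simp
  have "n \<noteq> 0" "\<not> is_unit (nat l)" using assms(2) l not_prime_unit by (simp, blast)
  then obtain m where m: "n = nat l ^ multiplicity (nat l) n * m" "\<not> nat l dvd m"
    by (rule multiplicity_decompose')
  have "int n = l ^ multiplicity (nat l) n * int m"
    using arg_cong[OF m(1), of int] by (simp only: of_nat_mult of_nat_power nat_l)
  moreover have "int (nat l) dvd int m \<longleftrightarrow> nat l dvd m" by (rule int_dvd_int_iff)
  then have "\<not> l dvd int m" using m(2) unfolding nat_l by blast
  ultimately show ?thesis using assms(1) by (intro unit_part_eqI(1))
qed

text \<open>The residue 3 modulo 4 makes the symbol of \<open>s * \<Prod>S\<close> at l the product
  character of \<open>insert 4 S\<close>. Nothing is prescribed at 4, so \<open>S\<close> is a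
  proper subset of the moduli, as the existence of a genus requires.\<close>

theorem prescribed_Legendre_symbols:
  fixes S :: "int set"
  assumes fin: "finite S" and S: "\<And>p. p \<in> S \<Longrightarrow> prime p \<and> p > 2"
    and s: "s = 1 \<or> s = - 1" "(s * \<Prod>S) mod 4 = 3"
    and \<epsilon>: "\<And>p. p \<in> S \<Longrightarrow> \<epsilon> p = 1 \<or> \<epsilon> p = - 1"
  obtains n :: int where "n > 0" "\<And>p. p \<in> S \<Longrightarrow> Legendre n p = \<epsilon> p"
    "\<And>l. prime l \<Longrightarrow> l > 2 \<Longrightarrow> odd (multiplicity l n) \<Longrightarrow> Legendre (s * \<Prod>S) l = 1"
proof -
  have four: "4 \<notin> S"
  proof
    assume "4 \<in> S"
    then have "prime (4 :: int)" using S by blast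
    then show False using primes_dvd_imp_eq[of "2 :: int" 4] by simp
  qed
  interpret moduli "insert 4 S"
    using fin S by unfold_locales (auto simp: local_modulus_def)
  obtain n where n: "n > 0" "coprime (int n) (\<Prod>(insert 4 S))"
    "\<And>p. p \<in> S \<Longrightarrow> local_character p (int n) = \<epsilon> p"
    "\<And>l. prime l \<Longrightarrow> odd (multiplicity l n) \<Longrightarrow> product_character (insert 4 S) (insert 4 S) l = 1"
    using genus_exists[of S \<epsilon>] four \<epsilon> by blast
  show ?thesis
  proof (rule that[of "int n"])
    show "int n > 0" using n(1) by simp
    show "Legendre (int n) p = \<epsilon> p" if "p \<in> S" for p
      using n(3)[OF that] that four by (auto simp: local_character_def split: if_splits)
    fix l :: int assume l: "prime l" "l > 2" "odd (multiplicity l (int n))"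
    have ln: "prime (nat l)" using l(1) prime_int_nat_transfer by blast
    have nat_l: "int (nat l) = l" using l(2) by simp
    have "odd (multiplicity (nat l) n)" using l(3) multiplicity_int_nat[OF l(1) n(1)] by simp
    then have one: "product_character (insert 4 S) (insert 4 S) (nat l) = 1" using n(4) ln by blast
    then have "coprime l (\<Prod>(insert 4 S))"
      using nat_l by (auto simp: product_character_def split: if_splits)
    then have "coprime l p" if "p \<in> S" for p using that by (simp add: coprime_prod_iff)
    then have "l \<notin> S" using l(1) not_prime_unit by (metis coprime_self)
    have "real_of_int (\<Prod>q\<in>insert 4 S. local_character q l) = 1"
      using one nat_l by (simp add: product_character_def del: of_int_prod split: if_splits)
    then have "(\<Prod>q\<in>insert 4 S. local_character q l) = 1" by (simp only: of_int_eq_1_iff)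
    then have "local_character 4 l * (\<Prod>q\<in>S. local_character q l) = 1" using fin four by simp
    moreover have "(\<Prod>q\<in>S. local_character q l) = (\<Prod>q\<in>S. Legendre l q)"
      using four by (intro prod.cong) (auto simp: local_character_def)
    ultimately show "Legendre (s * \<Prod>S) l = 1"
      using Legendre_prod_primes[OF fin S l(1,2) \<open>l \<notin> S\<close> s(1)] s(2) by (simp add: mult.commute)
  qed
qed

subsection \<open>Ternary forms with prescribed residues\<close>

text \<open>Up to the factor \<open>d\<close>, the form \<open>\<langle>dx, dy, dxy\<rangle>\<close> is the pure part of the norm form of the
  quaternion algebra \<open>(-x, -y)\<close>. Its determinant is \<open>d\<close> up to squares, and its residue at \<open>p\<close> differs
  from the unramified value exactly if the algebra ramifies at \<open>p\<close>.\<close>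

lemma residue_class_ternary:
  fixes p :: int
  assumes p: "prime p" "p > 2" and nz: "d \<noteq> 0" "x \<noteq> 0" "y \<noteq> 0"
  defines "R \<equiv> residue_class p (d * x) + residue_class p (d * y) + residue_class p (d * x * y)"
  shows "even (multiplicity p x) \<Longrightarrow> even (multiplicity p y) \<Longrightarrow> 4 dvd R + residue_class p d"
    and "even (multiplicity p x) \<Longrightarrow> odd (multiplicity p y) \<Longrightarrow> unit_symbol p (- x) = 1 \<Longrightarrow>
      4 dvd R + residue_class p d"
    and "odd (multiplicity p x) \<Longrightarrow> even (multiplicity p y) \<Longrightarrow> unit_symbol p (- y) = 1 \<Longrightarrow>
      4 dvd R + residue_class p d"
    and "odd (multiplicity p x) \<Longrightarrow> even (multiplicity p y) \<Longrightarrow> unit_symbol p (- y) = - 1 \<Longrightarrow>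
      4 dvd R + residue_class p d + 2"
proof -
  have nd: "\<not> p dvd - 1" using p by (simp add: zdvd_not_zless)
  have m1: "unit_symbol p (- 1) = (if p mod 4 = 1 then 1 else - 1)"
    using unit_symbol_eqI[OF p(1) nd, of "-1" 0] Legendre_minus_one[OF p] by simp
  have neg: "unit_symbol p (- z) = (if p mod 4 = 1 then 1 else - 1) * unit_symbol p z" if "z \<noteq> 0" for z
    using unit_symbol_mult[OF p, of "-1" z] that m1 by simp
  note facts = R_def residue_class_def multiplicity_prime_mult[OF p(1)] unit_symbol_mult[OF p] nz
    neg[OF nz(2)] neg[OF nz(3)]
  note vals = unit_symbol_values[OF p(1) nz(1)] unit_symbol_values[OF p(1) nz(2)]
    unit_symbol_values[OF p(1) nz(3)]
  show "even (multiplicity p x) \<Longrightarrow> even (multiplicity p y) \<Longrightarrow> 4 dvd R + residue_class p d"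
    using vals by (elim disjE) (simp_all add: facts)
  show "even (multiplicity p x) \<Longrightarrow> odd (multiplicity p y) \<Longrightarrow> unit_symbol p (- x) = 1 \<Longrightarrow>
      4 dvd R + residue_class p d"
    using vals by (elim disjE) (simp_all add: facts split: if_splits)
  show "odd (multiplicity p x) \<Longrightarrow> even (multiplicity p y) \<Longrightarrow> unit_symbol p (- y) = 1 \<Longrightarrow>
      4 dvd R + residue_class p d"
    using vals by (elim disjE) (simp_all add: facts split: if_splits)
  show "odd (multiplicity p x) \<Longrightarrow> even (multiplicity p y) \<Longrightarrow> unit_symbol p (- y) = - 1 \<Longrightarrow>
      4 dvd R + residue_class p d + 2"
    using vals by (elim disjE) (simp_all add: facts split: if_splits)
qed

text \<open>Modulo 2 the residue of a form depends on its total valuation only, hence on the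
  determinant. Two forms with the same total valuation at p therefore have residues that differ by
  an even number.\<close>

lemma residue_class_parity:
  fixes p :: int
  assumes "prime p" "a \<noteq> 0"
  shows "even (residue_class p a - (if p mod 4 = 1 then 0 else int (multiplicity p a)))"
  using unit_symbol_values[OF assms] by (auto simp: residue_class_def)

lemma multiplicity_minus: "multiplicity p (- a) = multiplicity p (a :: int)"
  using multiplicity_times_unit_right[of "-1" p a] by simp

theorem complementary_ternary_form:
  fixes xs :: "int list"
  assumes nz: "0 \<notin> set xs" and k: "k \<le> 3"
  obtains b1 b2 b3 where "0 \<notin> set [b1, b2, b3]" "length (filter (\<lambda>a. a > 0) [b1, b2, b3]) = k"
    "\<forall>p. prime p \<longrightarrow> 2 dvd (\<Sum>a\<leftarrow>[b1, b2, b3] @ xs. int (multiplicity p a))"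
    "\<forall>p. prime p \<longrightarrow> p > 2 \<longrightarrow> 4 dvd (\<Sum>a\<leftarrow>[b1, b2, b3] @ xs. residue_class p a)"
proof -
  have prod_nz: "prod_list xs \<noteq> 0" using nz by (simp add: prod_list_zero_iff)
  \<comment> \<open>Up to squares d is the determinant of <dx, dy, dxy>, so its absolute value
    copies that of the given form; its sign is (-1)^(3 - k), as there are 3 - k negative
    entries.\<close>
  define d where "d = (if odd k then \<bar>prod_list xs\<bar> else - \<bar>prod_list xs\<bar>)"
  have d: "d \<noteq> 0" "d > 0 \<longleftrightarrow> odd k" using prod_nz by (auto simp: d_def)
  have mult_d: "int (multiplicity p d) = (\<Sum>a\<leftarrow>xs. int (multiplicity p a))" if "prime p" for p
  proof -
    have "multiplicity p d = multiplicity p (prod_list xs)"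
      by (simp add: d_def abs_if multiplicity_minus)
    moreover have "int (multiplicity p (prod_list ys)) = (\<Sum>a\<leftarrow>ys. int (multiplicity p a))"
      if "0 \<notin> set ys" for ys
      using that \<open>prime p\<close> by (induction ys) (auto simp: multiplicity_prime_mult prod_list_zero_iff)
    ultimately show ?thesis using nz by simp
  qed
  define defect where "defect p = (\<Sum>a\<leftarrow>xs. residue_class p a) - residue_class p d" for p
  \<comment> \<open>These are the odd primes at which the quaternion algebra is to ramify; the
    defect is even, so it is 2 modulo 4 there.\<close>
  define S where "S = {p. prime p \<and> p > 2 \<and> \<not> 4 dvd defect p}"
  have even_defect: "even (defect p)" if p: "prime p" for p
  proof -
    have "even ((\<Sum>a\<leftarrow>ys. residue_class p a) - (if p mod 4 = 1 then 0 else (\<Sum>a\<leftarrow>ys. int (multiplicity p a))))"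
      if "0 \<notin> set ys" for ys
      using that residue_class_parity[OF p] by (induction ys) (auto split: if_splits)
    from this[OF nz] residue_class_parity[OF p d(1)] show ?thesis
      unfolding defect_def mult_d[OF p] by (auto split: if_splits)
  qed
  have "S \<subseteq> {p. p dvd prod_list xs}"
  proof (rule subsetI, rule ccontr)
    fix p assume p: "p \<in> S" "p \<notin> {p. p dvd prod_list xs}"
    have "a dvd prod_list ys" if "a \<in> set ys" for a :: int and ys
      using that by (induction ys) auto
    then have "multiplicity p a = 0" if "a \<in> set xs" for a
      using that p(2) dvd_trans[of p a] by (intro not_dvd_imp_multiplicity_0) blast
    moreover have "multiplicity p d = 0"
      using p by (intro not_dvd_imp_multiplicity_0) (auto simp: d_def)
    ultimately have "defect p = 0"
      by (simp add: defect_def residue_class_def cong: map_cong)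
    then show False using p by (simp add: S_def)
  qed
  then have finS: "finite S" using prod_nz finite_divisors_int by (auto intro: finite_subset)
  have S: "prime p \<and> p > 2" if "p \<in> S" for p using that by (simp add: S_def)
  \<comment> \<open>An additional prime congruent to 3 modulo 4 corrects the product to 1, so that
    its negative is 3 modulo 4. The algebra will be kept unramified at this prime.\<close>
  obtain S' where S': "finite S'" "\<And>p. p \<in> S' \<Longrightarrow> prime p \<and> p > 2" "S \<subseteq> S'" "\<Prod>S' mod 4 = 1"
  proof (cases "\<Prod>S mod 4 = 1")
    case True
    then show ?thesis using that[of S] finS S by blast
  next
    case False
    obtain q where q: "prime q" "q mod 4 = 3" "q \<notin> S" using prime_mod_4_3_not_in[OF finS S] .
    have "q \<noteq> 2" using q(2) by auto
    then have "q > 2" using prime_ge_2_int[OF q(1)] by simp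
    have "(\<Prod>S) mod 4 = 3"
      using Legendre_prod_primes[OF finS S q(1) \<open>q > 2\<close> q(3), of 1] False by simp
    then have "\<Prod>(insert q S) mod 4 = 1"
      using finS q mod_mult_eq[of q 4 "\<Prod>S"] by simp
    then show ?thesis using that[of "insert q S"] finS S q(1) \<open>q > 2\<close> by auto
  qed
  \<comment> \<open>The sign of y. With x positive, the form d <x, y, xy> is definite for y positive
    and has two entries of sign opposite to d for y negative.\<close>
  define \<tau> :: int where "\<tau> = (if k = 0 \<or> k = 3 then 1 else - 1)"
  have \<tau>: "\<tau> = 1 \<or> \<tau> = - 1" by (simp add: \<tau>_def)
  \<comment> \<open>The factor \<open>Legendre (- \<tau>) p\<close> passes from n to -y: the symbol
    of -y becomes -1 on \<open>S\<close> and 1 on the rest of \<open>S'\<close>.\<close>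
  define \<epsilon> where "\<epsilon> p = (if p \<in> S then - 1 else 1) * Legendre (- \<tau>) p" for p
  have tau_symbol: "Legendre (- \<tau>) p = 1 \<or> Legendre (- \<tau>) p = - 1" if "prime p" for p
    using \<tau> that not_prime_unit[of p] by (intro Legendre_values) auto
  then have eps: "\<epsilon> p = 1 \<or> \<epsilon> p = - 1" if "p \<in> S'" for p
    using S'(2)[OF that] by (auto simp: \<epsilon>_def)
  have mod3: "(- 1 * \<Prod>S') mod 4 = 3" using S'(4) by presburger
  obtain n where n: "n > 0" "\<And>p. p \<in> S' \<Longrightarrow> Legendre n p = \<epsilon> p"
    "\<And>l. prime l \<Longrightarrow> l > 2 \<Longrightarrow> odd (multiplicity l n) \<Longrightarrow> Legendre (- 1 * \<Prod>S') l = 1"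
    using prescribed_Legendre_symbols[of S' "-1" \<epsilon>] S'(1,2) mod3 eps by blast
  define x where "x = \<Prod>S'"
  define y where "y = \<tau> * n"
  have x: "x > 0" unfolding x_def using S'(2) by (intro prod_pos) fastforce
  have y: "y \<noteq> 0" "y > 0 \<longleftrightarrow> \<tau> = 1" using n(1) \<tau> by (auto simp: y_def)
  have mult_y: "multiplicity p y = multiplicity p n" for p using \<tau> by (auto simp: y_def multiplicity_minus)
  have mult_x: "multiplicity p x = (if p \<in> S' then 1 else 0)" if p: "prime p" for p
  proof (cases "p \<in> S'")
    case True
    have "\<not> p dvd \<Prod>(S' - {p})"
    proof
      assume "p dvd \<Prod>(S' - {p})"
      then obtain q where "q \<in> S' - {p}" "p dvd q"
        using prime_dvd_prod_iff[of "S' - {p}" p "\<lambda>q. q"] S'(1) p by auto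
      then show False using S'(2) primes_dvd_imp_eq p by blast
    qed
    moreover have "x = p ^ 1 * \<Prod>(S' - {p})"
      using True S'(1) by (simp add: x_def prod.remove)
    ultimately have "multiplicity p x = 1" by (rule unit_part_eqI(1)[OF p])
    then show ?thesis using True by simp
  next
    case False
    have "\<not> p dvd x"
    proof
      assume "p dvd x"
      then obtain q where "q \<in> S'" "p dvd q"
        using prime_dvd_prod_iff[of S' p "\<lambda>q. q"] S'(1) p by (auto simp: x_def)
      then show False using S'(2) primes_dvd_imp_eq p False by blast
    qed
    then show ?thesis using False by (simp add: not_dvd_imp_multiplicity_0)
  qed
  define R where "R p = residue_class p (d * x) + residue_class p (d * y) + residue_class p (d * x * y)" for p
  have R: "4 dvd R p + defect p + residue_class p d" if p: "prime p" "p > 2" for p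
  proof -
    note ternary = residue_class_ternary[OF p d(1) less_imp_neq[OF x, symmetric] y(1), folded R_def]
    have def: "4 dvd defect p" if "p \<notin> S" using that p by (simp add: S_def)
    have plus: "4 dvd R p + defect p + residue_class p d" if "4 dvd R p + residue_class p d" "4 dvd defect p"
      using dvd_add[OF that] by (simp add: algebra_simps)
    show ?thesis
    proof (cases "p \<in> S'")
      case False
      then have even_x: "even (multiplicity p x)" using mult_x[OF p(1)] by simp
      have "p \<notin> S" using False S'(3) by blast
      have "4 dvd R p + residue_class p d"
      proof (cases "even (multiplicity p y)")
        case True
        then show ?thesis by (rule ternary(1)[OF even_x])
      next
        case odd: False
        have nd: "\<not> p dvd - x"
        proof
          assume "p dvd - x"
          then have "p dvd x" by simp
          moreover have "x \<noteq> 0" "\<not> is_unit p" using x p(1) not_prime_unit by (simp, blast)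
          ultimately have "multiplicity p x > 0" using multiplicity_gt_zero_iff by blast
          then show False using mult_x[OF p(1)] False by simp
        qed
        \<comment> \<open>Here p divides n to an odd power, so by the choice of n the unit -x is a
          square modulo p, and the algebra splits at p.\<close>
        have "unit_symbol p (- x) = Legendre (- x) p"
          using unit_symbol_eqI[OF p(1) nd, of "- x" 0] by simp
        also have "\<dots> = 1" using n(3)[OF p] odd mult_y by (simp add: x_def)
        finally show ?thesis by (rule ternary(2)[OF even_x odd])
      qed
      then show ?thesis using plus def \<open>p \<notin> S\<close> by blast
    next
      case True
      then have odd_x: "odd (multiplicity p x)" using mult_x[OF p(1)] by simp
      have Leg: "Legendre (- y) p = (if p \<in> S then - 1 else 1)"
        using Legendre_mult[OF p, of "- \<tau>" n] n(2)[OF True] tau_symbol[OF p(1)]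
        by (auto simp: y_def \<epsilon>_def)
      have nd: "\<not> p dvd - y" using Leg Legendre_eq_0_iff[of "- y" p] by (auto split: if_splits)
      then have even_y: "even (multiplicity p y)" by (simp add: not_dvd_imp_multiplicity_0)
      have sym: "unit_symbol p (- y) = (if p \<in> S then - 1 else 1)"
        using unit_symbol_eqI[OF p(1) nd, of "- y" 0] Leg by simp
      show ?thesis
      proof (cases "p \<in> S")
        case False
        then show ?thesis using plus def ternary(3)[OF odd_x even_y] sym by simp
      next
        case inS: True
        then have "4 dvd R p + residue_class p d + 2" using ternary(4)[OF odd_x even_y] sym by simp
        moreover have "4 dvd defect p - 2"
        proof -
          have "\<not> 4 dvd defect p" using inS by (simp add: S_def)
          moreover have "even t \<Longrightarrow> \<not> 4 dvd t \<Longrightarrow> 4 dvd t - 2" for t :: int by presburger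
          ultimately show ?thesis using even_defect[OF p(1)] by blast
        qed
        ultimately have "4 dvd (R p + residue_class p d + 2) + (defect p - 2)" by (rule dvd_add)
        then show ?thesis by (simp add: algebra_simps)
      qed
    qed
  qed
  show ?thesis
  proof (rule that[of "d * x" "d * y" "d * x * y"])
    show "0 \<notin> set [d * x, d * y, d * x * y]" using d(1) x y(1) by simp
    have "k = 0 \<or> k = 1 \<or> k = 2 \<or> k = 3" using k by linarith
    then show "length (filter (\<lambda>a. a > 0) [d * x, d * y, d * x * y]) = k"
      using d x y by (elim disjE) (auto simp: zero_less_mult_iff mult_less_0_iff \<tau>_def not_less)
    show "\<forall>p. prime p \<longrightarrow> 2 dvd (\<Sum>a\<leftarrow>[d * x, d * y, d * x * y] @ xs. int (multiplicity p a))"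
      using d(1) x y(1) mult_d by (simp add: multiplicity_prime_mult)
    show "\<forall>p. prime p \<longrightarrow> p > 2 \<longrightarrow> 4 dvd (\<Sum>a\<leftarrow>[d * x, d * y, d * x * y] @ xs. residue_class p a)"
      using R by (simp add: R_def defect_def algebra_simps)
  qed
qed

subsection \<open>Matrices\<close>

lemma congruence_by_diagonal_index:
  fixes P :: "'a::field mat"
  assumes P: "P \<in> carrier_mat L n" and "j < n" "k < n"
  shows "(transpose_mat P * (mat_diag L f * P)) $$ (j, k) = (\<Sum>i<L. f i * P $$ (i, j) * P $$ (i, k))"
proof -
  have "(transpose_mat P * (mat_diag L f * P)) $$ (j, k)
      = (\<Sum>i = 0..<L. P $$ (i, j) * (f i * P $$ (i, k)))"
    unfolding mat_diag_mult_left[OF P] using assms by (simp add: scalar_prod_def)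
  then show ?thesis by (simp add: lessThan_atLeast0 mult_ac)
qed

lemma represents_iff_mat:
  fixes A :: "'a::field mat"
  assumes A: "A \<in> carrier_mat n n"
  shows "represents xs n (\<lambda>j k. A $$ (j, k)) \<longleftrightarrow>
     (\<exists>P \<in> carrier_mat (length xs) n. transpose_mat P * (mat_diag (length xs) ((!) xs) * P) = A)"
proof
  assume "represents xs n (\<lambda>j k. A $$ (j, k))"
  then obtain P where P: "\<forall>j<n. \<forall>k<n. (\<Sum>i<length xs. xs ! i * P i j * P i k) = A $$ (j, k)"
    by (rule representsE)
  let ?P = "mat (length xs) n (\<lambda>(i, j). P i j)"
  have PC: "?P \<in> carrier_mat (length xs) n" by simp
  have "transpose_mat ?P * (mat_diag (length xs) ((!) xs) * ?P) = A"
  proof (rule eq_matI)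
    fix j k assume "j < dim_row A" "k < dim_col A"
    then have jk: "j < n" "k < n" using A by auto
    show "(transpose_mat ?P * (mat_diag (length xs) ((!) xs) * ?P)) $$ (j, k) = A $$ (j, k)"
      unfolding congruence_by_diagonal_index[OF PC jk] using P jk by simp
  qed (use A in auto)
  then show "\<exists>P \<in> carrier_mat (length xs) n. transpose_mat P * (mat_diag (length xs) ((!) xs) * P) = A"
    using PC by blast
next
  assume "\<exists>P \<in> carrier_mat (length xs) n. transpose_mat P * (mat_diag (length xs) ((!) xs) * P) = A"
  then obtain P where P: "P \<in> carrier_mat (length xs) n"
    "transpose_mat P * (mat_diag (length xs) ((!) xs) * P) = A" by blast
  show "represents xs n (\<lambda>j k. A $$ (j, k))"
    by (rule representsI[where P = "\<lambda>i j. P $$ (i, j)"])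
      (simp add: congruence_by_diagonal_index[OF P(1)] P(2)[symmetric])
qed

lemma represents_congruent:
  fixes A :: "'a::field mat"
  assumes A: "A \<in> carrier_mat n n" and Q: "Q \<in> carrier_mat n n"
    and rep: "represents xs n (\<lambda>j k. A $$ (j, k))"
  shows "represents xs n (\<lambda>j k. (transpose_mat Q * A * Q) $$ (j, k))"
proof -
  let ?L = "length xs" and ?D = "mat_diag (length xs) ((!) xs)"
  obtain P where P: "P \<in> carrier_mat ?L n" "transpose_mat P * (?D * P) = A"
    using rep represents_iff_mat[OF A] by blast
  have D: "?D \<in> carrier_mat ?L ?L" by simp
  have PT: "transpose_mat P \<in> carrier_mat n ?L" and QT: "transpose_mat Q \<in> carrier_mat n n"
    using P(1) Q by simp_all
  have DP: "?D * P \<in> carrier_mat ?L n" using D P(1) by (rule mult_carrier_mat)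
  have "transpose_mat (P * Q) * (?D * (P * Q)) = (transpose_mat Q * transpose_mat P) * ((?D * P) * Q)"
    using assoc_mult_mat[OF D P(1) Q] transpose_mult[OF P(1) Q] by simp
  also have "\<dots> = transpose_mat Q * (transpose_mat P * ((?D * P) * Q))"
    by (rule assoc_mult_mat[OF QT PT mult_carrier_mat[OF DP Q]])
  also have "transpose_mat P * ((?D * P) * Q) = A * Q"
    using assoc_mult_mat[OF PT DP Q] P(2) by simp
  also have "transpose_mat Q * (A * Q) = transpose_mat Q * A * Q"
    by (rule assoc_mult_mat[OF QT A Q, symmetric])
  finally show ?thesis
    using represents_iff_mat[of "transpose_mat Q * A * Q" n xs] A Q QT mult_carrier_mat[OF P(1) Q]
    by (auto intro!: mult_carrier_mat)
qed

lemma det_mat_diag: "det (mat_diag n f) = (\<Prod>i<n. f i :: 'a :: comm_ring_1)"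
proof -
  have "upper_triangular (mat_diag n f)" by (auto simp: mat_diag_def)
  then have "det (mat_diag n f) = prod_list (diag_mat (mat_diag n f))"
    by (rule det_upper_triangular[OF _ mat_diag_dim])
  also have "diag_mat (mat_diag n f) = map f [0..<n]"
    by (auto simp: diag_mat_def mat_diag_def)
  also have "prod_list \<dots> = (\<Prod>i<n. f i)"
    by (induction n) (auto simp: mult.commute)
  finally show ?thesis .
qed

lemma represents_nondegenerate:
  fixes A :: "'a::field mat"
  assumes A: "A \<in> carrier_mat n n" "det A \<noteq> 0" and "length xs = n"
    and rep: "represents xs n (\<lambda>j k. A $$ (j, k))"
  shows "0 \<notin> set xs"
proof -
  obtain P where P: "P \<in> carrier_mat n n" "transpose_mat P * (mat_diag n ((!) xs) * P) = A"
    using rep represents_iff_mat[OF A(1)] assms(3) by blast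
  have "det A = det (transpose_mat P) * (det (mat_diag n ((!) xs)) * det P)"
  proof -
    have D: "mat_diag n ((!) xs) \<in> carrier_mat n n" and PT: "transpose_mat P \<in> carrier_mat n n"
      using P(1) by simp_all
    show ?thesis
      unfolding P(2)[symmetric] det_mult[OF PT mult_carrier_mat[OF D P(1)]] det_mult[OF D P(1)] ..
  qed
  then have "(\<Prod>i<n. xs ! i) \<noteq> 0" using A(2) by (auto simp: det_mat_diag)
  then show ?thesis using assms(3) by (auto simp: in_set_conv_nth)
qed

lemma invertible_mat_det_nonzero:
  fixes P :: "'a::field mat"
  assumes P: "P \<in> carrier_mat n n" "invertible_mat P"
  shows "det P \<noteq> 0"
proof -
  obtain B where B: "P * B = 1\<^sub>m (dim_row P)" "B * P = 1\<^sub>m (dim_row B)"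
    using P(2) unfolding invertible_mat_def inverts_mat_def by blast
  have "dim_col B = n" "dim_row B = n"
    using arg_cong[OF B(1), of dim_col] arg_cong[OF B(2), of dim_col] P(1) by auto
  then have "B \<in> carrier_mat n n" by (intro carrier_matI)
  with P(1) have "det (P * B) = det P * det B" by (rule det_mult)
  then have "det P * det B = 1" unfolding B(1) by simp
  then show ?thesis by auto
qed

text \<open>The rational diagonalization and the real normal form are congruent over the reals; a
  nonzero determinant leaves no zero entry in either, and inertia compares the numbers of positive
  entries.\<close>

theorem signature_of_diagonalization:
  fixes A :: "rat mat"
  assumes A: "A \<in> carrier_mat n n" "det A \<noteq> 0" and sig: "has_signature A r s"
    and xs: "length xs = n" "represents xs n (\<lambda>j k. A $$ (j, k))"
  shows "r + s = n" "length (filter (\<lambda>x. x > 0) xs) = r"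
proof -
  let ?A = "map_mat (of_rat :: rat \<Rightarrow> real) A"
  define f :: "nat \<Rightarrow> real" where "f i = (if i < r then 1 else if i < r + s then - 1 else 0)" for i
  have AC: "?A \<in> carrier_mat n n" using A(1) by simp
  have J: "mat n n (\<lambda>(i, j). if i = j then (if i < r then 1 else if i < r + s then - 1 else 0) else (0 :: real))
      = mat_diag n f" by (auto simp: mat_diag_def f_def)
  have dim: "dim_row A = n" using A(1) by simp
  obtain Q where rs: "r + s \<le> n" and Q: "Q \<in> carrier_mat n n" "invertible_mat Q"
    "transpose_mat Q * ?A * Q = mat_diag n f"
    using sig unfolding has_signature_def Let_def dim J by (elim conjE bexE)
  have detA: "det ?A \<noteq> 0" using A(2) by simp
  have "(\<Prod>i<n. f i) = det (transpose_mat Q) * det ?A * det Q"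
    unfolding det_mat_diag[symmetric] Q(3)[symmetric] using Q(1) AC
    by (subst det_mult[of _ n], simp, simp, subst det_mult[of _ n]) auto
  then have "(\<Prod>i<n. f i) \<noteq> 0"
    using detA invertible_mat_det_nonzero[OF Q(1,2)] det_transpose[OF Q(1)] by simp
  \<comment> \<open>The first zero of the normal form would stand at index r + s.\<close>
  then have "f (r + s) \<noteq> 0 \<or> \<not> r + s < n" by auto
  then show rsn: "r + s = n" using rs by (auto simp: f_def)
  obtain P where P: "\<forall>j<n. \<forall>k<n. (\<Sum>i<length xs. xs ! i * P i j * P i k) = A $$ (j, k)"
    using representsE[OF xs(2)] .
  let ?xs = "map real_of_rat xs"
  have "represents ?xs n (\<lambda>j k. ?A $$ (j, k))"
  proof (rule representsI[where P = "\<lambda>i j. real_of_rat (P i j)"])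
    fix j k assume jk: "j < n" "k < n"
    have "?A $$ (j, k) = real_of_rat (\<Sum>i<length xs. xs ! i * P i j * P i k)"
      using P jk A(1) by simp
    also have "\<dots> = (\<Sum>i<length xs. real_of_rat (xs ! i) * real_of_rat (P i j) * real_of_rat (P i k))"
      by (simp add: of_rat_sum of_rat_mult)
    finally show "(\<Sum>i<length ?xs. ?xs ! i * real_of_rat (P i j) * real_of_rat (P i k)) = ?A $$ (j, k)"
      by simp
  qed
  from represents_congruent[OF AC Q(1) this]
  have rep: "represents ?xs n (\<lambda>j k. mat_diag n f $$ (j, k))" unfolding Q(3) .
  have "embeds ?xs (replicate r 1 @ replicate s (- 1))"
  proof -
    obtain R where R: "\<forall>j<n. \<forall>k<n. (\<Sum>i<length ?xs. ?xs ! i * R i j * R i k) = mat_diag n f $$ (j, k)"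
      using representsE[OF rep] .
    show ?thesis
    proof (rule embedsI[where P = R])
      fix j k assume "j < length (replicate r 1 @ replicate s (- 1 :: real))"
        "k < length (replicate r 1 @ replicate s (- 1 :: real))"
      then have jk: "j < n" "k < n" using rsn by simp_all
      then have "mat_diag n f $$ (j, k)
          = (if j = k then (replicate r 1 @ replicate s (- 1)) ! j else 0)"
        using rsn by (auto simp: mat_diag_def f_def nth_append)
      then show "(\<Sum>i<length ?xs. ?xs ! i * R i j * R i k)
          = (if j = k then (replicate r 1 @ replicate s (- 1)) ! j else 0)"
        using R jk by simp
    qed
  qed
  moreover have "0 \<notin> set ?xs" using represents_nondegenerate[OF A xs] by auto
  ultimately have "length (filter (\<lambda>x. x > 0) ?xs) = r"
    using rsn xs(1) by (intro sylvester_inertia) auto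
  then show "length (filter (\<lambda>x. x > 0) xs) = r" by (simp add: filter_map o_def)
qed

text \<open>For x = u / v with v positive, x is the integer u v of the same sign times the square of
  1 / v.\<close>

lemma rational_form_scaled_to_integers:
  fixes xs :: "rat list"
  assumes "0 \<notin> set xs"
  shows "\<exists>zs. 0 \<notin> set zs \<and> length zs = length xs \<and> embeds (rat_form zs) xs \<and>
     length (filter (\<lambda>a. a > 0) zs) = length (filter (\<lambda>a. a > 0) xs)"
  using assms
proof (induction xs)
  case Nil
  then show ?case by (intro exI[of _ "[]"]) (simp add: embeds_refl)
next
  case (Cons x xs)
  then obtain zs where zs: "0 \<notin> set zs" "length zs = length xs" "embeds (rat_form zs) xs"
     "length (filter (\<lambda>a. a > 0) zs) = length (filter (\<lambda>a. a > 0) xs)" by auto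
  obtain u v where uv: "quotient_of x = (u, v)" by (cases "quotient_of x")
  have v: "v > 0" and x: "x = of_int u / of_int v"
    using quotient_of_denom_pos[OF uv] quotient_of_div[OF uv] by auto
  have eq: "rat_of_int (u * v) * (1 / rat_of_int v) * (1 / rat_of_int v) = x"
    using v x by simp
  have "embeds (rat_of_int (u * v) # rat_form zs) (x # rat_form zs)"
    using embeds_square[of "rat_of_int (u * v)" "rat_form zs" "1 / rat_of_int v"] unfolding eq .
  then have "embeds (rat_form ((u * v) # zs)) (x # xs)"
    using embeds_trans[OF _ embeds_Cons[OF zs(3)]] by simp
  moreover have "u * v > 0 \<longleftrightarrow> x > 0" "u * v \<noteq> 0"
    using v x Cons.prems by (auto simp: zero_less_mult_iff zero_less_divide_iff)
  ultimately show ?case using zs by (intro exI[of _ "(u * v) # zs"]) auto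
qed

lemma sign_diag_mat_diag:
  "sign_diag (r + s) r s (mat_diag (r + s) ((!) (rat_form (replicate r 1 @ replicate s (- 1)))))"
proof -
  let ?l = "rat_form (replicate r 1 @ replicate s (- 1))"
  let ?D = "mat_diag (r + s) ((!) ?l)"
  have entry: "?D $$ (i, i) = (if i < r then 1 else - 1)" if "i < r + s" for i
    using that by (simp add: mat_diag_def nth_append)
  have "{i. i < r + s \<and> ?D $$ (i, i) = 1} = {..<r}"
    using entry by (auto split: if_splits)
  moreover have "{i. i < r + s \<and> ?D $$ (i, i) = - 1} = {r..<r + s}"
    using entry by (auto split: if_splits)
  moreover have "diagonal_mat ?D" by (auto simp: diagonal_mat_def mat_diag_def)
  ultimately show ?thesis using entry by (auto simp: sign_diag_def)
qed

text \<open>Injectivity comes from the factorization of \<open>A\<close> through \<open>M\<close>: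
  vectors with the same image under \<open>M\<close> differ by an element of the kernel of
  \<open>A\<close>, which is zero.\<close>

lemma isometric_embeddingI:
  fixes A :: "rat mat"
  assumes A: "A \<in> carrier_mat n n" "det A \<noteq> 0" and D: "D \<in> carrier_mat N N"
    and M: "M \<in> carrier_mat N n" and eq: "transpose_mat M * (D * M) = A"
  shows "isometric_embedding n A N D M"
proof -
  have MT: "transpose_mat M \<in> carrier_mat n N" using M by simp
  have Ax: "A *\<^sub>v x = transpose_mat M *\<^sub>v (D *\<^sub>v (M *\<^sub>v x))" if x: "x \<in> carrier_vec n" for x
  proof -
    have "A *\<^sub>v x = transpose_mat M *\<^sub>v ((D * M) *\<^sub>v x)"
      unfolding eq[symmetric] by (rule assoc_mult_mat_vec[OF MT mult_carrier_mat[OF D M] x])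
    then show ?thesis using assoc_mult_mat_vec[OF D M x] by simp
  qed
  have "inj_on (\<lambda>x. M *\<^sub>v x) (carrier_vec n)"
  proof (rule inj_onI)
    fix x y assume x: "x \<in> carrier_vec n" and y: "y \<in> carrier_vec n" and xy: "M *\<^sub>v x = M *\<^sub>v y"
    have "A *\<^sub>v (x - y) = A *\<^sub>v x - A *\<^sub>v y" by (rule mult_minus_distrib_mat_vec[OF A(1) x y])
    also have "A *\<^sub>v x = A *\<^sub>v y" unfolding Ax[OF x] Ax[OF y] xy ..
    also have "A *\<^sub>v y - A *\<^sub>v y = 0\<^sub>v n"
      by (rule minus_cancel_vec[OF mult_mat_vec_carrier[OF A(1) y]])
    finally have "A *\<^sub>v (x - y) = 0\<^sub>v n" .
    moreover have "x - y \<in> carrier_vec n" using x y by (rule minus_carrier_vec)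
    ultimately have "x - y = 0\<^sub>v n" using A(2) det_0_iff_vec_prod_zero_field[OF A(1)] by blast
    then have "x $ i = y $ i" if "i < n" for i
      using that x y index_minus_vec(1)[of i y x] by simp
    then show "x = y" using x y by (intro eq_vecI) auto
  qed
  moreover have "(M *\<^sub>v x) \<bullet> (D *\<^sub>v (M *\<^sub>v x)) = x \<bullet> (A *\<^sub>v x)" if x: "x \<in> carrier_vec n" for x
  proof -
    let ?w = "D *\<^sub>v (M *\<^sub>v x)"
    have Mx: "M *\<^sub>v x \<in> carrier_vec N" and w: "?w \<in> carrier_vec N"
      using M D x by (auto intro: mult_mat_vec_carrier)
    have "(M *\<^sub>v x) \<bullet> ?w = ?w \<bullet> (M *\<^sub>v x)" by (rule comm_scalar_prod[OF Mx w])
    also have "\<dots> = (transpose_mat M *\<^sub>v ?w) \<bullet> x"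
      by (rule transpose_vec_mult_scalar[OF M x w, symmetric])
    also have "\<dots> = x \<bullet> (A *\<^sub>v x)"
      unfolding Ax[OF x] by (rule comm_scalar_prod[OF mult_mat_vec_carrier[OF MT w] x])
    finally show ?thesis .
  qed
  ultimately show ?thesis using M by (simp add: isometric_embedding_def)
qed

theorem mainTheorem7:
  fixes n r s :: nat and A :: "rat mat"
  assumes "lattice_form n A"
    and "nondegenerate_form A"
    and "has_signature A r s"
  shows "\<forall>k \<le> 3. \<exists>D M. sign_diag (n + 3) (r + k) (s + (3 - k)) D \<and>
           isometric_embedding n A (n + 3) D M"
proof (intro allI impI)
  fix k :: nat assume k: "k \<le> 3"
  have A: "A \<in> carrier_mat n n" "det A \<noteq> 0" and sym: "transpose_mat A = A"
    using assms(1,2) by (auto simp: lattice_form_def nondegenerate_form_def)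
  have "A $$ (i, j) = A $$ (j, i)" if "i < n" "j < n" for i j
    using that A(1) arg_cong[OF sym, of "\<lambda>B. B $$ (i, j)"] by simp
  then obtain xs where xs: "length xs = n" "represents xs n (\<lambda>j k. A $$ (j, k))"
    using symmetric_form_diagonalizable[of n "\<lambda>j k. A $$ (j, k)"] by blast
  note sig = signature_of_diagonalization[OF A assms(3) xs]
  obtain zs where zs: "0 \<notin> set zs" "length zs = n" "embeds (rat_form zs) xs"
     "length (filter (\<lambda>a. a > 0) zs) = r"
    using rational_form_scaled_to_integers[OF represents_nondegenerate[OF A xs]] xs(1) sig(2) by auto
  obtain b1 b2 b3 where b: "0 \<notin> set [b1, b2, b3]" "length (filter (\<lambda>a. a > 0) [b1, b2, b3]) = k"
    "\<forall>p. prime p \<longrightarrow> 2 dvd (\<Sum>a\<leftarrow>[b1, b2, b3] @ zs. int (multiplicity p a))"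
    "\<forall>p. prime p \<longrightarrow> p > 2 \<longrightarrow> 4 dvd (\<Sum>a\<leftarrow>[b1, b2, b3] @ zs. residue_class p a)"
    using complementary_ternary_form[OF zs(1) k] .
  let ?N = "(r + k) + (s + (3 - k))"
  let ?l = "replicate (r + k) 1 @ replicate (s + (3 - k)) (- 1) :: int list"
  have N: "?N = n + 3" using sig(1) k by simp
  have "isometric_forms ?l ([b1, b2, b3] @ zs)"
  proof (rule isometric_to_signs_if_residues_vanish)
    show "0 \<notin> set ([b1, b2, b3] @ zs)" using b(1) zs(1) by auto
    show "length ([b1, b2, b3] @ zs) = (r + k) + (s + (3 - k))" using N zs(2) by simp
    show "length (filter (\<lambda>a. a > 0) ([b1, b2, b3] @ zs)) = r + k"
      using b(2) zs(4) unfolding filter_append length_append by simp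
  qed (use b(3,4) in blast)+
  then have "embeds (rat_form ?l) (rat_form [b1, b2, b3] @ rat_form zs)"
    by (simp add: isometric_forms_def)
  \<comment> \<open>The ternary form has done its work; restricting the isometry to its orthogonal
    complement leaves the given form inside the sum of signed squares.\<close>
  then have "embeds (rat_form ?l) (rat_form zs)" by (rule embeds_drop_append)
  then have "represents (rat_form ?l) n (\<lambda>j k. A $$ (j, k))"
    using embeds_represents[OF embeds_trans[OF _ zs(3)] xs(2)] by blast
  moreover have len: "length (rat_form ?l) = ?N" by simp
  ultimately obtain M where M: "M \<in> carrier_mat ?N n"
    "transpose_mat M * (mat_diag ?N ((!) (rat_form ?l)) * M) = A"
    using represents_iff_mat[OF A(1), of "rat_form ?l"] unfolding len by blast
  have "isometric_embedding n A ?N (mat_diag ?N ((!) (rat_form ?l))) M"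
    by (rule isometric_embeddingI[OF A _ M]) simp
  then show "\<exists>D M. sign_diag (n + 3) (r + k) (s + (3 - k)) D \<and> isometric_embedding n A (n + 3) D M"
    using sign_diag_mat_diag[of "r + k" "s + (3 - k)"] unfolding N by blast
qed

end
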